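(* Let $\ell\in[0,1)$, $\theta>0$, $\tau\ge0$, $T>0$, and consider the Cauchy problem $$u_t-u_{xxt}+u-u_{xx}+uu_x=f,\quad (x,t)\in\mathbb{R}\times\mathbb{R}_+,\qquad u(x,0)=\phi(x).\qquad (\ast)$$ There exists $\delta>0$ such that the following hold for every forcing term $f$ with $f(t)=f(\cdot,t)\in L^2(\mathbb{R})$ for all $t\ge0$ that is time-periodic with period $\theta$, i.e. $f(t+\theta)=f(t)$ for all $t\ge0$. (1) If $\phi\in H^\ell(\mathbb{R})$ and $f$ satisfy $\|\phi\|_{H^\ell}+\sup_{t\ge0}\|f(t)\|_{L^2(\mathbb{R})}\le\delta$, then there exists an initial datum $\tilde\phi\in H^\ell(\mathbb{R})$ such that the solution $\tilde u$ of $(\ast)$ with $\tilde u(\cdot,0)=\tilde\phi$ is time-periodic with period $\theta$, with $\tilde u(t)\in H^\ell(\mathbb{R})$ for all $t\ge 0$, and this periodic solution is unique. (2) Moreover, if $\delta$ is sufficiently small, there exist $N_0\in\mathbb{N}$ and $\gamma_0=\gamma_0(N_0)>0$ such that $\tilde u$ is locally stable in $H^\ell(\mathbb{R})$ with exponential decay rate $2\gamma_0$: for every $u_0\in H^\ell(\mathbb{R})$ sufficiently close to $\tilde\phi$ in $H^\ell(\mathbb{R})$, the solution $u$ of $(\ast)$ with $u(\cdot,0)=u_0$ satisfies $\|u(t)-\tilde u(t)\|_{H^\ell}\le K e^{-2\gamma_0 t}$ for all $t\ge0$, for some constant $K$. (3) For an initial value $\phi\in H^\ell(\mathbb{R})$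 of any size, if $\sup_{t\in[0,\infty)}\|f(t)\|_{L^2(\mathbb{R})}<\delta$, then one can find $N_1\in\mathbb{N}$ and $\gamma_1=\gamma_1(N_1)>0$ such that global stability holds with decay rate $2\gamma_1$: the solution $u$ of $(\ast)$ with $u(\cdot,0)=\phi$ satisfies $\|u(t)-\tilde u(t)\|_{H^\ell}\le K e^{-2\gamma_1 t}$ for all $t\ge0$, for some constant $K$.
   Context: The forcing $f$ is a (strongly measurable) map $t\mapsto f(t)\in L^2(\mathbb{R})$, $t\ge0$. Solutions are understood in the mild sense, with values continuous in time in $H^\ell(\mathbb{R})$: with $uu_x=\tfrac12(u^2)_x$, $$u(t)=e^{-t}u(0)+\int_0^t e^{-(t-s)}(1-\partial_{xx})^{-1}\big(f(s)-\tfrac12\partial_x(u(s)^2)\big)\,ds .$$ Stability (with $X=H^\ell(\mathbb{R})$): a solution $\tilde u$ is locally stable if the solution $u(t)$ generated by $u_0\in X$ converges to $\tilde u(t)$ in $X$ as $t\to\infty$ (i.e. $\|u(t)-\tilde u(t)\|_X\to0$) whenever $u_0$ is sufficiently close to $\tilde u(0)$ in $X$; it is globally stable if this convergence holds for every $u_0\in X$, no matter how far $u_0$ is from $\tilde u(0)$. The fixed numbers $\tau\ge0,T>0$ enter only through the smallness threshold $\delta$, which is in particular taken such that $(\ast)$ is well-posed in $H^\ell(\mathbb{R})$ for $\|\phi\|_{H^\ell}+\sup_{t\ge0}\|f(t)\|_{L^2}\le\delta$, with $\sup_{\tau\le s\le\tau+T}\|u(s)\|_{H^\ell}+\big(\int_\tau^{\tau+T}\|u(s)\|_{H^\ell}^2ds\big)^{1/2}\le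 C\big(\|\phi\|_{H^\ell}+\sup_{t\ge0}\|f(t)\|_{L^2}\big)$. The integers $N_0,N_1$ are frequency-truncation parameters, on which the decay constants $\gamma_0,\gamma_1$ may depend. *)

theory Defs
  imports "HOL-Analysis.Analysis"
begin

section \<open>The Hilbert space of square-integrable functions on the line\<close>

text \<open>
  Square-integrable functions modulo equality almost everywhere, as a type. It is shown to be a
  separable Hilbert space, so that the library's Bochner integral applies to functions with values
  in it, and so that strong measurability of such functions is Borel measurability.
\<close>

definition sq_integrable :: "(real \<Rightarrow> 'a::euclidean_space) \<Rightarrow> bool" where
  "sq_integrable f \<longleftrightarrow>
     f \<in> borel_measurable lborel \<and> integrable lborel (\<lambda>x. (norm (f x))\<^sup>2)"

definition l2_rel :: "(real \<Rightarrow> 'a::euclidean_space) \<Rightarrow> (real \<Rightarrow> 'a) \<Rightarrow> bool" where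
  "l2_rel f g \<longleftrightarrow> sq_integrable f \<and> sq_integrable g \<and> (AE x in lborel. f x = g x)"

lemma sq_integrable_0 [simp]: "sq_integrable (\<lambda>_. 0)"
  by (simp add: sq_integrable_def)

lemma sq_integrable_meas [measurable_dest]: "sq_integrable f \<Longrightarrow> f \<in> borel_measurable lborel"
  by (simp add: sq_integrable_def)

lemma sq_integrable_bound:
  assumes "integrable lborel w" and "f \<in> borel_measurable lborel"
    and "AE x in lborel. (norm (f x))\<^sup>2 \<le> w x"
  shows "sq_integrable f"
  unfolding sq_integrable_def
proof
  show "f \<in> borel_measurable lborel" by fact
  show "integrable lborel (\<lambda>x. (norm (f x))\<^sup>2)"
  proof (rule Bochner_Integration.integrable_bound[OF assms(1)])
    show "(\<lambda>x. (norm (f x))\<^sup>2) \<in> borel_measurable lborel" using assms(2) by measurable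
    show "AE x in lborel. norm ((norm (f x))\<^sup>2) \<le> norm (w x)"
      using assms(3) by eventually_elim auto
  qed
qed

lemma norm_add_sq_le: "(norm (a + b))\<^sup>2 \<le> 2 * (norm (a::'a::real_normed_vector))\<^sup>2 + 2 * (norm b)\<^sup>2"
proof -
  have "(norm (a + b))\<^sup>2 \<le> (norm a + norm b)\<^sup>2"
    by (rule power_mono[OF norm_triangle_ineq]) simp
  also have "\<dots> \<le> 2 * (norm a)\<^sup>2 + 2 * (norm b)\<^sup>2"
    using sum_squares_bound[of "norm a" "norm b"] by (simp add: power2_sum)
  finally show ?thesis .
qed

lemma sq_integrable_add:
  assumes "sq_integrable f" "sq_integrable g" shows "sq_integrable (\<lambda>x. f x + g x)"
proof (rule sq_integrable_bound)
  show "integrable lborel (\<lambda>x. 2 * (norm (f x))\<^sup>2 + 2 * (norm (g x))\<^sup>2)"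
    using assms by (auto simp: sq_integrable_def)
  show "(\<lambda>x. f x + g x) \<in> borel_measurable lborel" using assms by (auto simp: sq_integrable_def)
qed (simp add: norm_add_sq_le)

lemma sq_integrable_scaleR:
  assumes "sq_integrable f" shows "sq_integrable (\<lambda>x. c *\<^sub>R f x)"
proof (rule sq_integrable_bound)
  show "integrable lborel (\<lambda>x. c\<^sup>2 * (norm (f x))\<^sup>2)"
    using assms by (auto simp: sq_integrable_def)
  show "(\<lambda>x. c *\<^sub>R f x) \<in> borel_measurable lborel" using assms by (auto simp: sq_integrable_def)
qed (simp add: power_mult_distrib)

lemma sq_integrable_uminus: "sq_integrable f \<Longrightarrow> sq_integrable (\<lambda>x. - f x)"
  using sq_integrable_scaleR[of f "-1"] by simp

lemma sq_integrable_diff: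
  "sq_integrable f \<Longrightarrow> sq_integrable g \<Longrightarrow> sq_integrable (\<lambda>x. f x - g x)"
  using sq_integrable_add[of f "\<lambda>x. - g x"] sq_integrable_uminus[of g] by simp

lemma integrable_inner_l2:
  assumes "sq_integrable f" "sq_integrable g"
  shows "integrable lborel (\<lambda>x. f x \<bullet> g x)"
proof (rule Bochner_Integration.integrable_bound)
  show "integrable lborel (\<lambda>x. (norm (f x))\<^sup>2 + (norm (g x))\<^sup>2)"
    using assms by (auto simp: sq_integrable_def)
  show "(\<lambda>x. f x \<bullet> g x) \<in> borel_measurable lborel" using assms by (auto simp: sq_integrable_def)
  have "\<bar>a \<bullet> b\<bar> \<le> (norm a)\<^sup>2 + (norm b)\<^sup>2" for a b :: 'a
    using Cauchy_Schwarz_ineq2[of a b] sum_squares_bound[of "norm a" "norm b"]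
      mult_nonneg_nonneg[OF norm_ge_zero[of a] norm_ge_zero[of b]] by linarith
  then show "AE x in lborel. norm (f x \<bullet> g x) \<le> norm ((norm (f x))\<^sup>2 + (norm (g x))\<^sup>2)"
    by (simp add: abs_of_nonneg)
qed

quotient_type (overloaded) 'a l2 = "real \<Rightarrow> 'a::euclidean_space" / partial: l2_rel
  morphisms rep_l2 abs_l2
proof (rule part_equivpI)
  show "\<exists>f::real \<Rightarrow> 'a. l2_rel f f" by (rule exI[of _ "\<lambda>_. 0"]) (simp add: l2_rel_def)
  show "symp (l2_rel :: (real \<Rightarrow> 'a) \<Rightarrow> _)" by (rule sympI) (auto simp: l2_rel_def)
  show "transp (l2_rel :: (real \<Rightarrow> 'a) \<Rightarrow> _)" by (rule transpI) (auto simp: l2_rel_def)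
qed

instantiation l2 :: (euclidean_space) real_inner
begin

lift_definition zero_l2 :: "'a l2" is "\<lambda>_. 0" by (simp add: l2_rel_def)

lift_definition plus_l2 :: "'a l2 \<Rightarrow> 'a l2 \<Rightarrow> 'a l2" is "\<lambda>f g x. f x + g x"
  by (auto simp: l2_rel_def sq_integrable_add)

lift_definition uminus_l2 :: "'a l2 \<Rightarrow> 'a l2" is "\<lambda>f x. - f x"
  by (auto simp: l2_rel_def sq_integrable_uminus)

lift_definition minus_l2 :: "'a l2 \<Rightarrow> 'a l2 \<Rightarrow> 'a l2" is "\<lambda>f g x. f x - g x"
  by (auto simp: l2_rel_def sq_integrable_diff)

lift_definition scaleR_l2 :: "real \<Rightarrow> 'a l2 \<Rightarrow> 'a l2" is "\<lambda>c f x. c *\<^sub>R f x"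
  by (auto simp: l2_rel_def sq_integrable_scaleR)

lift_definition inner_l2 :: "'a l2 \<Rightarrow> 'a l2 \<Rightarrow> real" is "\<lambda>f g. \<integral>x. f x \<bullet> g x \<partial>lborel"
  by (rule integral_cong_AE) (auto simp: l2_rel_def sq_integrable_def)

definition norm_l2 :: "'a l2 \<Rightarrow> real" where "norm_l2 u = sqrt (inner u u)"
definition dist_l2 :: "'a l2 \<Rightarrow> 'a l2 \<Rightarrow> real" where "dist_l2 u v = norm (u - v)"
definition sgn_l2 :: "'a l2 \<Rightarrow> 'a l2" where "sgn_l2 u = inverse (norm u) *\<^sub>R u"
definition uniformity_l2 :: "('a l2 \<times> 'a l2) filter" where
  "uniformity_l2 = (INF e\<in>{0<..}. principal {(x, y). dist x y < e})"
definition open_l2 :: "'a l2 set \<Rightarrow> bool" where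
  "open_l2 S \<longleftrightarrow> (\<forall>x\<in>S. \<forall>\<^sub>F (x', y) in uniformity. x' = x \<longrightarrow> y \<in> S)"

instance
proof
  fix u v w :: "'a l2" and a b :: real
  show "u + v + w = u + (v + w)"
    by transfer (auto simp: l2_rel_def sq_integrable_add add.assoc)
  show "u + v = v + u"
    by transfer (auto simp: l2_rel_def sq_integrable_add add.commute)
  show "0 + u = u" by transfer (auto simp: l2_rel_def)
  show "- u + u = 0" by transfer (auto simp: l2_rel_def)
  show "u - v = u + - v"
    by transfer (auto simp: l2_rel_def sq_integrable_diff)
  show "a *\<^sub>R (u + v) = a *\<^sub>R u + a *\<^sub>R v"
    by transfer (auto simp: l2_rel_def scaleR_add_right intro!: sq_integrable_add sq_integrable_scaleR)
  show "(a + b) *\<^sub>R u = a *\<^sub>R u + b *\<^sub>R u"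
    by transfer (auto simp: l2_rel_def scaleR_add_left intro!: sq_integrable_add sq_integrable_scaleR)
  show "a *\<^sub>R b *\<^sub>R u = (a * b) *\<^sub>R u"
    by transfer (auto simp: l2_rel_def intro!: sq_integrable_scaleR)
  show "1 *\<^sub>R u = u" by transfer (auto simp: l2_rel_def)
  show "dist u v = norm (u - v)" by (simp add: dist_l2_def)
  show "sgn u = inverse (norm u) *\<^sub>R u" by (simp add: sgn_l2_def)
  show "uniformity = (INF e\<in>{0<..}. principal {(x::'a l2, y). dist x y < e})"
    by (simp add: uniformity_l2_def)
  show "open U \<longleftrightarrow> (\<forall>x\<in>U. \<forall>\<^sub>F (x', y) in uniformity. x' = x \<longrightarrow> y \<in> U)" for U :: "'a l2 set"
    by (simp add: open_l2_def)
  show "inner u v = inner v u" by transfer (simp add: inner_commute)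
  show "inner (u + v) w = inner u w + inner v w"
    by transfer (auto simp: l2_rel_def inner_add_left integrable_inner_l2)
  show "inner (a *\<^sub>R u) v = a * inner u v"
    by transfer simp
  show "0 \<le> inner u u" by transfer simp
  show "inner u u = 0 \<longleftrightarrow> u = 0"
  proof transfer
    fix f :: "real \<Rightarrow> 'a" assume f: "l2_rel f f"
    then have "(\<integral>x. f x \<bullet> f x \<partial>lborel) = 0 \<longleftrightarrow> (AE x in lborel. f x \<bullet> f x = 0)"
      by (intro integral_nonneg_eq_0_iff_AE integrable_inner_l2) (auto simp: l2_rel_def)
    then show "(\<integral>x. f x \<bullet> f x \<partial>lborel) = 0 \<longleftrightarrow> l2_rel f (\<lambda>_. 0)"
      using f by (simp add: l2_rel_def)
  qed
  show "norm u = sqrt (inner u u)" by (simp add: norm_l2_def)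
qed

end

lemma sq_integrable_rep [simp]: "sq_integrable (rep_l2 u)"
  using Quotient_rep_reflp[OF Quotient_l2, of u] by (simp add: l2_rel_def)

lemma abs_rep_l2 [simp]: "abs_l2 (rep_l2 u) = u"
  by (rule Quotient_abs_rep[OF Quotient_l2])

lemma rep_abs_l2:
  assumes "sq_integrable f" shows "AE x in lborel. rep_l2 (abs_l2 f) x = f x"
  using Quotient3_rep_abs[OF Quotient3_l2, of f] assms by (simp add: l2_rel_def)

lemma norm_l2_sq: "(norm u)\<^sup>2 = (\<integral>x. (norm (rep_l2 u x))\<^sup>2 \<partial>lborel)"
  unfolding norm_eq_sqrt_inner[of u] inner_l2.rep_eq
  by (simp add: power2_norm_eq_inner)

lemma norm_abs_l2:
  assumes "sq_integrable f" shows "(norm (abs_l2 f))\<^sup>2 = (\<integral>x. (norm (f x))\<^sup>2 \<partial>lborel)"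
proof -
  have "(\<integral>x. (norm (rep_l2 (abs_l2 f) x))\<^sup>2 \<partial>lborel) = (\<integral>x. (norm (f x))\<^sup>2 \<partial>lborel)"
    by (rule integral_cong_AE)
      (use rep_abs_l2[OF assms] assms sq_integrable_rep[of "abs_l2 f"] in \<open>auto simp: sq_integrable_def\<close>)
  then show ?thesis by (simp add: norm_l2_sq)
qed

lemma abs_l2_diff:
  assumes "sq_integrable f" "sq_integrable g"
  shows "abs_l2 (\<lambda>x. f x - g x) = abs_l2 f - abs_l2 g"
  using assms by (intro minus_l2.abs_eq[symmetric]) (auto simp: l2_rel_def)

lemma abs_l2_add:
  assumes "sq_integrable f" "sq_integrable g"
  shows "abs_l2 (\<lambda>x. f x + g x) = abs_l2 f + abs_l2 g"
  using assms by (intro plus_l2.abs_eq[symmetric]) (auto simp: l2_rel_def)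

lemma abs_l2_scaleR:
  assumes "sq_integrable f" 
  shows "abs_l2 (\<lambda>x. c *\<^sub>R f x) = c *\<^sub>R abs_l2 f"
  using assms by (intro scaleR_l2.abs_eq[symmetric]) (auto simp: l2_rel_def)

lemma abs_l2_zero: "abs_l2 (\<lambda>x. 0) = 0"
  by (simp add: zero_l2_def)

lemma abs_l2_sum:
  assumes "\<And>i. i \<in> I \<Longrightarrow> sq_integrable (f i)"
  shows "sq_integrable (\<lambda>x. \<Sum>i\<in>I. f i x) \<and> abs_l2 (\<lambda>x. \<Sum>i\<in>I. f i x) = (\<Sum>i\<in>I. abs_l2 (f i))"
  using assms
  by (induction I rule: infinite_finite_induct) (auto simp: abs_l2_zero abs_l2_add sq_integrable_add)

lemma norm_l2_diff_sq:
  "(norm (u - v))\<^sup>2 = (\<integral>x. (norm (rep_l2 u x - rep_l2 v x))\<^sup>2 \<partial>lborel)"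
  using norm_abs_l2[of "\<lambda>x. rep_l2 u x - rep_l2 v x"]
  by (simp add: abs_l2_diff sq_integrable_diff)

lemma tendsto_abs_l2_dominated:
  fixes f :: "nat \<Rightarrow> real \<Rightarrow> 'a::euclidean_space"
  assumes f: "\<And>n. f n \<in> borel_measurable lborel" and g: "g \<in> borel_measurable lborel"
    and w: "integrable lborel w"
    and bd: "\<And>n. AE x in lborel. (norm (f n x))\<^sup>2 \<le> w x"
    and lim: "AE x in lborel. (\<lambda>n. f n x) \<longlonglongrightarrow> g x"
  shows "sq_integrable g" and "(\<lambda>n. abs_l2 (f n)) \<longlonglongrightarrow> abs_l2 g"
proof -
  have "AE x in lborel. \<forall>n. (norm (f n x))\<^sup>2 \<le> w x"
    using bd by (simp add: AE_all_countable)
  then have bd': "AE x in lborel. (norm (g x))\<^sup>2 \<le> w x"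
    using lim
  proof eventually_elim
    case (elim x)
    have "(\<lambda>n. (norm (f n x))\<^sup>2) \<longlonglongrightarrow> (norm (g x))\<^sup>2"
      using elim(2) by (intro tendsto_intros)
    then show ?case by (rule LIMSEQ_le_const2) (use elim in auto)
  qed
  show sg: "sq_integrable g" by (rule sq_integrable_bound[OF w g bd'])
  have sf: "sq_integrable (f n)" for n by (rule sq_integrable_bound[OF w f bd])
  have "(\<lambda>n. \<integral>x. (norm (f n x - g x))\<^sup>2 \<partial>lborel) \<longlonglongrightarrow> (\<integral>x. 0 \<partial>(lborel::real measure))"
  proof (rule integral_dominated_convergence)
    show "integrable lborel (\<lambda>x. 4 * w x)" using w by simp
    show "(\<lambda>x. (norm (f n x - g x))\<^sup>2) \<in> borel_measurable lborel" for n
      using f[of n] g by measurable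
    show "AE x in lborel. (\<lambda>n. (norm (f n x - g x))\<^sup>2) \<longlonglongrightarrow> 0"
      using lim
    proof eventually_elim
      case (elim x)
      have "(\<lambda>n. (norm (f n x - g x))\<^sup>2) \<longlonglongrightarrow> (norm (g x - g x))\<^sup>2"
        using elim by (intro tendsto_intros)
      then show ?case by simp
    qed
    show "AE x in lborel. norm ((norm (f n x - g x))\<^sup>2) \<le> 4 * w x" for n
      using bd[of n] bd'
    proof eventually_elim
      case (elim x)
      then show ?case using norm_add_sq_le[of "f n x" "- g x"] by simp
    qed
  qed simp
  then have "(\<lambda>n. (norm (abs_l2 (f n) - abs_l2 g))\<^sup>2) \<longlonglongrightarrow> 0"
    using norm_abs_l2[OF sq_integrable_diff[OF sf sg]] by (simp add: abs_l2_diff sf sg)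
  then have "(\<lambda>n. sqrt ((norm (abs_l2 (f n) - abs_l2 g))\<^sup>2)) \<longlonglongrightarrow> sqrt 0"
    by (rule tendsto_real_sqrt)
  then have "(\<lambda>n. norm (abs_l2 (f n) - abs_l2 g)) \<longlonglongrightarrow> 0" by simp
  then show "(\<lambda>n. abs_l2 (f n)) \<longlonglongrightarrow> abs_l2 g"
    by (rule Lim_null[THEN iffD2, OF tendsto_norm_zero_cancel])
qed

lemma nn_integral_norm_l2_diff:
  "(\<integral>\<^sup>+x. ennreal ((norm (rep_l2 u x - rep_l2 v x))\<^sup>2) \<partial>lborel) = ennreal ((norm (u - v))\<^sup>2)"
proof -
  have "sq_integrable (\<lambda>x. rep_l2 u x - rep_l2 v x)" by (simp add: sq_integrable_diff)
  then have "integrable lborel (\<lambda>x. (norm (rep_l2 u x - rep_l2 v x))\<^sup>2)"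
    by (simp add: sq_integrable_def)
  from nn_integral_eq_integral[OF this] show ?thesis by (simp add: norm_l2_diff_sq)
qed

lemma summable_of_weighted_squares:
  fixes d :: "nat \<Rightarrow> 'a::euclidean_space"
  assumes "summable (\<lambda>n. 2 ^ n * (norm (d n))\<^sup>2)"
  shows "summable d"
proof -
  have "Bseq (\<lambda>n. 2 ^ n * (norm (d n))\<^sup>2)"
    using summable_LIMSEQ_zero[OF assms] by (blast intro: convergent_imp_Bseq convergentI)
  then obtain C where C: "C > 0" "\<And>n. norm (2 ^ n * (norm (d n))\<^sup>2) \<le> C"
    by (auto elim: BseqE)
  show ?thesis
  proof (rule summable_comparison_test)
    show "summable (\<lambda>n. sqrt C * (1 / sqrt 2) ^ n)"
      by (intro summable_mult summable_geometric) simp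
    have "norm (d n) \<le> sqrt C * (1 / sqrt 2) ^ n" for n
    proof -
      have "(norm (d n))\<^sup>2 \<le> C / 2 ^ n" using C(2)[of n] by (simp add: field_simps)
      then have "norm (d n) \<le> sqrt (C / 2 ^ n)" by (rule real_le_rsqrt)
      then show ?thesis by (simp add: real_sqrt_divide real_sqrt_power power_divide)
    qed
    then show "\<exists>N. \<forall>n\<ge>N. norm (d n) \<le> sqrt C * (1 / sqrt 2) ^ n" by blast
  qed
qed

instance l2 :: (euclidean_space) banach
proof
  fix X :: "nat \<Rightarrow> 'a l2" assume X: "Cauchy X"
  have "\<forall>n. \<exists>N. \<forall>m\<ge>N. \<forall>k\<ge>N. dist (X m) (X k) < (1 / 4) ^ n"
    using X by (auto simp: Cauchy_def)
  then obtain M where M: "\<And>n m k. m \<ge> M n \<Longrightarrow> k \<ge> M n \<Longrightarrow> dist (X m) (X k) < (1 / 4) ^ n"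
    by metis
  define r where "r n = (\<Sum>i\<le>n. M i)" for n
  have r: "M n \<le> r m" if "n \<le> m" for n m
    unfolding r_def using that by (intro member_le_sum) auto
  define Y where "Y n = X (r n)" for n
  have Y: "norm (Y m - Y n) \<le> (1 / 4) ^ n" if "n \<le> m" for m n
    using M[of n "r m" "r n"] r[OF that] r[of n n] by (simp add: dist_norm Y_def)
  have Y2: "(norm (Y m - Y n))\<^sup>2 \<le> (1 / 16) ^ n" if "n \<le> m" for m n
  proof -
    have "(norm (Y m - Y n))\<^sup>2 \<le> ((1 / 4) ^ n)\<^sup>2" by (rule power_mono[OF Y[OF that]]) simp
    also have "\<dots> = (1 / 16) ^ n"
      by (simp add: power2_eq_square flip: power_mult_distrib)
    finally show ?thesis .
  qed
  define f where "f n = rep_l2 (Y n)" for n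
  have f [measurable]: "f n \<in> borel_measurable borel" for n
    using sq_integrable_rep[of "Y n"] by (simp add: sq_integrable_def f_def)
  have nn: "(\<integral>\<^sup>+x. ennreal ((norm (f m x - f n x))\<^sup>2) \<partial>lborel) = ennreal ((norm (Y m - Y n))\<^sup>2)" for m n
    by (simp add: f_def nn_integral_norm_l2_diff)
  have "(\<integral>\<^sup>+x. (\<Sum>n. ennreal (2 ^ n * (norm (f (Suc n) x - f n x))\<^sup>2)) \<partial>lborel)
      = (\<Sum>n. \<integral>\<^sup>+x. ennreal (2 ^ n * (norm (f (Suc n) x - f n x))\<^sup>2) \<partial>lborel)"
    by (intro nn_integral_suminf) measurable
  also have "\<dots> = (\<Sum>n. ennreal (2 ^ n * (norm (Y (Suc n) - Y n))\<^sup>2))"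
    by (intro suminf_cong) (simp add: ennreal_mult nn_integral_cmult nn)
  also have "\<dots> \<le> (\<Sum>n. ennreal ((1 / 8) ^ n))"
  proof (intro suminf_le ennreal_leI allI)
    fix n
    have "2 ^ n * (norm (Y (Suc n) - Y n))\<^sup>2 \<le> 2 ^ n * (1 / 16) ^ n"
      by (intro mult_left_mono Y2) auto
    also have "\<dots> = (1 / 8 :: real) ^ n" by (simp flip: power_mult_distrib)
    finally show "2 ^ n * (norm (Y (Suc n) - Y n))\<^sup>2 \<le> (1 / 8) ^ n" .
  qed auto
  also have "\<dots> = ennreal (\<Sum>n. (1 / 8) ^ n)"
    by (intro suminf_ennreal2 summable_geometric) auto
  also have "\<dots> < \<infinity>" by simp
  finally have fin: "(\<integral>\<^sup>+x. (\<Sum>n. ennreal (2 ^ n * (norm (f (Suc n) x - f n x))\<^sup>2)) \<partial>lborel) \<noteq> \<infinity>"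
    by simp
  have conv: "AE x in lborel. convergent (\<lambda>n. f n x)"
    using nn_integral_PInf_AE[OF _ fin]
  proof (rule AE_mp)
    show "(\<lambda>x. \<Sum>n. ennreal (2 ^ n * (norm (f (Suc n) x - f n x))\<^sup>2)) \<in> borel_measurable lborel"
      by measurable
    show "AE x in lborel. (\<Sum>n. ennreal (2 ^ n * (norm (f (Suc n) x - f n x))\<^sup>2)) \<noteq> \<infinity>
        \<longrightarrow> convergent (\<lambda>n. f n x)"
    proof (intro AE_I2 impI)
      fix x assume "(\<Sum>n. ennreal (2 ^ n * (norm (f (Suc n) x - f n x))\<^sup>2)) \<noteq> \<infinity>"
      then have "summable (\<lambda>n. 2 ^ n * (norm (f (Suc n) x - f n x))\<^sup>2)"
        by (intro summable_suminf_not_top) auto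
      then have "summable (\<lambda>n. f (Suc n) x - f n x)" by (rule summable_of_weighted_squares)
      then have "convergent (\<lambda>n. (f n x - f 0 x) + f 0 x)"
        by (intro convergent_add convergent_const)
           (simp add: summable_iff_convergent sum_lessThan_telescope[of "\<lambda>i. f i x"])
      then show "convergent (\<lambda>n. f n x)" by simp
    qed
  qed
  define g where "g x = lim (\<lambda>n. f n x)" for x
  have g [measurable]: "g \<in> borel_measurable borel"
    unfolding g_def by (rule borel_measurable_lim_metric) (rule f)
  have bd: "(\<integral>\<^sup>+x. ennreal ((norm (g x - f n x))\<^sup>2) \<partial>lborel) \<le> ennreal ((1 / 16) ^ n)" for n
  proof -
    have "(\<integral>\<^sup>+x. ennreal ((norm (g x - f n x))\<^sup>2) \<partial>lborel)
       = (\<integral>\<^sup>+x. liminf (\<lambda>m. ennreal ((norm (f m x - f n x))\<^sup>2)) \<partial>lborel)"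
    proof (rule nn_integral_cong_AE)
      show "AE x in lborel. ennreal ((norm (g x - f n x))\<^sup>2) = liminf (\<lambda>m. ennreal ((norm (f m x - f n x))\<^sup>2))"
        using conv
      proof eventually_elim
        case (elim x)
        then have "(\<lambda>m. f m x) \<longlonglongrightarrow> g x" by (simp add: g_def convergent_LIMSEQ_iff)
        then have "(\<lambda>m. ennreal ((norm (f m x - f n x))\<^sup>2)) \<longlonglongrightarrow> ennreal ((norm (g x - f n x))\<^sup>2)"
          by (intro tendsto_intros)
        then show ?case by (intro lim_imp_Liminf[symmetric]) auto
      qed
    qed
    also have "\<dots> \<le> liminf (\<lambda>m. \<integral>\<^sup>+x. ennreal ((norm (f m x - f n x))\<^sup>2) \<partial>lborel)"
      by (intro nn_integral_liminf) measurable
    also have "\<dots> \<le> liminf (\<lambda>m. ennreal ((1 / 16) ^ n))"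
      unfolding nn using Y2[of n]
      by (intro Liminf_mono eventually_sequentiallyI[of n] ennreal_leI) auto
    also have "\<dots> = ennreal ((1 / 16) ^ n)" by (simp add: Liminf_const)
    finally show ?thesis .
  qed
  have sgf: "sq_integrable (\<lambda>x. g x - f n x)" for n
    unfolding sq_integrable_def
  proof
    show "integrable lborel (\<lambda>x. (norm (g x - f n x))\<^sup>2)"
      unfolding integrable_iff_bounded
    proof
      show "(\<integral>\<^sup>+x. ennreal (norm ((norm (g x - f n x))\<^sup>2)) \<partial>lborel) < \<infinity>"
        using bd[of n] by (simp add: le_less_trans[OF _ ennreal_less_top])
    qed measurable
  qed measurable
  have sf: "sq_integrable (f n)" for n by (simp add: f_def)
  have sg: "sq_integrable g" using sq_integrable_add[OF sgf[of 0] sf[of 0]] by simp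
  have "norm (Y n - abs_l2 g) \<le> (1 / 4) ^ n" for n
  proof -
    have "ennreal ((norm (abs_l2 g - Y n))\<^sup>2) = (\<integral>\<^sup>+x. ennreal ((norm (g x - f n x))\<^sup>2) \<partial>lborel)"
    proof -
      have "abs_l2 g - Y n = abs_l2 (\<lambda>x. g x - f n x)"
        by (simp add: abs_l2_diff sg sf) (simp add: f_def)
      then show ?thesis
        using sgf[of n] norm_abs_l2[OF sgf[of n]]
        by (simp add: nn_integral_eq_integral sq_integrable_def)
    qed
    also have "\<dots> \<le> ennreal ((1 / 16) ^ n)" by (rule bd)
    finally have "(norm (abs_l2 g - Y n))\<^sup>2 \<le> (1 / 16) ^ n" by simp
    also have "\<dots> = ((1 / 4) ^ n)\<^sup>2"
      by (simp add: power2_eq_square flip: power_mult_distrib)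
    finally show ?thesis by (simp add: norm_minus_commute power2_le_iff_abs_le)
  qed
  then have "(\<lambda>n. norm (Y n - abs_l2 g)) \<longlonglongrightarrow> 0"
    by (intro tendsto_sandwich[OF _ _ tendsto_const LIMSEQ_power_zero[of "1/4::real"]]) auto
  then have Ylim: "Y \<longlonglongrightarrow> abs_l2 g"
    by (rule Lim_null[THEN iffD2, OF tendsto_norm_zero_cancel])
  have "X \<longlonglongrightarrow> abs_l2 g"
  proof (rule metric_LIMSEQ_I)
    fix e :: real assume "e > 0"
    then obtain N where N: "\<And>m k. m \<ge> N \<Longrightarrow> k \<ge> N \<Longrightarrow> dist (X m) (X k) < e / 2"
      using metric_CauchyD[OF X, of "e/2"] by auto
    obtain K where K: "\<And>n. n \<ge> K \<Longrightarrow> dist (Y n) (abs_l2 g) < e / 2"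
      using metric_LIMSEQ_D[OF Ylim, of "e/2"] \<open>e > 0\<close> by auto
    obtain p where p: "(1 / 4) ^ p < e / 2"
      using real_arch_pow_inv[of "e/2" "1/4::real"] \<open>e > 0\<close> by auto
    have "dist (X m) (abs_l2 g) < e" if "m \<ge> M (max p K)" for m
    proof -
      have "dist (X m) (Y (max p K)) < (1 / 4) ^ max p K"
        unfolding Y_def by (rule M[OF that r]) simp
      also have "\<dots> \<le> (1 / 4) ^ p" by (rule power_decreasing) auto
      finally have "dist (X m) (Y (max p K)) < e / 2" using p by simp
      then show ?thesis using K[of "max p K"] dist_triangle[of "X m" "abs_l2 g" "Y (max p K)"] by simp
    qed
    then show "\<exists>no. \<forall>n\<ge>no. dist (X n) (abs_l2 g) < e" by blast
  qed
  then show "convergent X" by (rule convergentI)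
qed

definition l2_generators :: "'a::euclidean_space l2 set" where
  "l2_generators = (\<lambda>(a, b, e). abs_l2 (\<lambda>x. indicator {a..b} x *\<^sub>R e)) ` (\<rat> \<times> \<rat> \<times> Basis)"

definition l2_dense :: "'a::euclidean_space l2 set" where
  "l2_dense = (\<lambda>xs. \<Sum>(q, g)\<leftarrow>xs. q *\<^sub>R g) ` lists (\<rat> \<times> l2_generators)"

lemma countable_l2_dense: "countable l2_dense"
  unfolding l2_dense_def l2_generators_def
  by (intro countable_image countable_lists countable_SIGMA countable_rat countable_finite finite_Basis)

lemma l2_dense_0: "0 \<in> l2_dense"
  unfolding l2_dense_def by (rule image_eqI[of _ _ "[]"]) auto

lemma l2_dense_generator: "g \<in> l2_generators \<Longrightarrow> g \<in> l2_dense"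
  unfolding l2_dense_def by (rule image_eqI[of _ _ "[(1, g)]"]) auto

lemma l2_dense_add:
  assumes "u \<in> l2_dense" "v \<in> l2_dense" shows "u + v \<in> l2_dense"
proof -
  obtain xs ys where "xs \<in> lists (\<rat> \<times> l2_generators)" "ys \<in> lists (\<rat> \<times> l2_generators)"
    "u = (\<Sum>(q, g)\<leftarrow>xs. q *\<^sub>R g)" "v = (\<Sum>(q, g)\<leftarrow>ys. q *\<^sub>R g)"
    using assms by (auto simp: l2_dense_def)
  then show ?thesis unfolding l2_dense_def by (intro image_eqI[of _ _ "xs @ ys"]) auto
qed

lemma l2_dense_scaleR:
  assumes "u \<in> l2_dense" "c \<in> \<rat>" shows "c *\<^sub>R u \<in> l2_dense"
proof -
  obtain xs where xs: "xs \<in> lists (\<rat> \<times> l2_generators)" "u = (\<Sum>(q, g)\<leftarrow>xs. q *\<^sub>R g)"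
    using assms by (auto simp: l2_dense_def)
  have "c *\<^sub>R (\<Sum>(q, g)\<leftarrow>xs. q *\<^sub>R g) = (\<Sum>(q, g)\<leftarrow>map (\<lambda>(q, g). (c * q, g)) xs. q *\<^sub>R g)"
    by (induction xs) (auto simp: scaleR_add_right)
  moreover have "map (\<lambda>(q, g). (c * q, g)) xs \<in> lists (\<rat> \<times> l2_generators)"
    using xs(1) assms(2) by (auto simp: lists_eq_set)
  ultimately show ?thesis unfolding xs(2) l2_dense_def by blast
qed

lemma closure_l2_dense_add:
  assumes "u \<in> closure l2_dense" "v \<in> closure l2_dense" shows "u + v \<in> closure l2_dense"
proof -
  obtain x y where "\<And>n. x n \<in> l2_dense" "x \<longlonglongrightarrow> u" "\<And>n. y n \<in> l2_dense" "y \<longlonglongrightarrow> v"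
    using assms by (auto simp: closure_sequential)
  then show ?thesis unfolding closure_sequential
    by (intro exI[of _ "\<lambda>n. x n + y n"]) (auto intro: l2_dense_add tendsto_add)
qed

lemma closure_l2_dense_scaleR:
  assumes "u \<in> closure l2_dense" shows "c *\<^sub>R u \<in> closure l2_dense"
proof -
  obtain x where x: "\<And>n. x n \<in> l2_dense" "x \<longlonglongrightarrow> u"
    using assms by (auto simp: closure_sequential)
  have "c \<in> closure \<rat>" by (simp add: Rats_closure_real)
  then obtain q where q: "\<And>n. q n \<in> \<rat>" "q \<longlonglongrightarrow> c"
    by (auto simp: closure_sequential)
  show ?thesis unfolding closure_sequential
    using x q by (intro exI[of _ "\<lambda>n. q n *\<^sub>R x n"]) (auto intro: l2_dense_scaleR tendsto_scaleR)
qed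

lemma closure_l2_dense_sum:
  "(\<And>i. i \<in> I \<Longrightarrow> f i \<in> closure l2_dense) \<Longrightarrow> (\<Sum>i\<in>I. f i) \<in> closure l2_dense"
  using l2_dense_0 closure_subset
  by (induction I rule: infinite_finite_induct) (auto intro: closure_l2_dense_add)

lemma closure_l2_dense_limit:
  "(\<And>n::nat. u n \<in> closure l2_dense) \<Longrightarrow> u \<longlonglongrightarrow> v \<Longrightarrow> v \<in> closure l2_dense"
  using closed_sequentially[OF closed_closure] by blast

lemma sq_integrable_indicator:
  assumes "A \<in> sets borel" "emeasure lborel A < \<infinity>"
  shows "sq_integrable (\<lambda>x. indicator A x *\<^sub>R e)"
proof (rule sq_integrable_bound)
  show "integrable lborel (\<lambda>x. indicator A x * (norm e)\<^sup>2)"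
    using assms by (intro integrable_mult_left integrable_real_indicator) auto
  show "(\<lambda>x. indicator A x *\<^sub>R e) \<in> borel_measurable lborel" using assms by measurable
qed (auto simp: indicator_def)

lemma abs_l2_indicator_limit:
  assumes A: "\<And>n. A n \<in> sets borel" and B: "B \<in> sets borel" "emeasure lborel B < \<infinity>"
    and sub: "\<And>n. A n \<subseteq> B"
    and lim: "\<And>x. (\<lambda>n. indicator (A n) x :: real) \<longlonglongrightarrow> indicator C x" and C: "C \<in> sets borel"
  shows "(\<lambda>n. abs_l2 (\<lambda>x. indicator (A n) x *\<^sub>R e)) \<longlonglongrightarrow> abs_l2 (\<lambda>x. indicator C x *\<^sub>R e)"
proof (rule tendsto_abs_l2_dominated)
  show "integrable lborel (\<lambda>x. indicator B x * (norm e)\<^sup>2)"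
    using B by (intro integrable_mult_left integrable_real_indicator) auto
  show "(\<lambda>x. indicator (A n) x *\<^sub>R e) \<in> borel_measurable lborel" for n using A[of n] by measurable
  show "(\<lambda>x. indicator C x *\<^sub>R e) \<in> borel_measurable lborel" using C by measurable
  show "AE x in lborel. (norm (indicator (A n) x *\<^sub>R e))\<^sup>2 \<le> indicator B x * (norm e)\<^sup>2" for n
    using sub[of n] by (auto simp: indicator_def)
  show "AE x in lborel. (\<lambda>n. indicator (A n) x *\<^sub>R e) \<longlonglongrightarrow> indicator C x *\<^sub>R e"
    by (intro AE_I2 tendsto_scaleR lim tendsto_const)
qed

lemma closure_l2_dense_Icc:
  assumes e: "e \<in> Basis" shows "abs_l2 (\<lambda>x. indicator {a..b} x *\<^sub>R e) \<in> closure l2_dense"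
proof -
  have "\<exists>q\<in>\<rat>. a - 1 / real (Suc n) < q \<and> q < a" for n
    by (rule Rats_dense_in_real) simp
  then obtain p where p: "\<And>n. p n \<in> \<rat>" "\<And>n. a - 1 / real (Suc n) < p n" "\<And>n. p n < a"
    by metis
  have "\<exists>q\<in>\<rat>. b < q \<and> q < b + 1 / real (Suc n)" for n
    by (rule Rats_dense_in_real) simp
  then obtain q where q: "\<And>n. q n \<in> \<rat>" "\<And>n. b < q n" "\<And>n. q n < b + 1 / real (Suc n)"
    by metis
  have plim: "p \<longlonglongrightarrow> a"
  proof (rule tendsto_sandwich[OF _ _ _ tendsto_const])
    show "(\<lambda>n. a - 1 / real (Suc n)) \<longlonglongrightarrow> a"
      using tendsto_diff[OF tendsto_const LIMSEQ_Suc[OF lim_1_over_n], of a] by simp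
  qed (use p in \<open>auto intro!: always_eventually less_imp_le\<close>)
  have qlim: "q \<longlonglongrightarrow> b"
  proof (rule tendsto_sandwich[OF _ _ tendsto_const])
    show "(\<lambda>n. b + 1 / real (Suc n)) \<longlonglongrightarrow> b"
      using tendsto_add[OF tendsto_const LIMSEQ_Suc[OF lim_1_over_n], of b] by simp
  qed (use q in \<open>auto intro!: always_eventually less_imp_le\<close>)
  have "(\<lambda>n. abs_l2 (\<lambda>x. indicator {p n..q n} x *\<^sub>R e)) \<longlonglongrightarrow> abs_l2 (\<lambda>x. indicator {a..b} x *\<^sub>R e)"
  proof (rule abs_l2_indicator_limit)
    show "{p n..q n} \<subseteq> {a - 1..b + 1}" for n
    proof -
      have "1 / real (Suc n) \<le> 1" by simp
      then have "a - 1 \<le> p n" "q n \<le> b + 1" using p(2)[of n] q(3)[of n] by linarith+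
      then show ?thesis by auto
    qed
    show "(\<lambda>n. indicator {p n..q n} x :: real) \<longlonglongrightarrow> indicator {a..b} x" for x
    proof (cases "x \<in> {a..b}")
      case True
      then have "x \<in> {p n..q n}" for n using p(3)[of n] q(2)[of n] by auto
      then show ?thesis using True by simp
    next
      case False
      then consider "x < a" | "x > b" by fastforce
      then have "\<forall>\<^sub>F n in sequentially. x \<notin> {p n..q n}"
      proof cases
        case 1
        then show ?thesis using order_tendstoD(1)[OF plim 1] by (auto elim: eventually_mono)
      next
        case 2
        then show ?thesis using order_tendstoD(2)[OF qlim 2] by (auto elim: eventually_mono)
      qed
      then have "\<forall>\<^sub>F n in sequentially. indicator {p n..q n} x = (0::real)"
        by (auto elim: eventually_mono)
      then show ?thesis using False by (simp add: tendsto_eventually)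
    qed
  qed (auto simp: emeasure_lborel_Icc_eq)
  moreover have "abs_l2 (\<lambda>x. indicator {p n..q n} x *\<^sub>R e) \<in> closure l2_dense" for n
    by (rule subsetD[OF closure_subset], rule l2_dense_generator)
      (use p(1)[of n] q(1)[of n] e in \<open>force simp: l2_generators_def\<close>)
  ultimately show ?thesis by (rule closure_l2_dense_limit[rotated])
qed

lemma closure_l2_dense_bounded:
  assumes e: "e \<in> Basis" and A: "A \<in> sets borel"
  shows "abs_l2 (\<lambda>x. indicator (A \<inter> {-R..R}) x *\<^sub>R e) \<in> closure l2_dense"
proof -
  have fin: "emeasure lborel (A \<inter> {-R..R}) < \<infinity>" if "A \<in> sets borel" for A
    using emeasure_mono[of "A \<inter> {-R..R}" "{-R..R}" lborel]
    by (auto simp: emeasure_lborel_Icc_eq intro: le_less_trans)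
  have G: "borel = sigma UNIV (range (\<lambda>(a::real, b). {a..b}))"
    using borel_eq_atLeastAtMost .
  then have As: "A \<in> sigma_sets UNIV (range (\<lambda>(a::real, b). {a..b}))"
    using A by (metis sets_measure_of subset_Pow_Union Pow_UNIV top_greatest)
  have Int: "Int_stable (range (\<lambda>(a::real, b). {a..b}))"
    by (auto simp: Int_stable_def)
  have Pow: "range (\<lambda>(a::real, b). {a..b}) \<subseteq> Pow UNIV" by simp
  show ?thesis
    using Int Pow As
  proof (induction rule: sigma_sets_induct_disjoint)
    case (basic A)
    then obtain a b where "A = {a..b}" by auto
    then have "A \<inter> {-R..R} = {max a (-R)..min b R}" by auto
    then show ?case using closure_l2_dense_Icc[OF e] by simp
  next
    case empty
    then show ?case using l2_dense_0 closure_subset by (auto simp: abs_l2_zero)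
  next
    case (compl A)
    have A: "A \<in> sets borel" unfolding G using compl(1) by simp
    have "abs_l2 (\<lambda>x. indicator ((UNIV - A) \<inter> {-R..R}) x *\<^sub>R e)
        = abs_l2 (\<lambda>x. indicator (UNIV \<inter> {-R..R}) x *\<^sub>R e + (-1) *\<^sub>R (indicator (A \<inter> {-R..R}) x *\<^sub>R e))"
      by (rule arg_cong[of _ _ abs_l2]) (auto simp: indicator_def)
    also have "\<dots> = abs_l2 (\<lambda>x. indicator (UNIV \<inter> {-R..R}) x *\<^sub>R e)
        + (-1) *\<^sub>R abs_l2 (\<lambda>x. indicator (A \<inter> {-R..R}) x *\<^sub>R e)"
      using A sq_integrable_indicator[OF _ fin] sq_integrable_indicator[OF _ fin, of UNIV]
      by (subst abs_l2_add) (auto intro!: sq_integrable_uminus simp: abs_l2_scaleR[of _ "-1", simplified])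
    finally show ?case
      using closure_l2_dense_add[OF closure_l2_dense_Icc[OF e, of "-R" R]
          closure_l2_dense_scaleR[OF compl(2), of "-1"]] by simp
  next
    case (union A)
    have A: "A i \<in> sets borel" for i unfolding G using union(2) by auto
    have "abs_l2 (\<lambda>x. indicator ((\<Union>i<n. A i) \<inter> {-R..R}) x *\<^sub>R e) \<in> closure l2_dense" for n
    proof -
      have eq: "(\<lambda>x. indicator ((\<Union>i<n. A i) \<inter> {-R..R}) x *\<^sub>R e)
          = (\<lambda>x. \<Sum>i<n. indicator (A i \<inter> {-R..R}) x *\<^sub>R e)"
      proof
        fix x
        have "disjoint_family_on (\<lambda>i. A i \<inter> {-R..R}) {..<n}"
          using union(1) by (fastforce simp: disjoint_family_on_def)
        then have "indicator (\<Union>i<n. A i \<inter> {-R..R}) x = (\<Sum>i<n. indicator (A i \<inter> {-R..R}) x :: real)"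
          by (intro indicator_UN_disjoint) auto
        then show "indicator ((\<Union>i<n. A i) \<inter> {-R..R}) x *\<^sub>R e
            = (\<Sum>i<n. indicator (A i \<inter> {-R..R}) x *\<^sub>R e)"
          by (simp add: scaleR_sum_left)
      qed
      have sq: "sq_integrable (\<lambda>x. indicator (A i \<inter> {-R..R}) x *\<^sub>R e)" for i
        using A by (intro sq_integrable_indicator fin) auto
      have "abs_l2 (\<lambda>x. indicator ((\<Union>i<n. A i) \<inter> {-R..R}) x *\<^sub>R e)
          = (\<Sum>i<n. abs_l2 (\<lambda>x. indicator (A i \<inter> {-R..R}) x *\<^sub>R e))"
        unfolding eq
        using abs_l2_sum[of "{..<n}" "\<lambda>i x. indicator (A i \<inter> {-R..R}) x *\<^sub>R e"] sq by blast
      then show ?thesis using union(3) by (simp add: closure_l2_dense_sum)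
    qed
    moreover have "(\<lambda>n. abs_l2 (\<lambda>x. indicator ((\<Union>i<n. A i) \<inter> {-R..R}) x *\<^sub>R e))
        \<longlonglongrightarrow> abs_l2 (\<lambda>x. indicator ((\<Union>i. A i) \<inter> {-R..R}) x *\<^sub>R e)"
    proof (rule abs_l2_indicator_limit[where B="UNIV \<inter> {-R..R}"])
      show "(\<Union>i<n. A i) \<inter> {-R..R} \<in> sets borel" for n using A by auto
      show "(\<Union>i. A i) \<inter> {-R..R} \<in> sets borel" using A by auto
      show "(\<lambda>n. indicator ((\<Union>i<n. A i) \<inter> {-R..R}) x :: real)
          \<longlonglongrightarrow> indicator ((\<Union>i. A i) \<inter> {-R..R}) x" for x
      proof (cases "x \<in> (\<Union>i. A i) \<inter> {-R..R}")
        case True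
        then obtain i where i: "x \<in> A i" "x \<in> {-R..R}" by auto
        have "\<forall>\<^sub>F n in sequentially. indicator ((\<Union>i<n. A i) \<inter> {-R..R}) x = (1::real)"
          using i by (intro eventually_sequentiallyI[of "Suc i"]) (auto simp: indicator_def)
        then show ?thesis using True by (simp add: tendsto_eventually)
      next
        case False
        then have "indicator ((\<Union>i<n. A i) \<inter> {-R..R}) x = (0::real)" for n
          by (auto simp: indicator_def)
        then show ?thesis using False by simp
      qed
      show "(\<Union>i<n. A i) \<inter> {-R..R} \<subseteq> UNIV \<inter> {-R..R}" for n by auto
      show "emeasure lborel (UNIV \<inter> {-R..R}) < \<infinity>" by (rule fin) auto
    qed auto
    ultimately show ?case by (rule closure_l2_dense_limit)
  qed
qed

lemma closure_l2_dense_indicator: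
  assumes A: "A \<in> sets borel" "emeasure lborel A < \<infinity>"
  shows "abs_l2 (\<lambda>x. indicator A x *\<^sub>R c) \<in> closure l2_dense"
proof -
  have 1: "abs_l2 (\<lambda>x. indicator A x *\<^sub>R e) \<in> closure l2_dense" if e: "e \<in> Basis" for e :: 'a
  proof (rule closure_l2_dense_limit)
    show "abs_l2 (\<lambda>x. indicator (A \<inter> {-real n..real n}) x *\<^sub>R e) \<in> closure l2_dense" for n
      by (rule closure_l2_dense_bounded[OF e A(1)])
    show "(\<lambda>n. abs_l2 (\<lambda>x. indicator (A \<inter> {-real n..real n}) x *\<^sub>R e))
        \<longlonglongrightarrow> abs_l2 (\<lambda>x. indicator A x *\<^sub>R e)"
    proof (rule abs_l2_indicator_limit[where B=A])
      show "(\<lambda>n. indicator (A \<inter> {-real n..real n}) x :: real) \<longlonglongrightarrow> indicator A x" for x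
      proof (rule tendsto_eventually)
        obtain N where "\<bar>x\<bar> \<le> real N" using real_arch_simple by blast
        then show "\<forall>\<^sub>F n in sequentially. indicator (A \<inter> {-real n..real n}) x = (indicator A x :: real)"
          by (intro eventually_sequentiallyI[of N]) (auto simp: indicator_def)
      qed
    qed (use A in auto)
  qed
  have sq: "sq_integrable (\<lambda>x. (c \<bullet> e) *\<^sub>R (indicator A x *\<^sub>R e))" for e :: 'a
    by (intro sq_integrable_scaleR sq_integrable_indicator A)
  have "(\<lambda>x. indicator A x *\<^sub>R c) = (\<lambda>x. \<Sum>e\<in>Basis. (c \<bullet> e) *\<^sub>R (indicator A x *\<^sub>R e))"
  proof
    fix x
    have "(\<Sum>e\<in>Basis. (c \<bullet> e) *\<^sub>R (indicator A x *\<^sub>R e)) = indicator A x *\<^sub>R (\<Sum>e\<in>Basis. (c \<bullet> e) *\<^sub>R e)"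
      unfolding scaleR_sum_right by (intro sum.cong) (auto simp: indicator_def)
    then show "indicator A x *\<^sub>R c = (\<Sum>e\<in>Basis. (c \<bullet> e) *\<^sub>R (indicator A x *\<^sub>R e))"
      by (simp add: euclidean_representation)
  qed
  then have "abs_l2 (\<lambda>x. indicator A x *\<^sub>R c) = (\<Sum>e\<in>Basis. (c \<bullet> e) *\<^sub>R abs_l2 (\<lambda>x. indicator A x *\<^sub>R e))"
    using sq abs_l2_sum[of Basis "\<lambda>e x. (c \<bullet> e) *\<^sub>R (indicator A x *\<^sub>R e)"]
    by (simp only: abs_l2_scaleR[OF sq_integrable_indicator[OF A]])
  then show ?thesis using 1 by (simp add: closure_l2_dense_sum closure_l2_dense_scaleR)
qed

lemma closure_l2_dense: "closure l2_dense = (UNIV :: 'a::euclidean_space l2 set)"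
proof -
  have "u \<in> closure l2_dense" for u :: "'a l2"
  proof -
    define f where "f = rep_l2 u"
    have f: "sq_integrable f" by (simp add: f_def)
    then have fm: "f \<in> borel_measurable lborel" by (simp add: sq_integrable_def)
    from borel_measurable_implies_sequence_metric[OF this, of 0] obtain s where
      s: "\<And>i. simple_function lborel (s i)" and lim: "\<And>x. (\<lambda>i. s i x) \<longlonglongrightarrow> f x" and
      bd: "\<And>i x. norm (s i x) \<le> 2 * norm (f x)"
      by (auto simp: )
    have bd2: "(norm (s i x))\<^sup>2 \<le> 4 * (norm (f x))\<^sup>2" for i x
      using power_mono[OF bd[of i x], of 2] by (simp add: power_mult_distrib)
    have int: "integrable lborel (\<lambda>x. 4 * (norm (f x))\<^sup>2)" using f by (simp add: sq_integrable_def)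
    have sm: "s i \<in> borel_measurable lborel" for i using s by (rule borel_measurable_simple_function)
    have "(\<lambda>i. abs_l2 (s i)) \<longlonglongrightarrow> abs_l2 f"
      by (rule tendsto_abs_l2_dominated[OF sm fm int]) (use bd2 lim in auto)
    moreover have "abs_l2 (s i) \<in> closure l2_dense" for i
    proof -
      define V where "V = s i ` UNIV - {0}"
      have finV: "finite V" using simple_functionD(1)[OF s[of i]] by (simp add: V_def)
      have fin: "emeasure lborel (s i -` {v}) < \<infinity>" if "v \<noteq> 0" for v
      proof -
        have meas: "s i -` {v} \<in> sets borel" using simple_functionD(2)[OF s[of i], of "{v}"] by simp
        have "ennreal ((norm v)\<^sup>2) * emeasure lborel (s i -` {v})
            = (\<integral>\<^sup>+x. ennreal ((norm v)\<^sup>2) * indicator (s i -` {v}) x \<partial>lborel)"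
          using meas by (simp add: nn_integral_cmult_indicator)
        also have "\<dots> \<le> (\<integral>\<^sup>+x. ennreal (4 * (norm (f x))\<^sup>2) \<partial>lborel)"
          using bd2[of i] by (intro nn_integral_mono) (auto simp: indicator_def intro!: ennreal_leI)
        also have "\<dots> < \<infinity>" using int by (simp add: nn_integral_eq_integral)
        finally show ?thesis using that by (auto simp: ennreal_mult_less_top)
      qed
      have sq: "sq_integrable (\<lambda>x. indicator (s i -` {v}) x *\<^sub>R v)" and
        cl: "abs_l2 (\<lambda>x. indicator (s i -` {v}) x *\<^sub>R v) \<in> closure l2_dense" if "v \<in> V" for v
        using that fin[of v] simple_functionD(2)[OF s[of i], of "{v}"]
        by (auto simp: V_def intro!: sq_integrable_indicator closure_l2_dense_indicator)
      have "s i = (\<lambda>x. \<Sum>v\<in>V. indicator (s i -` {v}) x *\<^sub>R v)"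
      proof
        fix x
        have "(\<Sum>v\<in>V. indicator (s i -` {v}) x *\<^sub>R v) = (\<Sum>v\<in>V. if v = s i x then v else 0)"
          by (intro sum.cong) (auto simp: indicator_def)
        then show "s i x = (\<Sum>v\<in>V. indicator (s i -` {v}) x *\<^sub>R v)"
          using finV by (auto simp: V_def)
      qed
      then have "abs_l2 (s i) = (\<Sum>v\<in>V. abs_l2 (\<lambda>x. indicator (s i -` {v}) x *\<^sub>R v))"
        using abs_l2_sum[of V "\<lambda>v x. indicator (s i -` {v}) x *\<^sub>R v"] sq by simp
      then show ?thesis using cl by (simp add: closure_l2_dense_sum)
    qed
    ultimately have "abs_l2 f \<in> closure l2_dense" by (rule closure_l2_dense_limit[rotated])
    then show ?thesis by (simp add: f_def)
  qed
  then show ?thesis by auto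
qed

instance l2 :: (euclidean_space) second_countable_topology
proof
  define B where "B = (\<lambda>(d::'a l2, r). ball d r) ` (l2_dense \<times> (\<rat> \<inter> {0<..}))"
  have "topological_basis B"
  proof (rule topological_basisI)
    show "open b" if "b \<in> B" for b using that by (auto simp: B_def)
    fix U and u :: "'a l2" assume "open U" "u \<in> U"
    then obtain e where e: "e > 0" "ball u e \<subseteq> U" by (auto simp: open_contains_ball)
    obtain r where r: "r \<in> \<rat>" "0 < r" "r < e / 2" using Rats_dense_in_real[of 0 "e/2"] e by auto
    have "u \<in> closure l2_dense" by (simp add: closure_l2_dense)
    then obtain d where d: "d \<in> l2_dense" "dist d u < r"
      using r(2) by (auto simp: closure_approachable)
    have "ball d r \<subseteq> ball u e"
    proof
      fix z assume "z \<in> ball d r"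
      then show "z \<in> ball u e" using d(2) r(3) dist_triangle[of u z d] by (simp add: dist_commute)
    qed
    then show "\<exists>b\<in>B. u \<in> b \<and> b \<subseteq> U"
      using d r e by (intro bexI[of _ "ball d r"]) (auto simp: B_def)
  qed
  moreover have "countable B"
    unfolding B_def by (intro countable_image countable_SIGMA countable_l2_dense countable_Int1 countable_rat)
  ultimately show "\<exists>B::'a l2 set set. countable B \<and> open = generate_topology B"
    using topological_basis_imp_subbasis by blast
qed

section \<open>Fourier transform and Sobolev spaces\<close>

text \<open>The unitary normalisation is used: the norm of \<open>H\<^sup>0\<close> is the norm of \<open>L\<^sup>2\<close>.\<close>

definition fourier_integral :: "(real \<Rightarrow> real) \<Rightarrow> real \<Rightarrow> complex" where
  "fourier_integral g \<xi> =
     (\<integral>x. cis (- (\<xi> * x)) * complex_of_real (g x) \<partial>lborel) / complex_of_real (sqrt (2 * pi))"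

text \<open>
  The Fourier-Plancherel transform: the limit in \<open>L\<^sup>2\<close> of the Fourier integrals of the truncations
  to \<open>[-n, n]\<close>.
\<close>

definition fourier :: "real l2 \<Rightarrow> complex l2" where
  "fourier u =
     lim (\<lambda>n. abs_l2 (fourier_integral (\<lambda>x. indicator {- real n..real n} x * rep_l2 u x)))"

definition sobolev :: "real \<Rightarrow> real l2 set" where
  "sobolev l =
     {u. integrable lborel (\<lambda>\<xi>. (1 + \<xi>\<^sup>2) powr l * (cmod (rep_l2 (fourier u) \<xi>))\<^sup>2)}"

definition sobolev_norm :: "real \<Rightarrow> real l2 \<Rightarrow> real" where
  "sobolev_norm l u =
     sqrt (\<integral>\<xi>. (1 + \<xi>\<^sup>2) powr l * (cmod (rep_l2 (fourier u) \<xi>))\<^sup>2 \<partial>lborel)"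


section \<open>Mild solutions\<close>

text \<open>
  The Fourier multiplier \<open>(1 - \<partial>\<^sub>x\<^sub>x)\<^sup>-\<^sup>1\<close>, applied to the distribution whose Fourier transform is \<open>F\<close>.
\<close>

definition inv_helmholtz :: "(real \<Rightarrow> complex) \<Rightarrow> real l2" where
  "inv_helmholtz F =
     (THE v. AE \<xi> in lborel. rep_l2 (fourier v) \<xi> = F \<xi> / complex_of_real (1 + \<xi>\<^sup>2))"

text \<open>
  \<open>(1 - \<partial>\<^sub>x\<^sub>x)\<^sup>-\<^sup>1 (g - 1/2 \<partial>\<^sub>x(w\<^sup>2))\<close>. As \<open>w\<close> lies in \<open>L\<^sup>2\<close>, its square lies in \<open>L\<^sup>1\<close>, so that the
  Fourier transform of the square is given by the absolutely convergent integral.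
\<close>

definition bbm_rhs :: "real l2 \<Rightarrow> real l2 \<Rightarrow> real l2" where
  "bbm_rhs g w =
     inv_helmholtz (\<lambda>\<xi>. rep_l2 (fourier g) \<xi>
       - 1 / 2 * (\<i> * complex_of_real \<xi> * fourier_integral (\<lambda>x. (rep_l2 w x)\<^sup>2) \<xi>))"

text \<open>
  The time variable ranges over \<open>[0, \<infinity>)\<close>; values of \<open>f\<close> and \<open>u\<close> at negative times are
  irrelevant. The integral is the Bochner integral in \<open>L\<^sup>2\<close>, which is also the value of the Bochner
  integral in \<open>H\<^sup>l\<close>, as \<open>H\<^sup>l\<close> is continuously embedded in \<open>L\<^sup>2\<close>.
\<close>

definition mild_solution :: "real \<Rightarrow> (real \<Rightarrow> real l2) \<Rightarrow> (real \<Rightarrow> real l2) \<Rightarrow> bool" where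
  "mild_solution l f u \<longleftrightarrow>
     (\<forall>t\<ge>0. u t \<in> sobolev l) \<and>
     (\<forall>t\<ge>0. ((\<lambda>s. sobolev_norm l (u s - u t)) \<longlongrightarrow> 0) (at t within {0..})) \<and>
     (\<forall>t\<ge>0. set_integrable lebesgue {0..t} (\<lambda>s. exp (- (t - s)) *\<^sub>R bbm_rhs (f s) (u s)) \<and>
        u t = exp (- t) *\<^sub>R u 0 + (LINT s:{0..t}|lebesgue. exp (- (t - s)) *\<^sub>R bbm_rhs (f s) (u s)))"

definition solves :: "real \<Rightarrow> (real \<Rightarrow> real l2) \<Rightarrow> real l2 \<Rightarrow> (real \<Rightarrow> real l2) \<Rightarrow> bool" where
  "solves l f \<phi> u \<longleftrightarrow> mild_solution l f u \<and> u 0 = \<phi>"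

definition solves_uniquely :: "real \<Rightarrow> (real \<Rightarrow> real l2) \<Rightarrow> real l2 \<Rightarrow> (real \<Rightarrow> real l2) \<Rightarrow> bool" where
  "solves_uniquely l f \<phi> u \<longleftrightarrow>
     solves l f \<phi> u \<and> (\<forall>v. solves l f \<phi> v \<longrightarrow> (\<forall>t\<ge>0. v t = u t))"

definition time_periodic :: "real \<Rightarrow> (real \<Rightarrow> real l2) \<Rightarrow> bool" where
  "time_periodic \<theta> u \<longleftrightarrow> (\<forall>t\<ge>0. u (t + \<theta>) = u t)"

definition periodic_solution :: "real \<Rightarrow> real \<Rightarrow> (real \<Rightarrow> real l2) \<Rightarrow> (real \<Rightarrow> real l2) \<Rightarrow> bool" where
  "periodic_solution l \<theta> f u \<longleftrightarrow> mild_solution l f u \<and> time_periodic \<theta> u"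


section \<open>Forcing terms, smallness and well-posedness\<close>

definition forcing_term :: "(real \<Rightarrow> real l2) \<Rightarrow> bool" where
  "forcing_term f \<longleftrightarrow> f \<in> borel_measurable (lebesgue_on {0..})"

text \<open>The supremum is formed in \<open>[0, \<infinity>]\<close>, so that it is meaningful for unbounded \<open>f\<close> too.\<close>

definition forcing_sup :: "(real \<Rightarrow> real l2) \<Rightarrow> ennreal" where
  "forcing_sup f = (SUP t\<in>{0..}. ennreal (norm (f t)))"

definition data_size :: "real \<Rightarrow> real l2 \<Rightarrow> (real \<Rightarrow> real l2) \<Rightarrow> ennreal" where
  "data_size l \<phi> f = ennreal (sobolev_norm l \<phi>) + forcing_sup f"

text \<open>
  For data of size at most \<open>\<delta>\<close>: existence and uniqueness of the solution, its continuous
  dependence on the data, and the a priori estimate on \<open>[\<tau>, \<tau> + T]\<close>. The forcing need not be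
  periodic here.
\<close>

definition well_posed_below :: "real \<Rightarrow> real \<Rightarrow> real \<Rightarrow> real \<Rightarrow> bool" where
  "well_posed_below l \<tau> T \<delta> \<longleftrightarrow>
     (\<forall>\<phi>\<in>sobolev l. \<forall>f. forcing_term f \<and> data_size l \<phi> f \<le> ennreal \<delta> \<longrightarrow>
        (\<exists>u. solves_uniquely l f \<phi> u)) \<and>
     (\<forall>\<phi>\<in>sobolev l. \<forall>f u S \<epsilon>.
        forcing_term f \<and> data_size l \<phi> f \<le> ennreal \<delta> \<and> solves l f \<phi> u \<and> 0 < S \<and> 0 < \<epsilon> \<longrightarrow>
        (\<exists>\<eta>>0. \<forall>\<psi>\<in>sobolev l. \<forall>g v.
           forcing_term g \<and> data_size l \<psi> g \<le> ennreal \<delta> \<and> solves l g \<psi> v \<and>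
           data_size l (\<psi> - \<phi>) (\<lambda>t. g t - f t) < ennreal \<eta> \<longrightarrow>
           (\<forall>t\<in>{0..S}. sobolev_norm l (v t - u t) < \<epsilon>))) \<and>
     (\<exists>C::real. \<forall>\<phi>\<in>sobolev l. \<forall>f u.
        forcing_term f \<and> data_size l \<phi> f \<le> ennreal \<delta> \<and> solves l f \<phi> u \<longrightarrow>
        (SUP s\<in>{\<tau>..\<tau> + T}. ennreal (sobolev_norm l (u s)))
          + ennreal (sqrt (LINT s:{\<tau>..\<tau> + T}|lebesgue. (sobolev_norm l (u s))\<^sup>2))
        \<le> ennreal C * data_size l \<phi> f)"


section \<open>Stability\<close>

definition exp_attracted ::
    "real \<Rightarrow> (real \<Rightarrow> real l2) \<Rightarrow> (real \<Rightarrow> real l2) \<Rightarrow> real \<Rightarrow> real l2 \<Rightarrow> bool" where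
  "exp_attracted l f v r u0 \<longleftrightarrow>
     (\<exists>u. solves_uniquely l f u0 u \<and>
        (\<exists>K. \<forall>t\<ge>0. sobolev_norm l (u t - v t) \<le> K * exp (- r * t)))"

definition locally_exp_stable ::
    "real \<Rightarrow> (real \<Rightarrow> real l2) \<Rightarrow> (real \<Rightarrow> real l2) \<Rightarrow> real \<Rightarrow> bool" where
  "locally_exp_stable l f v r \<longleftrightarrow>
     (\<exists>\<eta>>0. \<forall>u0\<in>sobolev l. sobolev_norm l (u0 - v 0) < \<eta> \<longrightarrow> exp_attracted l f v r u0)"

end

theory Submission
  imports Defs "HOL-Probability.Characteristic_Functions" "HOL-Probability.Sinc_Integral"
begin

text \<open>
  In the coordinate \<open>a = (1 - \<partial>\<^sub>x\<^sub>x)\<^bsup>l/2\<^esup> u\<close>, which maps \<open>H\<^sup>l\<close> isometrically onto \<open>L\<^sup>2\<close>, the equation becomes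
  \<open>a' = - a + G(t) + B(a, a)\<close> with a bounded bilinear \<open>B\<close>: on the Fourier side the quadratic term is
  a convolution of \<open>L\<^sup>2\<close> functions, hence bounded, and the multiplier \<open>\<xi> / (1 + \<xi>\<^sup>2)\<close> is square integrable.
  For small data and forcing the linear damping dominates \<open>B\<close>, so that solutions stay in a small ball on
  which the flow contracts; the periodic solution is the fixed point of the period map. Data of any
  size are written as a small part plus a part in \<open>H\<^sup>1\<close>. The small part evolves into a small solution
  \<open>v\<close>, and the difference \<open>w\<close> to the full solution solves an unforced equation in which \<open>w w\<^sub>x\<close> drops
  out of the \<open>H\<^sup>1\<close> energy balance while \<open>(v w)\<^sub>x\<close> is absorbed by the damping. Hence \<open>w\<close> exists globally and
  decays exponentially, every solution is attracted by a small one, and any two solutions attract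
  each other; this also yields uniqueness of the periodic solution among those of any size.
\<close>

section \<open>The Duhamel integral\<close>

text \<open>All evolution takes place in the one Hilbert space \<open>real l2\<close>; Sobolev
  spaces enter only through \<open>bessel\<close>. The splitting rests on the identity
  \<open>B a (I c) = I (D (J a) c)\<close>: \<open>J a\<close> is the function with coordinate
  \<open>a\<close>, \<open>I\<close> (of order 1 - l) passes from coordinates of H^1 to coordinates
  of H^l, and \<open>D\<close> is the quadratic term with its second argument read in H^1
  coordinates. Hence a perturbation starting in the range of \<open>I\<close> stays there, and its
  H^1 norm is simply the norm of \<open>c\<close>. As \<open>D\<close> takes its first argument in
  plain L2, the rough part \<open>v\<close> needs no extra regularity. The obstacle for large data
  is global existence. The quadratic term is first cut off by a radial projection, which makes the
  equation globally Lipschitz. On each ray the projection is multiplication by a scalar, so the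
  skewness survives the cut-off, and the resulting energy bound shows that the cut-off is never
  active. The linear damping has rate 1. Half of it is enough to absorb every error term, which
  leaves the common decay rate 1/2.\<close>

definition duhamel :: "(real \<Rightarrow> 'a::{banach, second_countable_topology}) \<Rightarrow> real \<Rightarrow> 'a" where
  "duhamel h t = (LINT s:{0..t}|lebesgue. exp (- (t - s)) *\<^sub>R h s)"

text \<open>The forcing is measurable only on the half line. Cutting \<open>h\<close> off by the
  indicator of \<open>{0..}\<close> makes it measurable on the whole line without changing anything
  on \<open>A\<close>.\<close>

lemma set_borel_measurable_half_line:
  fixes h :: "real \<Rightarrow> 'a::{banach, second_countable_topology}"
  assumes h: "h \<in> borel_measurable (lebesgue_on {0..})" and A: "A \<in> sets lebesgue" "A \<subseteq> {0..}"
    and w: "w \<in> borel_measurable borel"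
  shows "set_borel_measurable lebesgue A (\<lambda>s. w s *\<^sub>R h s)"
proof -
  have [measurable]: "(\<lambda>s. indicator {0..} s *\<^sub>R h s) \<in> borel_measurable lebesgue"
    by (rule borel_measurable_restrict_space_iff[THEN iffD1, OF _ h]) simp
  have [measurable]: "w \<in> borel_measurable lebesgue"
    by (rule measurable_completion) (use w in simp)
  have [measurable]: "A \<in> sets lebesgue" by (rule A)
  have "(\<lambda>s. (indicator A s * w s) *\<^sub>R (indicator {0..} s *\<^sub>R h s)) \<in> borel_measurable lebesgue"
    by measurable
  also have "(\<lambda>s. (indicator A s * w s) *\<^sub>R (indicator {0..} s *\<^sub>R h s)) = (\<lambda>s. indicator A s *\<^sub>R w s *\<^sub>R h s)"
    by (rule ext) (use A(2) in \<open>auto simp: indicator_def\<close>)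
  finally show ?thesis by (simp add: set_borel_measurable_def)
qed

lemma set_integral_exp_Icc:
  fixes \<mu> t :: real
  assumes "0 \<le> t" "\<mu> > 0"
  shows "set_integrable lebesgue {0..t} (\<lambda>s. C * exp (\<mu> * s))"
    "(LINT s:{0..t}|lebesgue. C * exp (\<mu> * s)) = C * (exp (\<mu> * t) - 1) / \<mu>"
proof -
  have "has_bochner_integral lborel (\<lambda>s. C * exp (\<mu> * s) * indicator {0..t} s)
      (C * exp (\<mu> * t) / \<mu> - C * exp (\<mu> * 0) / \<mu>)"
    by (rule has_bochner_integral_FTC_Icc_real)
       (use assms in \<open>auto intro!: derivative_eq_intros continuous_intros\<close>)
  then have *: "has_bochner_integral lebesgue (\<lambda>s. indicator {0..t} s *\<^sub>R (C * exp (\<mu> * s)))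
      (C * (exp (\<mu> * t) - 1) / \<mu>)"
    by (auto simp: has_bochner_integral_iff integrable_completion integral_completion mult.commute
        right_diff_distrib diff_divide_distrib)
  show "set_integrable lebesgue {0..t} (\<lambda>s. C * exp (\<mu> * s))"
    using * by (simp add: set_integrable_def has_bochner_integral_iff)
  show "(LINT s:{0..t}|lebesgue. C * exp (\<mu> * s)) = C * (exp (\<mu> * t) - 1) / \<mu>"
    using * unfolding set_lebesgue_integral_def has_bochner_integral_iff by blast
qed

text \<open>The exponential majorant is integrated explicitly. The exponent \<open>\<kappa>\<close>
  is 0 for bounds, -1/2 for decay and positive for growth estimates. The factor
  \<open>1 - exp (- (1 + \<kappa>) * t)\<close> is kept because in \<open>duhamel_comparison\<close>
  it is complementary to the weight of the initial value.\<close>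

lemma duhamel_bound:
  fixes h :: "real \<Rightarrow> 'a::{banach, second_countable_topology}"
  assumes t: "0 \<le> t" and h: "h \<in> borel_measurable (lebesgue_on {0..})"
    and bd: "\<And>s. s \<in> {0..t} \<Longrightarrow> norm (h s) \<le> C * exp (\<kappa> * s)" and \<kappa>: "1 + \<kappa> > 0"
  shows "set_integrable lebesgue {0..t} (\<lambda>s. exp (- (t - s)) *\<^sub>R h s)"
    and "norm (duhamel h t) \<le> C * exp (\<kappa> * t) * (1 - exp (- (1 + \<kappa>) * t)) / (1 + \<kappa>)"
proof -
  let ?w = "\<lambda>s. (C * exp (- t)) * exp ((1 + \<kappa>) * s)"
  have w: "set_integrable lebesgue {0..t} ?w" by (rule set_integral_exp_Icc[OF t \<kappa>])
  have meas: "set_borel_measurable lebesgue {0..t} (\<lambda>s. exp (- (t - s)) *\<^sub>R h s)"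
    by (rule set_borel_measurable_half_line[OF h]) (auto intro!: borel_measurable_continuous_onI continuous_intros)
  have bd': "norm (exp (- (t - s)) *\<^sub>R h s) \<le> ?w s" if "s \<in> {0..t}" for s
  proof -
    have "norm (exp (- (t - s)) *\<^sub>R h s) \<le> exp (- (t - s)) * (C * exp (\<kappa> * s))"
      using bd[OF that] by (simp add: mult_left_mono)
    also have "\<dots> = ?w s" by (simp add: exp_add exp_diff exp_minus field_simps)
    finally show ?thesis .
  qed
  show int: "set_integrable lebesgue {0..t} (\<lambda>s. exp (- (t - s)) *\<^sub>R h s)"
    by (rule set_integrable_bound[OF w meas]) (auto intro!: AE_I2 order_trans[OF bd'[simplified]])
  have "norm (duhamel h t) \<le> (LINT s:{0..t}|lebesgue. norm (exp (- (t - s)) *\<^sub>R h s))"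
    unfolding duhamel_def by (rule set_integral_norm_bound[OF int])
  also have "\<dots> \<le> (LINT s:{0..t}|lebesgue. ?w s)"
    by (rule set_integral_mono[OF set_integrable_norm[OF int] w bd'])
  also have "\<dots> = C * exp (- t) * (exp ((1 + \<kappa>) * t) - 1) / (1 + \<kappa>)"
    by (rule set_integral_exp_Icc[OF t \<kappa>])
  also have "\<dots> = C * exp (\<kappa> * t) * (1 - exp (- (1 + \<kappa>) * t)) / (1 + \<kappa>)"
    by (simp add: right_diff_distrib mult_exp_exp mult.assoc) (simp add: algebra_simps mult_exp_exp)
  finally show "norm (duhamel h t) \<le> C * exp (\<kappa> * t) * (1 - exp (- (1 + \<kappa>) * t)) / (1 + \<kappa>)" .
qed

lemma duhamel_integrable:
  fixes h :: "real \<Rightarrow> 'a::{banach, second_countable_topology}"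
  assumes "0 \<le> t" and "h \<in> borel_measurable (lebesgue_on {0..})"
    and "\<And>s. s \<in> {0..t} \<Longrightarrow> norm (h s) \<le> C"
  shows "set_integrable lebesgue {0..t} (\<lambda>s. exp (- (t - s)) *\<^sub>R h s)"
  using duhamel_bound(1)[of t h C 0] assms by simp

lemma duhamel_diff:
  assumes "set_integrable lebesgue {0..t} (\<lambda>s. exp (- (t - s)) *\<^sub>R h s)"
    "set_integrable lebesgue {0..t} (\<lambda>s. exp (- (t - s)) *\<^sub>R k s)"
  shows "duhamel (\<lambda>s. h s - k s) t = duhamel h t - duhamel k t"
  unfolding duhamel_def using assms by (simp add: scaleR_diff_right set_integral_diff)

lemma duhamel_add:
  assumes "set_integrable lebesgue {0..t} (\<lambda>s. exp (- (t - s)) *\<^sub>R h s)"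
    "set_integrable lebesgue {0..t} (\<lambda>s. exp (- (t - s)) *\<^sub>R k s)"
  shows "duhamel (\<lambda>s. h s + k s) t = duhamel h t + duhamel k t"
  unfolding duhamel_def using assms by (simp add: scaleR_add_right set_integral_add)

lemma duhamel_bounded_linear:
  assumes "bounded_linear A" "set_integrable lebesgue {0..t} (\<lambda>s. exp (- (t - s)) *\<^sub>R h s)"
  shows "duhamel (\<lambda>s. A (h s)) t = A (duhamel h t)"
    "set_integrable lebesgue {0..t} (\<lambda>s. exp (- (t - s)) *\<^sub>R A (h s))"
proof -
  interpret bounded_linear A by fact
  have eq: "indicator {0..t} s *\<^sub>R exp (- (t - s)) *\<^sub>R A (h s) = A (indicator {0..t} s *\<^sub>R exp (- (t - s)) *\<^sub>R h s)" for s
    by (simp only: scaleR)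
  show "duhamel (\<lambda>s. A (h s)) t = A (duhamel h t)"
    using integral_bounded_linear[OF assms(1) assms(2)[unfolded set_integrable_def]]
    unfolding duhamel_def set_lebesgue_integral_def eq .
  show "set_integrable lebesgue {0..t} (\<lambda>s. exp (- (t - s)) *\<^sub>R A (h s))"
    using integrable_bounded_linear[OF assms(1) assms(2)[unfolded set_integrable_def]]
    unfolding set_integrable_def eq .
qed

lemma duhamel_cong:
  "(\<And>s. s \<in> {0..t} \<Longrightarrow> h s = k s) \<Longrightarrow> duhamel h t = duhamel k t"
  unfolding duhamel_def by (rule set_lebesgue_integral_cong) auto

text \<open>Holds for arbitrary \<open>h\<close>: on a one-point interval the integrand depends on
  \<open>h 0\<close> alone, hence is measurable, and it vanishes almost everywhere.\<close>

lemma duhamel_0 [simp]: "duhamel h 0 = 0"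
proof -
  have "duhamel h 0 = (LINT s::real|lebesgue. 0)"
    unfolding duhamel_def set_lebesgue_integral_def
  proof (rule Bochner_Integration.integral_cong_AE)
    have "(\<lambda>s. indicator {0} s *\<^sub>R h 0) \<in> borel_measurable lebesgue"
      by (intro borel_measurable_scaleR borel_measurable_indicator) auto
    also have "(\<lambda>s. indicator {0} s *\<^sub>R h 0) = (\<lambda>s. indicator {0..0} s *\<^sub>R exp (- (0 - s)) *\<^sub>R h s)"
      by (auto simp: indicator_def)
    finally show "(\<lambda>s. indicator {0..0} s *\<^sub>R exp (- (0 - s)) *\<^sub>R h s) \<in> borel_measurable lebesgue" .
    have "AE s in lborel. s \<noteq> (0::real)" by (rule AE_lborel_singleton)
    then have "AE s in lebesgue. s \<noteq> (0::real)" by (rule AE_completion)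
    then show "AE s in lebesgue. indicator {0..0} s *\<^sub>R exp (- (0 - s)) *\<^sub>R h s = 0"
      by eventually_elim (auto simp: indicator_def)
  qed simp
  then show ?thesis by simp
qed

text \<open>Pulling out the factor that depends on \<open>t\<close> leaves an indefinite integral
  with a fixed integrand; continuity, differentiability and the shift rule are all read off from
  this form.\<close>

lemma duhamel_eq:
  "duhamel h t = exp (- t) *\<^sub>R (LINT s:{0..t}|lebesgue. exp s *\<^sub>R h s)"
proof -
  have "exp (- (t - s)) = exp (- t) * exp s" for s
    by (simp add: mult_exp_exp)
  then show ?thesis unfolding duhamel_def by (simp flip: scaleR_scaleR)
qed

text \<open>One estimate for two purposes: with \<open>c = 0\<close> it says that the indefinite
  integral is Lipschitz, with \<open>c\<close> the value of a continuous integrand it is the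
  fundamental theorem of calculus.\<close>

lemma set_integral_increment_bound:
  fixes k :: "real \<Rightarrow> 'a::{banach, second_countable_topology}"
  assumes ab: "0 \<le> a" "a \<le> b" and k: "set_integrable lebesgue {0..b} k"
    and bd: "\<And>s. s \<in> {a..b} \<Longrightarrow> norm (k s - c) \<le> M"
  shows "norm ((LINT s:{0..b}|lebesgue. k s) - (LINT s:{0..a}|lebesgue. k s) - (b - a) *\<^sub>R c) \<le> M * (b - a)"
proof -
  have k1: "set_integrable lebesgue {0..a} k" and k2: "set_integrable lebesgue {a<..b} k"
    using ab by (auto intro!: set_integrable_subset[OF k])
  have eq: "{0..b} = {0..a} \<union> {a<..b}" using ab by auto
  have 1: "(LINT s:{0..b}|lebesgue. k s) = (LINT s:{0..a}|lebesgue. k s) + (LINT s:{a<..b}|lebesgue. k s)"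
    unfolding eq by (rule set_integral_Un[OF _ k1 k2]) auto
  have ci: "set_integrable lebesgue {a<..b} (\<lambda>_. c)" for c :: 'a
    by (auto simp: set_integrable_def integrable_completion
        intro!: integrable_scaleR_left integrable_real_indicator) (simp add: ab)
  have cr: "set_integrable lebesgue {a<..b} (\<lambda>_. M)"
    using ab by (auto simp: set_integrable_def integrable_completion intro!: integrable_real_indicator)
  have 2: "(LINT s:{a<..b}|lebesgue. c) = (b - a) *\<^sub>R c"
    using ab by (simp add: set_lebesgue_integral_def)
  have "norm (LINT s:{a<..b}|lebesgue. k s - c) \<le> (LINT s:{a<..b}|lebesgue. norm (k s - c))"
    by (intro set_integral_norm_bound set_integral_diff k2 ci)
  also have "\<dots> \<le> (LINT s:{a<..b}|lebesgue. M)"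
    by (intro set_integral_mono set_integrable_norm set_integral_diff k2 ci cr bd) auto
  also have "\<dots> = M * (b - a)" using ab by (simp add: set_lebesgue_integral_def)
  finally show ?thesis using 1 2 by (simp add: set_integral_diff k2 ci)
qed

lemma set_integrable_exp_weight:
  assumes "set_integrable lebesgue {0..t} (\<lambda>s. exp (- (t - s)) *\<^sub>R h s)"
  shows "set_integrable lebesgue {0..t} (\<lambda>s. exp s *\<^sub>R h s)"
proof -
  have "set_integrable lebesgue {0..t} (\<lambda>s. exp t *\<^sub>R exp (- (t - s)) *\<^sub>R h s)"
    using assms by (rule set_integrable_scaleR_right)
  then show ?thesis by (simp add: exp_diff exp_minus field_simps)
qed

lemma continuous_on_half_line:
  fixes P :: "real \<Rightarrow> 'a::metric_space"
  assumes "\<And>S. 0 \<le> S \<Longrightarrow> continuous_on {0..S} P"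
  shows "continuous_on {0..} P"
  unfolding continuous_on_eq_continuous_within
proof
  fix t :: real assume t: "t \<in> {0..}"
  have "at t within {0..} = at t within {0..t + 1}"
    by (rule at_within_nhd[of t "{t - 1<..<t + 1}"]) (use t in auto)
  moreover have "continuous (at t within {0..t + 1}) P"
    using assms[of "t + 1"] t by (auto simp: continuous_on_eq_continuous_within)
  ultimately show "continuous (at t within {0..}) P" by (simp add: continuous_within)
qed

lemma duhamel_continuous:
  fixes h :: "real \<Rightarrow> 'a::{banach, second_countable_topology}"
  assumes h: "h \<in> borel_measurable (lebesgue_on {0..})"
    and bd: "\<And>S. 0 \<le> S \<Longrightarrow> \<exists>C. \<forall>s\<in>{0..S}. norm (h s) \<le> C"
  shows "continuous_on {0..} (duhamel h)"
proof (rule continuous_on_half_line)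
  fix S :: real assume S: "0 \<le> S"
  define P where "P t = (LINT s:{0..t}|lebesgue. exp s *\<^sub>R h s)" for t
  obtain C where C: "\<And>s. s \<in> {0..S} \<Longrightarrow> norm (h s) \<le> C" using bd[OF S] by blast
  have C0: "0 \<le> C" using norm_ge_zero[of "h 0"] C[of 0] S by (simp del: norm_ge_zero)
  have *: "norm (P b - P a) \<le> exp S * C * (b - a)" if "0 \<le> a" "a \<le> b" "b \<le> S" for a b
  proof -
    have "set_integrable lebesgue {0..b} (\<lambda>s. exp s *\<^sub>R h s)"
      using that C by (intro set_integrable_exp_weight duhamel_integrable[OF _ h, of b C]) auto
    moreover have "norm (exp s *\<^sub>R h s - 0) \<le> exp S * C" if "s \<in> {a..b}" for s
      using that \<open>0 \<le> a\<close> \<open>b \<le> S\<close> C[of s] by (auto intro!: mult_mono)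
    ultimately show ?thesis
      using set_integral_increment_bound[OF that(1,2), of "\<lambda>s. exp s *\<^sub>R h s" 0 "exp S * C"]
      by (simp add: P_def)
  qed
  have "(exp S * C)-lipschitz_on {0..S} P"
  proof (rule lipschitz_onI)
    fix x y assume "x \<in> {0..S}" "y \<in> {0..S}"
    then show "dist (P x) (P y) \<le> exp S * C * dist x y"
      using *[of x y] *[of y x] by (cases "x \<le> y") (auto simp: dist_norm norm_minus_commute)
  qed (use C0 in simp)
  then have "continuous_on {0..S} P" by (rule lipschitz_on_continuous_on)
  then show "continuous_on {0..S} (duhamel h)"
    unfolding duhamel_eq[abs_def] P_def by (intro continuous_intros)
qed

lemma continuous_half_line_bounded:
  fixes a :: "real \<Rightarrow> 'a::real_normed_vector"
  assumes "continuous_on {0..} a"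
  shows "\<exists>C. \<forall>s\<in>{0..S}. norm (a s) \<le> C"
proof -
  have "compact (a ` {0..S})"
    by (intro compact_continuous_image continuous_on_subset[OF assms]) auto
  then show ?thesis by (auto dest!: compact_imp_bounded simp: bounded_iff)
qed

lemma measurable_half_line:
  fixes a :: "real \<Rightarrow> 'a::real_normed_vector"
  assumes "continuous_on {0..} a"
  shows "a \<in> borel_measurable (lebesgue_on {0..})"
  by (rule continuous_imp_measurable_on_sets_lebesgue[OF assms]) simp

text \<open>Supplies the differential equation behind the integral equation, as the energy method
  needs it. This requires a continuous \<open>h\<close>, which the smooth part of a solution has
  even though the forcing is merely measurable.\<close>

lemma duhamel_has_derivative:
  fixes h :: "real \<Rightarrow> 'a::{banach, second_countable_topology}"
  assumes h: "continuous_on {0..} h" and t: "0 < t"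
  shows "(duhamel h has_vector_derivative (h t - duhamel h t)) (at t)"
proof -
  define k where "k s = exp s *\<^sub>R h s" for s
  define P where "P t = (LINT s:{0..t}|lebesgue. k s)" for t
  have k: "continuous_on {0..} k" unfolding k_def by (intro continuous_intros h)
  have int: "set_integrable lebesgue {0..b} k" if "0 \<le> b" for b
  proof -
    obtain C where "\<forall>s\<in>{0..b}. norm (h s) \<le> C" using continuous_half_line_bounded[OF h] by blast
    then show ?thesis
      unfolding k_def using that measurable_half_line[OF h]
      by (intro set_integrable_exp_weight duhamel_integrable[of b h C]) auto
  qed
  have "(P has_vector_derivative k t) (at t)"
    unfolding has_vector_derivative_def has_derivative_within_alt
  proof (intro conjI allI impI)
    show "bounded_linear (\<lambda>x. x *\<^sub>R k t)" by (rule bounded_linear_scaleR_left)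
    fix e :: real assume e: "0 < e"
    have "isCont k t" using k t by (auto simp: continuous_on_interior)
    then obtain d where d: "d > 0" "\<And>s. \<bar>s - t\<bar> < d \<Longrightarrow> norm (k s - k t) < e"
      using e by (auto simp: continuous_at_eps_delta dist_norm)
    show "\<exists>d>0. \<forall>y\<in>UNIV. norm (y - t) < d \<longrightarrow> norm (P y - P t - (y - t) *\<^sub>R k t) \<le> e * norm (y - t)"
    \<comment> \<open>The bound by \<open>t\<close> keeps \<open>y\<close> positive, where
      \<open>P\<close> is an integral over a genuine interval.\<close>
    proof (intro exI[of _ "min d t"] conjI ballI impI)
      fix y assume y: "norm (y - t) < min d t"
      show "norm (P y - P t - (y - t) *\<^sub>R k t) \<le> e * norm (y - t)"
      proof (cases "t \<le> y")
        case True
        have "norm (P y - P t - (y - t) *\<^sub>R k t) \<le> e * (y - t)"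
          unfolding P_def using True y t d(2)
          by (intro set_integral_increment_bound int) (auto intro!: less_imp_le)
        then show ?thesis using True by simp
      next
        case False
        have "norm (P t - P y - (t - y) *\<^sub>R k t) \<le> e * (t - y)"
          unfolding P_def using False y t d(2)
          by (intro set_integral_increment_bound int) (auto intro!: less_imp_le)
        moreover have "norm (P t - P y - (t - y) *\<^sub>R k t) = norm (P y - P t - (y - t) *\<^sub>R k t)"
          by (rule trans[OF norm_minus_cancel[symmetric]]) (simp add: algebra_simps)
        ultimately show ?thesis using False by simp
      qed
    qed (use d t in auto)
  qed
  then have "((\<lambda>t. exp (- t) *\<^sub>R P t) has_vector_derivative (exp (- t) *\<^sub>R k t + (- exp (- t)) *\<^sub>R P t)) (at t)"
    by (intro has_vector_derivative_scaleR) (auto intro!: derivative_eq_intros)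
  moreover have "exp (- t) *\<^sub>R k t + (- exp (- t)) *\<^sub>R P t = h t - duhamel h t"
    by (simp add: duhamel_eq P_def k_def exp_minus)
  moreover have "(\<lambda>t. exp (- t) *\<^sub>R P t) = duhamel h"
    by (simp add: fun_eq_iff duhamel_eq P_def k_def)
  ultimately show ?thesis by simp
qed

text \<open>The integral is split at \<open>\<theta>\<close> and the second piece translated back to
  the origin; the common endpoint is a null set. This is what makes the time shift of a solution a
  solution.\<close>

lemma duhamel_shift:
  fixes h :: "real \<Rightarrow> 'a::{banach, second_countable_topology}"
  assumes t: "0 \<le> t" "0 \<le> \<theta>" and h: "h \<in> borel_measurable (lebesgue_on {0..})"
    and bd: "\<And>s. s \<in> {0..t + \<theta>} \<Longrightarrow> norm (h s) \<le> C"
  shows "duhamel h (t + \<theta>) = exp (- t) *\<^sub>R duhamel h \<theta> + duhamel (\<lambda>s. h (s + \<theta>)) t"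
proof -
  define k where "k s = exp s *\<^sub>R h s" for s
  have int: "set_integrable lebesgue {0..t + \<theta>} k"
    unfolding k_def using t bd by (intro set_integrable_exp_weight duhamel_integrable[OF _ h, of _ C]) auto
  have i1: "set_integrable lebesgue {0..\<theta>} k" and i2: "set_integrable lebesgue {\<theta>..t + \<theta>} k"
    using t by (auto intro!: set_integrable_subset[OF int])
  have "AE s in lborel. s \<noteq> \<theta>" by (rule AE_lborel_singleton)
  then have "AE s in lebesgue. s \<noteq> \<theta>" by (rule AE_completion)
  then have ae: "AE s in lebesgue. \<not> (s \<in> {0..\<theta>} \<and> s \<in> {\<theta>..t + \<theta>})"
    by eventually_elim auto
  have "(LINT s:{0..\<theta>} \<union> {\<theta>..t + \<theta>}|lebesgue. k s) = (LINT s:{0..\<theta>}|lebesgue. k s) + (LINT s:{\<theta>..t + \<theta>}|lebesgue. k s)"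
    by (rule set_integral_Un_AE[OF ae _ _ i1 i2]) auto
  moreover have "{0..\<theta>} \<union> {\<theta>..t + \<theta>} = {0..t + \<theta>}" using t by auto
  moreover have "(LINT s:{\<theta>..t + \<theta>}|lebesgue. k s) = (LINT s:{0..t}|lebesgue. k (s + \<theta>))"
  proof -
    have eq: "lebesgue = distr lebesgue lebesgue (\<lambda>x. \<theta> + x)"
      using lebesgue_real_affine[of 1 \<theta>] by (simp add: density_1)
    have m: "(\<lambda>x. \<theta> + x) \<in> lebesgue \<rightarrow>\<^sub>M lebesgue"
      using lebesgue_affine_measurable[where c= "\<lambda>x::real. 1" and t=\<theta>] by simp
    have "(LINT s:{\<theta>..t + \<theta>}|lebesgue. k s) = (\<integral>s. indicator {\<theta>..t + \<theta>} s *\<^sub>R k s \<partial>distr lebesgue lebesgue (\<lambda>x. \<theta> + x))"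
      unfolding set_lebesgue_integral_def by (subst eq) simp
    also have "\<dots> = (\<integral>s. indicator {\<theta>..t + \<theta>} (\<theta> + s) *\<^sub>R k (\<theta> + s) \<partial>lebesgue)"
      using i2[unfolded set_integrable_def, THEN borel_measurable_integrable] m
      by (intro integral_distr) auto
    also have "\<dots> = (LINT s:{0..t}|lebesgue. k (s + \<theta>))"
      unfolding set_lebesgue_integral_def
      by (intro Bochner_Integration.integral_cong) (auto simp: indicator_def add.commute)
    finally show ?thesis .
  qed
  ultimately have "(LINT s:{0..t + \<theta>}|lebesgue. k s) = (LINT s:{0..\<theta>}|lebesgue. k s) + (LINT s:{0..t}|lebesgue. k (s + \<theta>))"
    by simp
  moreover have "(LINT s:{0..t}|lebesgue. k (s + \<theta>)) = exp \<theta> *\<^sub>R (LINT s:{0..t}|lebesgue. exp s *\<^sub>R h (s + \<theta>))"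
  proof -
    have "k (s + \<theta>) = exp \<theta> *\<^sub>R exp s *\<^sub>R h (s + \<theta>)" for s by (simp add: k_def mult_exp_exp add.commute)
    then show ?thesis by (simp only: set_integral_scaleR_right)
  qed
  ultimately have "duhamel h (t + \<theta>) = exp (- (t + \<theta>)) *\<^sub>R ((LINT s:{0..\<theta>}|lebesgue. exp s *\<^sub>R h s)
      + exp \<theta> *\<^sub>R (LINT s:{0..t}|lebesgue. exp s *\<^sub>R h (s + \<theta>)))"
    unfolding duhamel_eq[of h "t + \<theta>"] k_def by (simp only:)
  also have "\<dots> = (exp (- t) * exp (- \<theta>)) *\<^sub>R (LINT s:{0..\<theta>}|lebesgue. exp s *\<^sub>R h s)
      + exp (- t) *\<^sub>R (LINT s:{0..t}|lebesgue. exp s *\<^sub>R h (s + \<theta>))"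
    unfolding scaleR_add_right scaleR_scaleR mult_exp_exp by simp
  also have "\<dots> = exp (- t) *\<^sub>R duhamel h \<theta> + duhamel (\<lambda>s. h (s + \<theta>)) t"
    unfolding duhamel_eq[of h \<theta>] duhamel_eq[of "\<lambda>s. h (s + \<theta>)" t] by (simp only: scaleR_scaleR)
  finally show ?thesis .
qed

text \<open>A Gronwall argument at a maximum point \<open>r\<close> of the weighted norm
  \<open>exp (- \<kappa> * t) * norm (z t)\<close>. If the maximum \<open>M\<close> exceeded
  \<open>A\<close>, the integral equation at \<open>r\<close> would bound \<open>M\<close> by a
  convex combination of \<open>A\<close> and \<open>M\<close> in which \<open>A\<close> has positive
  weight, so that \<open>M \<le> A\<close>. The condition on \<open>m\<close> says that level
  \<open>A\<close> is not left under the combined effect of damping, Lipschitz term and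
  source.\<close>

lemma duhamel_comparison:
  fixes z h :: "real \<Rightarrow> 'a::{banach, second_countable_topology}"
  assumes z: "continuous_on {0..S} z" and h: "h \<in> borel_measurable (lebesgue_on {0..})"
    and eq: "\<And>t. t \<in> {0..S} \<Longrightarrow> z t = exp (- t) *\<^sub>R z 0 + duhamel h t"
    and bd: "\<And>s. s \<in> {0..S} \<Longrightarrow> norm (h s) \<le> k * norm (z s) + m * exp (\<kappa> * s)"
    and k: "0 \<le> k" "k \<le> 1 + \<kappa>" "0 < 1 + \<kappa>" and z0: "norm (z 0) \<le> A" and m: "m \<le> (1 + \<kappa> - k) * A"
    and t: "t \<in> {0..S}"
  shows "norm (z t) \<le> exp (\<kappa> * t) * A"
proof -
  define g where "g t = exp (- \<kappa> * t) * norm (z t)" for t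
  have zg: "norm (z t) = exp (\<kappa> * t) * g t" for t by (simp add: g_def exp_minus)
  have "continuous_on {0..S} g" unfolding g_def by (intro continuous_intros z)
  then obtain r where r: "r \<in> {0..S}" "\<And>s. s \<in> {0..S} \<Longrightarrow> g s \<le> g r"
    using continuous_attains_sup[of "{0..S}" g] t by auto
  define M where "M = g r"
  have "M \<le> A"
  proof (rule ccontr)
    assume "\<not> M \<le> A"
    then have MA: "A < M" by simp
    have "norm (h s) \<le> (k * M + m) * exp (\<kappa> * s)" if "s \<in> {0..r}" for s
    proof -
      have "k * norm (z s) \<le> k * (exp (\<kappa> * s) * M)"
        unfolding zg using r that k by (intro mult_left_mono) (auto simp: M_def)
      then show ?thesis using bd[of s] that r(1) by (simp add: algebra_simps)
    qed
    then have "norm (duhamel h r) \<le> (k * M + m) * exp (\<kappa> * r) * (1 - exp (- (1 + \<kappa>) * r)) / (1 + \<kappa>)"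
      using r(1) k by (intro duhamel_bound(2)[OF _ h]) auto
    also have "\<dots> = exp (\<kappa> * r) * ((1 - exp (- (1 + \<kappa>) * r)) * ((k * M + m) / (1 + \<kappa>)))" by simp
    also have "\<dots> \<le> exp (\<kappa> * r) * ((1 - exp (- (1 + \<kappa>) * r)) * M)"
    proof (intro mult_left_mono)
      \<comment> \<open>Since \<open>A < M\<close>, the bound on \<open>m\<close> in terms of
        \<open>A\<close> carries over to \<open>M\<close>.\<close>
      have "k * M + m \<le> k * M + (1 + \<kappa> - k) * M"
        using m mult_left_mono[OF less_imp_le[OF MA], of "1 + \<kappa> - k"] k by simp
      also have "\<dots> = M * (1 + \<kappa>)" by (simp add: algebra_simps)
      finally show "(k * M + m) / (1 + \<kappa>) \<le> M" using k by (simp add: divide_le_eq)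
      have "0 \<le> (1 + \<kappa>) * r" using k r(1) by (intro mult_nonneg_nonneg) auto
      then have "- (1 + \<kappa>) * r \<le> 0" by linarith
      then show "0 \<le> 1 - exp (- (1 + \<kappa>) * r)" by (simp del: mult_minus_left)
    qed auto
    finally have d: "norm (duhamel h r) \<le> exp (\<kappa> * r) * ((1 - exp (- (1 + \<kappa>) * r)) * M)" .
    have "norm (z r) \<le> exp (- r) * norm (z 0) + norm (duhamel h r)"
      unfolding eq[OF r(1)] by (rule order_trans[OF norm_triangle_ineq]) simp
    also have "\<dots> \<le> exp (- r) * A + exp (\<kappa> * r) * ((1 - exp (- (1 + \<kappa>) * r)) * M)"
      using z0 d by (intro add_mono mult_left_mono) auto
    also have "exp (- r) * A = exp (\<kappa> * r) * (exp (- (1 + \<kappa>) * r) * A)"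
    proof -
      have "exp (- r) = exp (\<kappa> * r) * exp (- (1 + \<kappa>) * r)"
        unfolding mult_exp_exp by (rule arg_cong[of _ _ exp]) (simp add: algebra_simps)
      then show ?thesis by (simp only: mult.assoc)
    qed
    finally have "exp (\<kappa> * r) * M \<le> exp (\<kappa> * r) * (exp (- (1 + \<kappa>) * r) * A + (1 - exp (- (1 + \<kappa>) * r)) * M)"
      unfolding zg[of r] M_def[symmetric] distrib_left .
    then have "M \<le> exp (- (1 + \<kappa>) * r) * A + (1 - exp (- (1 + \<kappa>) * r)) * M"
      by (rule mult_left_le_imp_le) simp
    then have "exp (- (1 + \<kappa>) * r) * M \<le> exp (- (1 + \<kappa>) * r) * A"
      unfolding left_diff_distrib by simp
    then have "M \<le> A" by (rule mult_left_le_imp_le) simp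
    then show False using MA by simp
  qed
  then show ?thesis unfolding zg using r(2)[OF t] by (intro mult_left_mono) (auto simp: M_def)
qed

section \<open>Mild solutions of an abstract evolution equation\<close>

text \<open>The damping is built into the Duhamel integral and so is left out of \<open>F\<close>.
  Integrability of the integrand is obtained separately, from measurability and local
  bounds.\<close>

definition mild :: "(real \<Rightarrow> 'a \<Rightarrow> 'a::{banach, second_countable_topology}) \<Rightarrow> (real \<Rightarrow> 'a) \<Rightarrow> bool" where
  "mild F a \<longleftrightarrow> continuous_on {0..} a \<and> (\<forall>t\<ge>0. a t = exp (- t) *\<^sub>R a 0 + duhamel (\<lambda>s. F s (a s)) t)"

lemma mild_continuous: "mild F a \<Longrightarrow> continuous_on {0..} a"
  unfolding mild_def by blast

lemma mild_eq: "mild F a \<Longrightarrow> 0 \<le> t \<Longrightarrow> a t = exp (- t) *\<^sub>R a 0 + duhamel (\<lambda>s. F s (a s)) t"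
  unfolding mild_def by blast

lemma mild_cong:
  assumes "mild F a" and "\<And>s. 0 \<le> s \<Longrightarrow> F s (a s) = H s (a s)" shows "mild H a"
proof -
  have eq: "duhamel (\<lambda>s. F s (a s)) t = duhamel (\<lambda>s. H s (a s)) t" for t
    using assms(2) by (intro duhamel_cong) simp
  show ?thesis using assms(1) unfolding mild_def eq .
qed

text \<open>Picard iteration in the norm weighted by \<open>exp (- L * t)\<close> contracts with
  factor L / (1 + L) on the entire half line. A single application of Banach's theorem therefore
  gives a global solution, with no continuation argument.\<close>

lemma mild_exists:
  fixes F :: "real \<Rightarrow> 'a \<Rightarrow> 'a::{banach, second_countable_topology}"
  assumes L: "0 \<le> L"
    and meas: "\<And>a. continuous_on {0..} a \<Longrightarrow> (\<lambda>s. F s (a s)) \<in> borel_measurable (lebesgue_on {0..})"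
    and lip: "\<And>s x y. 0 \<le> s \<Longrightarrow> norm (F s x - F s y) \<le> L * norm (x - y)"
    and bd: "\<And>s. 0 \<le> s \<Longrightarrow> norm (F s 0) \<le> M"
  shows "\<exists>a. mild F a \<and> a 0 = a0"
proof -
  \<comment> \<open>The unknown is the weighted path \<open>b\<close>, which is bounded;
    \<open>w b\<close> removes the weight and \<open>f b\<close> is the weighted right-hand side of
    the integral equation.\<close>
  define w where "w b s = exp (L * s) *\<^sub>R apply_bcontfun b s" for b :: "real \<Rightarrow>\<^sub>C 'a" and s
  define f where "f b t = exp (- L * t) *\<^sub>R (exp (- t) *\<^sub>R a0 + duhamel (\<lambda>s. F s (w b s)) t)" for b t
  have w: "continuous_on {0..} (w b)" for b unfolding w_def by (intro continuous_intros) auto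
  have hm: "(\<lambda>s. F s (w b s)) \<in> borel_measurable (lebesgue_on {0..})" for b by (rule meas[OF w])
  have M: "0 \<le> M" using bd[of 0] norm_ge_zero[of "F 0 0"] by (simp del: norm_ge_zero)
  have ex1: "1 \<le> exp (L * s)" if "0 \<le> s" for s using that L by simp
  have "\<exists>R. \<forall>t. norm (apply_bcontfun b t) \<le> R" for b :: "real \<Rightarrow>\<^sub>C 'a"
    using bounded_apply_bcontfun[of b] by (auto simp: bounded_iff)
  then obtain R where R: "\<And>b t. norm (apply_bcontfun b t) \<le> R (b :: real \<Rightarrow>\<^sub>C 'a)" by metis
  have hb: "norm (F s (w b s)) \<le> (M + L * R b) * exp (L * s)" if "0 \<le> s" for b s
  proof -
    have "norm (F s (w b s)) \<le> norm (F s (w b s) - F s 0) + norm (F s 0)"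
      by (metis diff_add_cancel norm_triangle_ineq)
    also have "\<dots> \<le> L * norm (w b s) + M" using lip[OF that, of "w b s" 0] bd[OF that] by simp
    also have "L * norm (w b s) \<le> L * (exp (L * s) * R b)"
      using L R by (auto simp: w_def intro!: mult_left_mono)
    also have "M \<le> M * exp (L * s)" using M ex1[OF that] by (simp add: mult_le_cancel_left1)
    finally show ?thesis by (simp add: algebra_simps)
  qed
  have hb': "\<exists>C. \<forall>s\<in>{0..S}. norm (F s (w b s)) \<le> C" for b S
  proof (intro exI ballI)
    fix s assume s: "s \<in> {0..S}"
    have "0 \<le> R b" using R[of b 0] norm_ge_zero order_trans by blast
    then have "(M + L * R b) * exp (L * s) \<le> (M + L * R b) * exp (L * S)"
      using s L M by (intro mult_left_mono) (auto intro!: mult_left_mono)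
    then show "norm (F s (w b s)) \<le> (M + L * R b) * exp (L * S)" using hb[of s b] s by simp
  qed
  have fc: "continuous_on {0..} (f b)" for b
    unfolding f_def by (intro continuous_intros duhamel_continuous hm hb')
  \<comment> \<open>The growth \<open>exp (L * s)\<close> of the weight together with the damping
    integrates to 1 / (1 + L); multiplied by the Lipschitz constant this is the contraction
    factor.\<close>
  have damp: "norm (exp (- L * t) *\<^sub>R duhamel k t) \<le> C * (1 / (1 + L)) * (1 - exp (- (1 + L) * t))"
    if "0 \<le> t" "k \<in> borel_measurable (lebesgue_on {0..})"
      and "\<And>s. 0 \<le> s \<Longrightarrow> norm (k s) \<le> C * exp (L * s)" for t k C
  proof -
    have "norm (exp (- L * t) *\<^sub>R duhamel k t)
        \<le> exp (- L * t) * (C * exp (L * t) * (1 - exp (- (1 + L) * t)) / (1 + L))"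
      using mult_left_mono[OF duhamel_bound(2)[OF that(1,2), of C L], of "exp (- L * t)"] that(3) L by simp
    also have "\<dots> = C * (1 / (1 + L)) * (1 - exp (- (1 + L) * t))" by (simp add: exp_minus)
    finally show ?thesis .
  qed
  have e01: "0 \<le> 1 - exp (- (1 + L) * t)" if "0 \<le> t" for t
  proof -
    have "0 \<le> (1 + L) * t" using L that by simp
    then have "- (1 + L) * t \<le> 0" by linarith
    then show ?thesis by (simp del: mult_minus_left)
  qed
  \<comment> \<open>Bounded continuous functions are taken on the whole line, so the path is
    continued to negative times by its value at 0.\<close>
  define \<Phi> where "\<Phi> b = Bcontfun (\<lambda>t. f b (max 0 t))" for b
  have "(\<lambda>t. f b (max 0 t)) \<in> bcontfun" for b
  proof (rule bcontfun_normI)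
    show "continuous_on UNIV (\<lambda>t. f b (max 0 t))"
      by (rule continuous_on_compose2[OF fc]) (auto intro!: continuous_intros)
    have "norm (f b t) \<le> norm a0 + (M + L * R b) * (1 / (1 + L))" if t: "0 \<le> t" for t
    proof -
      have "norm (f b t) \<le> norm (exp (- L * t) *\<^sub>R exp (- t) *\<^sub>R a0)
          + norm (exp (- L * t) *\<^sub>R duhamel (\<lambda>s. F s (w b s)) t)"
        unfolding f_def scaleR_add_right by (rule norm_triangle_ineq)
      also have "norm (exp (- L * t) *\<^sub>R exp (- t) *\<^sub>R a0) \<le> norm a0"
      proof -
        have "0 \<le> L * t" using L t by simp
        then have "- L * t + - t \<le> 0" using t by linarith
        then show ?thesis
          unfolding scaleR_scaleR mult_exp_exp norm_scaleR by (auto intro!: mult_left_le_one_le)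
      qed
      also have "norm (exp (- L * t) *\<^sub>R duhamel (\<lambda>s. F s (w b s)) t)
          \<le> (M + L * R b) * (1 / (1 + L)) * (1 - exp (- (1 + L) * t))"
        by (rule damp[OF t hm hb])
      also have "\<dots> \<le> (M + L * R b) * (1 / (1 + L))"
      proof (rule mult_right_le_one_le)
        have "0 \<le> R b" using R[of b 0] norm_ge_zero order_trans by blast
        then show "0 \<le> (M + L * R b) * (1 / (1 + L))" using M L by simp
      qed (rule e01[OF t], simp)
      finally show ?thesis by simp
    qed
    then show "norm (f b (max 0 t)) \<le> norm a0 + (M + L * R b) * (1 / (1 + L))" for t by simp
  qed
  then have \<Phi>: "apply_bcontfun (\<Phi> b) t = f b (max 0 t)" for b t
    by (simp add: \<Phi>_def Bcontfun_inverse)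
  have "dist (\<Phi> b) (\<Phi> c) \<le> L / (1 + L) * dist b c" for b c
  proof (rule dist_bound)
    fix u :: real
    define t where "t = max 0 u"
    have t: "0 \<le> t" by (simp add: t_def)
    have i: "set_integrable lebesgue {0..t} (\<lambda>s. exp (- (t - s)) *\<^sub>R F s (w b s))" for b
      using hb'[of t b] duhamel_integrable[OF t hm[of b]] by blast
    have "dist (apply_bcontfun (\<Phi> b) u) (apply_bcontfun (\<Phi> c) u)
        = norm (exp (- L * t) *\<^sub>R duhamel (\<lambda>s. F s (w b s) - F s (w c s)) t)"
      by (simp add: \<Phi> f_def dist_norm duhamel_diff[OF i i] flip: t_def scaleR_diff_right)
    also have "\<dots> \<le> (L * dist b c) * (1 / (1 + L)) * (1 - exp (- (1 + L) * t))"
    proof (rule damp[OF t])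
      show "(\<lambda>s. F s (w b s) - F s (w c s)) \<in> borel_measurable (lebesgue_on {0..})"
        by (intro borel_measurable_diff hm)
      fix s :: real assume s: "0 \<le> s"
      have "norm (w b s - w c s) = exp (L * s) * dist (apply_bcontfun b s) (apply_bcontfun c s)"
        by (simp add: w_def dist_norm flip: scaleR_diff_right)
      also have "\<dots> \<le> exp (L * s) * dist b c" by (intro mult_left_mono dist_bounded) auto
      finally have "norm (w b s - w c s) \<le> exp (L * s) * dist b c" .
      from mult_left_mono[OF this L] show "norm (F s (w b s) - F s (w c s)) \<le> L * dist b c * exp (L * s)"
        using lip[OF s, of "w b s" "w c s"] by (simp add: mult_ac)
    qed
    also have "\<dots> \<le> (L * dist b c) * (1 / (1 + L))"
      using L by (intro mult_right_le_one_le e01[OF t]) auto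
    finally show "dist (apply_bcontfun (\<Phi> b) u) (apply_bcontfun (\<Phi> c) u) \<le> L / (1 + L) * dist b c"
      by simp
  qed
  then have "\<exists>!b. \<Phi> b = b" using L by (intro banach_fix_type[of "L / (1 + L)"]) auto
  then obtain b where b: "\<Phi> b = b" by blast
  have fw: "w b t = exp (- t) *\<^sub>R a0 + duhamel (\<lambda>s. F s (w b s)) t" if "0 \<le> t" for t
  proof -
    have "w b t = exp (L * t) *\<^sub>R f b t" using \<Phi>[of b t] that by (simp add: b w_def)
    then show ?thesis by (simp add: f_def mult_exp_exp)
  qed
  then show ?thesis using w[of b] fw[of 0] by (intro exI[of _ "w b"]) (auto simp: mild_def)
qed

text \<open>The function \<open>exp t * (norm (c t))^2\<close> has derivative
  \<open>exp t * (2 * inner c h - (norm c)^2)\<close>, which the hypothesis makes nonpositive. Thus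
  half of the decay rate of the norm is sacrificed to \<open>h\<close>.\<close>

lemma energy_decay:
  fixes c h :: "real \<Rightarrow> 'a::{real_inner, banach, second_countable_topology}"
  assumes h: "continuous_on {0..} h" and eq: "\<And>t. 0 \<le> t \<Longrightarrow> c t = exp (- t) *\<^sub>R c 0 + duhamel h t"
    and bd: "\<And>s. 0 \<le> s \<Longrightarrow> inner (c s) (h s) \<le> (norm (c s))\<^sup>2 / 2" and t: "0 \<le> t"
  shows "norm (c t) \<le> exp (- t / 2) * norm (c 0)"
proof -
  \<comment> \<open>The formula for \<open>c\<close> is known only at nonnegative times;
    \<open>d\<close> is the formula itself.\<close>
  define d where "d t = exp (- t) *\<^sub>R c 0 + duhamel h t" for t
  define E where "E t = exp t * inner (d t) (d t)" for t
  have cd: "c s = d s" if "0 \<le> s" for s using eq[OF that] by (simp add: d_def)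
  have "E t \<le> E 0"
  proof (rule DERIV_nonpos_imp_decreasing_open[OF t])
    have "continuous_on {0..} (duhamel h)"
      using continuous_half_line_bounded[OF h] by (intro duhamel_continuous measurable_half_line h) auto
    then have "continuous_on {0..t} (duhamel h)" by (rule continuous_on_subset) auto
    then show "continuous_on {0..t} E" unfolding E_def d_def by (intro continuous_intros)
    fix s :: real assume s: "0 < s" "s < t"
    have "(d has_vector_derivative (- exp (- s)) *\<^sub>R c 0 + (h s - duhamel h s)) (at s)"
      unfolding d_def
      by (intro has_vector_derivative_add duhamel_has_derivative h s)
         (auto intro!: derivative_eq_intros)
    moreover have "(- exp (- s)) *\<^sub>R c 0 + (h s - duhamel h s) = h s - d s" by (simp add: d_def)
    ultimately have d': "(d has_derivative (\<lambda>x. x *\<^sub>R (h s - d s))) (at s)"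
      by (simp only: has_vector_derivative_def)
    have "((\<lambda>t. inner (d t) (d t)) has_derivative
        (\<lambda>x. inner (d s) (x *\<^sub>R (h s - d s)) + inner (x *\<^sub>R (h s - d s)) (d s))) (at s)"
      by (rule has_derivative_inner[OF d' d'])
    then have "((\<lambda>t. inner (d t) (d t)) has_field_derivative 2 * inner (d s) (h s - d s)) (at s)"
      by (auto simp: has_field_derivative_def inner_commute mult.commute elim!: back_subst[of "\<lambda>f. (_ has_derivative f) _"])
    then have "(E has_field_derivative
        exp s * inner (d s) (d s) + 2 * inner (d s) (h s - d s) * exp s) (at s)"
      unfolding E_def by (intro DERIV_mult DERIV_exp)
    moreover have "inner (d s) (h s) \<le> inner (d s) (d s) / 2"
      using bd[of s] s by (simp add: cd power2_norm_eq_inner)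
    then have "exp s * inner (d s) (d s) + 2 * inner (d s) (h s - d s) * exp s \<le> 0"
      using mult_left_mono[of "2 * inner (d s) (h s)" "inner (d s) (d s)" "exp s"]
      by (simp add: inner_diff_right right_diff_distrib left_diff_distrib mult.commute)
    ultimately show "\<exists>y. (E has_field_derivative y) (at s) \<and> y \<le> 0" by blast
  qed
  then have "exp t * (norm (c t))\<^sup>2 \<le> (norm (c 0))\<^sup>2"
    using t by (simp add: E_def cd power2_norm_eq_inner)
  then have "(norm (c t))\<^sup>2 \<le> (exp (- t / 2) * norm (c 0))\<^sup>2"
    by (simp add: power_mult_distrib exp_minus field_simps flip: exp_double)
  then show ?thesis by (rule power2_le_imp_le) simp
qed

section \<open>Quadratic equations with small forcing\<close>

definition ball_proj :: "real \<Rightarrow> 'a::real_normed_vector \<Rightarrow> 'a" where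
  "ball_proj r x = (if norm x \<le> r then x else (r / norm x) *\<^sub>R x)"

lemma ball_proj_eq [simp]: "norm x \<le> r \<Longrightarrow> ball_proj r x = x"
  by (simp add: ball_proj_def)

lemma norm_ball_proj_le: "0 \<le> r \<Longrightarrow> norm (ball_proj r x) \<le> norm x"
  by (auto simp: ball_proj_def)

lemma norm_ball_proj: "0 \<le> r \<Longrightarrow> norm (ball_proj r x) \<le> r"
  by (auto simp: ball_proj_def)

text \<open>If \<open>y\<close> lies in the ball, projecting \<open>x\<close> moves it by at most
  its distance to \<open>y\<close>. If both points are outside, the farther one is first projected
  to the sphere through the nearer one, and then both are shrunk by a common factor below 1.\<close>

lemma ball_proj_lipschitz:
  assumes r: "0 \<le> r"
  shows "norm (ball_proj r x - ball_proj r y) \<le> 2 * norm (x - y)"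
proof -
  have 1: "norm (ball_proj r x - y) \<le> 2 * norm (x - y)" if r: "0 \<le> r" and y: "norm y \<le> r" for r and x y :: 'a
  proof (cases "norm x \<le> r")
    case False
    then have "x \<noteq> 0" using r by auto
    have "norm (ball_proj r x - x) = norm ((r / norm x - 1) *\<^sub>R x)"
      using False by (simp add: ball_proj_def scaleR_diff_left)
    also have "\<dots> = norm x - r"
      unfolding norm_scaleR real_norm_def using False r \<open>x \<noteq> 0\<close> by (simp add: abs_if field_simps)
    also have "\<dots> \<le> norm (x - y)" using y norm_triangle_ineq2[of x y] by simp
    finally show ?thesis using norm_triangle_ineq[of "ball_proj r x - x" "x - y"] by simp
  qed (simp add: mult_le_cancel_right1)
  have 2: "norm (ball_proj r x - ball_proj r y) \<le> 2 * norm (x - y)"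
    if "r < norm y" "norm y \<le> norm x" for x y :: 'a
  proof -
    have y0: "0 < norm y" using r that by linarith
    have "ball_proj r x = (r / norm y) *\<^sub>R ball_proj (norm y) x" "ball_proj r y = (r / norm y) *\<^sub>R y"
      using that y0 by (auto simp: ball_proj_def)
    then have "norm (ball_proj r x - ball_proj r y) = (r / norm y) * norm (ball_proj (norm y) x - y)"
      using r by (simp flip: scaleR_diff_right)
    also have "\<dots> \<le> 1 * (2 * norm (x - y))"
      using that r y0 by (intro mult_mono 1) auto
    finally show ?thesis by simp
  qed
  show ?thesis
    using 1[OF r, of y x] 1[OF r, of x y] 2[of x y] 2[of y x]
    by (cases "norm x \<le> r"; cases "norm y \<le> r"; cases "norm x \<le> norm y")
       (auto simp: norm_minus_commute)
qed

lemma continuous_ball_proj: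
  assumes "0 \<le> r" shows "continuous_on S (ball_proj r)"
proof (rule lipschitz_on_continuous_on)
  show "2-lipschitz_on S (ball_proj r)"
    by (rule lipschitz_onI) (use ball_proj_lipschitz[OF assms] in \<open>auto simp: dist_norm\<close>)
qed

definition forced :: "(real \<Rightarrow> 'a::real_normed_vector) \<Rightarrow> real \<Rightarrow> bool" where
  "forced G m \<longleftrightarrow> G \<in> borel_measurable (lebesgue_on {0..}) \<and> (\<forall>s\<ge>0. norm (G s) \<le> m)"

lemma forced_nonneg: "forced G m \<Longrightarrow> 0 \<le> m"
  unfolding forced_def using norm_ge_zero order_trans by blast

locale quadratic =
  fixes B :: "'a \<Rightarrow> 'a \<Rightarrow> 'a::{real_inner, banach, second_countable_topology}" and K :: real
  assumes B: "bounded_bilinear B" and K: "1 \<le> K"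
    and norm_B: "\<And>a b. norm (B a b) \<le> K * norm a * norm b"
begin

interpretation B: bounded_bilinear B by (rule B)

text \<open>On the ball of radius \<open>rad\<close> the quadratic term is Lipschitz with constant \<open>1/4\<close>.\<close>

definition rad :: real where "rad = 1 / (8 * K)"

lemma rad_pos: "0 < rad" and K_rad: "K * rad = 1 / 8"
  using K by (auto simp: rad_def)

abbreviation mild_sol :: "(real \<Rightarrow> 'a) \<Rightarrow> (real \<Rightarrow> 'a) \<Rightarrow> bool" where
  "mild_sol G \<equiv> mild (\<lambda>s x. G s + B x x)"

text \<open>From the splitting of \<open>B a a - B b b\<close> into \<open>B (a - b) a\<close> and
  \<open>B b (a - b)\<close>, which does not need symmetry of \<open>B\<close>.\<close>

lemma norm_B_diff:
  assumes "norm a \<le> r" "norm b \<le> r"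
  shows "norm (B a a - B b b) \<le> 2 * K * r * norm (a - b)"
proof -
  have "B a a - B b b = B (a - b) a + B b (a - b)"
    by (simp add: B.diff_left B.diff_right)
  then have "norm (B a a - B b b) \<le> K * norm (a - b) * norm a + K * norm b * norm (a - b)"
    using norm_triangle_ineq[of "B (a - b) a" "B b (a - b)"] norm_B[of "a - b" a] norm_B[of b "a - b"] by simp
  also have "\<dots> \<le> K * norm (a - b) * r + K * r * norm (a - b)"
    using assms K by (intro add_mono mult_left_mono mult_right_mono) auto
  finally show ?thesis by (simp add: algebra_simps)
qed

lemma meas_rhs:
  assumes "forced G m" "continuous_on {0..} a"
  shows "(\<lambda>s. G s + B (a s) (a s)) \<in> borel_measurable (lebesgue_on {0..})"
  using assms(1)
  by (intro borel_measurable_add measurable_half_line[OF B.continuous_on[OF assms(2,2)]]) (simp add: forced_def)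

lemma rhs_bounded:
  assumes "forced G m" "continuous_on {0..} a"
  shows "\<exists>C. \<forall>s\<in>{0..S}. norm (G s + B (a s) (a s)) \<le> C"
proof -
  obtain C where C: "\<And>s. s \<in> {0..S} \<Longrightarrow> norm (B (a s) (a s)) \<le> C"
    using continuous_half_line_bounded[OF B.continuous_on[OF assms(2,2)]] by blast
  show ?thesis
    using assms(1) C
    by (intro exI[of _ "m + C"] ballI order_trans[OF norm_triangle_ineq] add_mono) (auto simp: forced_def)
qed

lemma rhs_integrable:
  assumes "forced G m" "continuous_on {0..} a" "0 \<le> t"
  shows "set_integrable lebesgue {0..t} (\<lambda>s. exp (- (t - s)) *\<^sub>R (G s + B (a s) (a s)))"
  using rhs_bounded[OF assms(1,2)] duhamel_integrable[OF assms(3) meas_rhs[OF assms(1,2)]] by blast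

lemma mild_sol_diff:
  assumes G: "forced G m" "mild_sol G a" and H: "forced H m'" "mild_sol H b" and t: "0 \<le> t"
  shows "a t - b t = exp (- t) *\<^sub>R (a 0 - b 0)
    + duhamel (\<lambda>s. (G s + B (a s) (a s)) - (H s + B (b s) (b s))) t"
proof -
  have "continuous_on {0..} a" "continuous_on {0..} b" using mild_continuous G(2) H(2) by blast+
  note i = rhs_integrable[OF G(1) this(1) t] rhs_integrable[OF H(1) this(2) t]
  have "a t = exp (- t) *\<^sub>R a 0 + duhamel (\<lambda>s. G s + B (a s) (a s)) t"
    "b t = exp (- t) *\<^sub>R b 0 + duhamel (\<lambda>s. H s + B (b s) (b s)) t"
    by (rule mild_eq[OF G(2) t] mild_eq[OF H(2) t])+
  then show ?thesis unfolding duhamel_diff[OF i] by (simp add: algebra_simps)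
qed

text \<open>On a ball of radius \<open>r\<close> the quadratic term is Lipschitz with constant
  \<open>2 * K * r\<close>, so \<open>duhamel_comparison\<close> applies to the difference. The
  choices of \<open>\<kappa>\<close> are \<open>2 * K * r\<close> for uniqueness, -1/2 for
  contraction and 0 for continuous dependence.\<close>

lemma mild_sol_comparison:
  assumes G: "forced G m" "mild_sol G a" and H: "forced H m'" "mild_sol H b"
    and bd: "\<And>s. s \<in> {0..S} \<Longrightarrow> norm (a s) \<le> r" "\<And>s. s \<in> {0..S} \<Longrightarrow> norm (b s) \<le> r"
    and e: "\<And>s. 0 \<le> s \<Longrightarrow> norm (G s - H s) \<le> e * exp (\<kappa> * s)"
    and r: "0 \<le> r" "2 * K * r \<le> 1 + \<kappa>" "0 < 1 + \<kappa>"
    and A: "norm (a 0 - b 0) \<le> A" "e \<le> (1 + \<kappa> - 2 * K * r) * A" and t: "t \<in> {0..S}"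
  shows "norm (a t - b t) \<le> exp (\<kappa> * t) * A"
proof (rule duhamel_comparison[where z = "\<lambda>t. a t - b t" and k = "2 * K * r" and m = e])
  let ?h = "\<lambda>s. (G s + B (a s) (a s)) - (H s + B (b s) (b s))"
  have c: "continuous_on {0..} a" "continuous_on {0..} b" using mild_continuous G(2) H(2) by blast+
  show "continuous_on {0..S} (\<lambda>t. a t - b t)"
    by (intro continuous_intros continuous_on_subset[OF c(1)] continuous_on_subset[OF c(2)]) auto
  show "?h \<in> borel_measurable (lebesgue_on {0..})"
    by (intro borel_measurable_diff meas_rhs[OF G(1) c(1)] meas_rhs[OF H(1) c(2)])
  show "a t - b t = exp (- t) *\<^sub>R (a 0 - b 0) + duhamel ?h t" if "t \<in> {0..S}" for t
    using that by (intro mild_sol_diff[OF G H]) auto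
  show "norm (?h s) \<le> 2 * K * r * norm (a s - b s) + e * exp (\<kappa> * s)" if s: "s \<in> {0..S}" for s
  proof -
    have "?h s = (B (a s) (a s) - B (b s) (b s)) + (G s - H s)" by simp
    then have "norm (?h s) \<le> norm (B (a s) (a s) - B (b s) (b s)) + norm (G s - H s)"
      by (simp only: norm_triangle_ineq)
    then show ?thesis using norm_B_diff[OF bd(1)[OF s] bd(2)[OF s]] e[of s] s by auto
  qed
  show "0 \<le> 2 * K * r" using K r by simp
qed (fact r(2) r(3) A(1) A(2) t)+

text \<open>Continuous solutions are bounded on \<open>{0..t}\<close> by some \<open>r\<close>.
  Allowing exponential growth with rate \<open>2 * K * r\<close> removes every smallness condition,
  and the level \<open>A\<close> can be taken to be 0.\<close>

lemma mild_sol_unique: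
  assumes G: "forced G m" and a: "mild_sol G a" and b: "mild_sol G b" and ab: "a 0 = b 0" and t: "0 \<le> t"
  shows "a t = b t"
proof -
  obtain R R' where R: "\<And>s. s \<in> {0..t} \<Longrightarrow> norm (a s) \<le> R" and R': "\<And>s. s \<in> {0..t} \<Longrightarrow> norm (b s) \<le> R'"
    using continuous_half_line_bounded[OF mild_continuous[OF a], of t]
      continuous_half_line_bounded[OF mild_continuous[OF b], of t] by blast
  define r where "r = max 0 (max R R')"
  have r: "0 \<le> r" "R \<le> r" "R' \<le> r" by (auto simp: r_def)
  then have Kr: "0 \<le> 2 * K * r" using K by simp
  have "norm (a t - b t) \<le> exp ((2 * K * r) * t) * 0"
  proof (rule mild_sol_comparison[OF G a G b])
    show "norm (a s) \<le> r" "norm (b s) \<le> r" if "s \<in> {0..t}" for s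
      using R[OF that] R'[OF that] r by auto
    show "norm (G s - G s) \<le> 0 * exp (2 * K * r * s)" for s by simp
  qed (use r Kr ab t in auto)
  then show ?thesis by simp
qed

text \<open>Composing \<open>B\<close> with \<open>ball_proj rad\<close> gives a globally Lipschitz
  equation with constant 1/2, namely 1/4 from \<open>B\<close> times 2 from the projection. Its
  solution never leaves the ball and hence solves the original equation.\<close>

lemma small_exists:
  assumes G: "forced G (rad / 2)" and a0: "norm a0 \<le> rad"
  shows "\<exists>a. mild_sol G a \<and> a 0 = a0 \<and> (\<forall>t\<ge>0. norm (a t) \<le> rad)"
proof -
  let ?P = "ball_proj rad"
  define F where "F s x = G s + B (?P x) (?P x)" for s x
  note P = norm_ball_proj[OF less_imp_le[OF rad_pos]]
  have "\<exists>a. mild F a \<and> a 0 = a0"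
  proof (rule mild_exists[where L = "1/2" and M = "rad / 2"])
    show "(\<lambda>s. F s (a s)) \<in> borel_measurable (lebesgue_on {0..})" if "continuous_on {0..} a" for a
      unfolding F_def using rad_pos
      by (intro meas_rhs[OF G] continuous_on_compose2[OF continuous_ball_proj[of rad UNIV] that]) auto
    show "norm (F s x - F s y) \<le> 1 / 2 * norm (x - y)" for s x y
    proof -
      have "norm (F s x - F s y) \<le> 2 * (K * rad) * norm (?P x - ?P y)"
        unfolding F_def using norm_B_diff[OF P P, of x y] by (simp add: mult.assoc)
      also have "\<dots> \<le> 1 / 4 * (2 * norm (x - y))"
        unfolding K_rad using ball_proj_lipschitz[of rad x y] rad_pos by simp
      finally show ?thesis by simp
    qed
    show "norm (F s 0) \<le> rad / 2" if "0 \<le> s" for s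
      using G that rad_pos by (simp add: F_def forced_def B.zero_left)
  qed simp
  then obtain a where a: "mild F a" "a 0 = a0" by blast
  have c: "continuous_on {0..} a" using mild_continuous a by blast
  have small: "norm (a t) \<le> rad" if t: "0 \<le> t" for t
  proof -
    have "norm (a t) \<le> exp (0 * t) * rad"
    \<comment> \<open>The value 1/8 is \<open>K * rad\<close>. The level \<open>rad\<close> is
      preserved because \<open>rad / 2 \<le> (1 - 1/8) * rad\<close>; this is where the bound
      \<open>rad / 2\<close> on the forcing comes from.\<close>
    proof (rule duhamel_comparison[where k = "1/8" and m = "rad / 2" and S = t and h = "\<lambda>s. F s (a s)"])
      show "continuous_on {0..t} a" by (rule continuous_on_subset[OF c]) auto
      show "(\<lambda>s. F s (a s)) \<in> borel_measurable (lebesgue_on {0..})"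
        unfolding F_def using rad_pos
        by (intro meas_rhs[OF G] continuous_on_compose2[OF continuous_ball_proj[of rad UNIV] c]) auto
      show "a s = exp (- s) *\<^sub>R a 0 + duhamel (\<lambda>s. F s (a s)) s" if "s \<in> {0..t}" for s
        by (rule mild_eq[OF a(1)]) (use that in simp)
      show "norm (F s (a s)) \<le> 1 / 8 * norm (a s) + rad / 2 * exp (0 * s)" if s: "s \<in> {0..t}" for s
      proof -
        have "norm (B (?P (a s)) (?P (a s))) \<le> K * norm (?P (a s)) * norm (?P (a s))" by (rule norm_B)
        also have "\<dots> \<le> K * rad * norm (a s)"
          using K rad_pos norm_ball_proj_le[of rad "a s"] by (intro mult_mono P) auto
        finally have "norm (B (?P (a s)) (?P (a s))) \<le> 1 / 8 * norm (a s)" unfolding K_rad .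
        moreover have "norm (G s) \<le> rad / 2" using G s by (auto simp: forced_def)
        ultimately show ?thesis
          using norm_triangle_ineq[of "G s" "B (?P (a s)) (?P (a s))"] by (simp add: F_def)
      qed
    qed (use a0 a t rad_pos in auto)
    then show ?thesis by simp
  qed
  have "mild_sol G a" by (rule mild_cong[OF a(1)]) (simp add: F_def small)
  then show ?thesis using a(2) small by blast
qed

lemma small_bounded:
  assumes G: "forced G (rad / 2)" and a: "mild_sol G a" "norm (a 0) \<le> rad" and t: "0 \<le> t"
  shows "norm (a t) \<le> rad"
proof -
  obtain b where "mild_sol G b" "b 0 = a 0" "\<And>t. 0 \<le> t \<Longrightarrow> norm (b t) \<le> rad"
    using small_exists[OF G a(2)] by blast
  then show ?thesis using mild_sol_unique[OF G a(1), of b t] t by simp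
qed

text \<open>Linear in the data, as the a priori estimate of well-posedness demands. The factor 2
  leaves room in \<open>m \<le> (1 - 1/8) * 2 * (norm (a 0) + m)\<close>.\<close>

lemma small_linear_bound:
  assumes G: "forced G m" and a: "mild_sol G a" and bd: "\<And>t. 0 \<le> t \<Longrightarrow> norm (a t) \<le> rad" and t: "0 \<le> t"
  shows "norm (a t) \<le> 2 * (norm (a 0) + m)"
proof -
  have c: "continuous_on {0..} a" using mild_continuous a by blast
  have m: "0 \<le> m" by (rule forced_nonneg[OF G])
  have "norm (a t) \<le> exp (0 * t) * (2 * (norm (a 0) + m))"
  proof (rule duhamel_comparison[where k = "1/8" and m = m and S = t and h = "\<lambda>s. G s + B (a s) (a s)"])
    show "continuous_on {0..t} a" by (rule continuous_on_subset[OF c]) auto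
    show "(\<lambda>s. G s + B (a s) (a s)) \<in> borel_measurable (lebesgue_on {0..})" by (rule meas_rhs[OF G c])
    show "a s = exp (- s) *\<^sub>R a 0 + duhamel (\<lambda>s. G s + B (a s) (a s)) s" if "s \<in> {0..t}" for s
      by (rule mild_eq[OF a]) (use that in simp)
    show "norm (G s + B (a s) (a s)) \<le> 1 / 8 * norm (a s) + m * exp (0 * s)" if s: "s \<in> {0..t}" for s
    proof -
      have "norm (B (a s) (a s)) \<le> K * norm (a s) * norm (a s)" by (rule norm_B)
      also have "\<dots> \<le> K * rad * norm (a s)"
        using K rad_pos bd[of s] s by (intro mult_mono) auto
      finally have "norm (B (a s) (a s)) \<le> 1 / 8 * norm (a s)" unfolding K_rad .
      moreover have "norm (G s) \<le> m" using G s by (auto simp: forced_def)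
      ultimately show ?thesis using norm_triangle_ineq[of "G s" "B (a s) (a s)"] by simp
    qed
  qed (use t m in auto)
  then show ?thesis by simp
qed

text \<open>The rate 1/2 is admissible since \<open>2 * K * rad\<close> = 1/4 is below 1 -
  1/2.\<close>

lemma small_contraction:
  assumes G: "forced G m" and a: "mild_sol G a" and b: "mild_sol G b"
    and bd: "\<And>t. 0 \<le> t \<Longrightarrow> norm (a t) \<le> rad" "\<And>t. 0 \<le> t \<Longrightarrow> norm (b t) \<le> rad" and t: "0 \<le> t"
  shows "norm (a t - b t) \<le> exp (- t / 2) * norm (a 0 - b 0)"
  using mild_sol_comparison[OF G a G b, of t rad 0 "-1/2" "norm (a 0 - b 0)" t] bd t rad_pos K_rad
  by (simp add: mult.assoc)

text \<open>Uniform in time because the exponent is 0; the factor 2 satisfies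
  \<open>e \<le> (1 - 1/4) * 2 * (norm (a 0 - b 0) + e)\<close>.\<close>

lemma small_dependence:
  assumes G: "forced G m" "mild_sol G a" and H: "forced H m'" "mild_sol H b"
    and bd: "\<And>t. 0 \<le> t \<Longrightarrow> norm (a t) \<le> rad" "\<And>t. 0 \<le> t \<Longrightarrow> norm (b t) \<le> rad"
    and e: "\<And>s. 0 \<le> s \<Longrightarrow> norm (G s - H s) \<le> e" and t: "0 \<le> t"
  shows "norm (a t - b t) \<le> 2 * (norm (a 0 - b 0) + e)"
proof -
  have "0 \<le> e" using e[of 0] norm_ge_zero order_trans by blast
  then show ?thesis
    using mild_sol_comparison[OF G H, of t rad e 0 "2 * (norm (a 0 - b 0) + e)" t] bd e t rad_pos K_rad
    by (simp add: mult.assoc)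
qed

lemma mild_sol_shift:
  assumes G: "forced G m" and a: "mild_sol G a" and \<theta>: "0 \<le> \<theta>"
  shows "mild_sol (\<lambda>s. G (s + \<theta>)) (\<lambda>s. a (s + \<theta>))"
  unfolding mild_def
proof (intro conjI allI impI)
  have c: "continuous_on {0..} a" using mild_continuous a by blast
  show "continuous_on {0..} (\<lambda>s. a (s + \<theta>))"
    using \<theta> by (intro continuous_on_compose2[OF c] continuous_intros) auto
  fix t :: real assume t: "0 \<le> t"
  let ?h = "\<lambda>s. G s + B (a s) (a s)"
  have eq: "a r = exp (- r) *\<^sub>R a 0 + duhamel ?h r" if "0 \<le> r" for r
    by (rule mild_eq[OF a that])
  obtain C where C: "\<And>s. s \<in> {0..t + \<theta>} \<Longrightarrow> norm (?h s) \<le> C" using rhs_bounded[OF G c] by blast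
  have "a (t + \<theta>) = exp (- (t + \<theta>)) *\<^sub>R a 0 + (exp (- t) *\<^sub>R duhamel ?h \<theta> + duhamel (\<lambda>s. ?h (s + \<theta>)) t)"
    using eq[of "t + \<theta>"] duhamel_shift[OF t \<theta> meas_rhs[OF G c] C] t \<theta> by simp
  also have "\<dots> = exp (- t) *\<^sub>R a \<theta> + duhamel (\<lambda>s. ?h (s + \<theta>)) t"
    unfolding eq[OF \<theta>] scaleR_add_right scaleR_scaleR mult_exp_exp by (simp add: add.assoc)
  finally show "a (t + \<theta>) = exp (- t) *\<^sub>R a (0 + \<theta>) + duhamel (\<lambda>s. ?h (s + \<theta>)) t" by simp
qed

lemma small_periodic:
  assumes G: "forced G (rad / 2)" and \<theta>: "0 < \<theta>" and per: "\<And>t. 0 \<le> t \<Longrightarrow> G (t + \<theta>) = G t"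
  shows "\<exists>a. mild_sol G a \<and> (\<forall>t\<ge>0. norm (a t) \<le> rad) \<and> (\<forall>t\<ge>0. a (t + \<theta>) = a t)"
proof -
  have "\<exists>S. \<forall>a0\<in>cball 0 rad. mild_sol G (S a0) \<and> S a0 0 = a0 \<and> (\<forall>t\<ge>0. norm (S a0 t) \<le> rad)"
    using small_exists[OF G] by (intro bchoice) simp
  then obtain S where S: "\<And>a0. a0 \<in> cball 0 rad \<Longrightarrow> mild_sol G (S a0)" "\<And>a0. a0 \<in> cball 0 rad \<Longrightarrow> S a0 0 = a0"
    "\<And>a0 t. a0 \<in> cball 0 rad \<Longrightarrow> 0 \<le> t \<Longrightarrow> norm (S a0 t) \<le> rad" by blast
  have "\<exists>!x. x \<in> cball 0 rad \<and> S x \<theta> = x"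
  proof (rule Banach_fix[where c = "exp (- \<theta> / 2)"])
    show "complete (cball (0::'a) rad)" by (simp add: complete_eq_closed)
    show "cball (0::'a) rad \<noteq> {}" using rad_pos by simp
    show "(\<lambda>x. S x \<theta>) ` cball 0 rad \<subseteq> cball 0 rad" using S(3) \<theta> by auto
    show "dist (S x \<theta>) (S y \<theta>) \<le> exp (- \<theta> / 2) * dist x y" if "x \<in> cball 0 rad" "y \<in> cball 0 rad" for x y
      using small_contraction[OF G S(1)[OF that(1)] S(1)[OF that(2)] S(3)[OF that(1)] S(3)[OF that(2)], of \<theta>]
        S(2)[OF that(1)] S(2)[OF that(2)] \<theta> by (simp add: dist_norm)
  qed (use \<theta> in auto)
  then obtain x where x: "x \<in> cball 0 rad" "S x \<theta> = x" by blast
  \<comment> \<open>Periodicity of \<open>G\<close> makes the shifted path a solution of the same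
    equation. It starts at \<open>S x \<theta>\<close> = \<open>x\<close>, so uniqueness identifies
    it with the unshifted one.\<close>
  have "mild_sol G (\<lambda>s. S x (s + \<theta>))"
    by (rule mild_cong[OF mild_sol_shift[OF G S(1)[OF x(1)]]]) (use \<theta> per in auto)
  then have "S x (t + \<theta>) = S x t" if "0 \<le> t" for t
    using mild_sol_unique[OF G _ S(1)[OF x(1)], of "\<lambda>s. S x (s + \<theta>)" t] x S(2)[OF x(1)] that by simp
  then show ?thesis using S[of x] x by blast
qed

end

text \<open>
  Rough data split into a small rough part and a large part in the range of the smoothing operator
  \<open>I\<close>, on which the nonlinearity is skew: the large part then obeys an energy inequality.
\<close>

locale smoothing_quadratic = quadratic +
  fixes D :: "'a \<Rightarrow> 'a \<Rightarrow> 'a" and J I :: "'a \<Rightarrow> 'a"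
  assumes D: "bounded_bilinear D" and norm_D: "\<And>a b. norm (D a b) \<le> K * norm a * norm b"
    and J: "bounded_linear J" and norm_J: "\<And>a. norm (J a) \<le> norm a"
    and I: "bounded_linear I" and norm_I: "\<And>a. norm (I a) \<le> norm a"
    and B_sym: "\<And>a b. B a b = B b a" and B_I: "\<And>a c. B a (I c) = I (D (J a) c)"
    and skew: "\<And>c. inner c (D (J (I c)) c) = 0"
    and dense: "\<And>a e. 0 < e \<Longrightarrow> \<exists>c. norm (a - I c) \<le> e"
begin

interpretation B: bounded_bilinear B by (rule B)
interpretation D: bounded_bilinear D by (rule D)
interpretation J: bounded_linear J by (rule J)
interpretation I: bounded_linear I by (rule I)

text \<open>The ansatz is \<open>a = v + I c\<close>. Expanding \<open>B a a\<close> and moving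
  \<open>I\<close> outside by \<open>B_I\<close> leaves for \<open>c\<close> the unforced equation
  with right-hand side \<open>D (J (I c)) c + 2 *\<^sub>R D (J v) c\<close>. Its first term is skew,
  its second is small because \<open>v\<close> is.\<close>

lemma near_small_exists:
  assumes G: "forced G (rad / 2)"
  shows "\<exists>a v C. mild_sol G a \<and> a 0 = a0 \<and> mild_sol G v \<and> (\<forall>t\<ge>0. norm (v t) \<le> rad) \<and>
    (\<forall>t\<ge>0. norm (a t - v t) \<le> C * exp (- t / 2))"
proof -
  \<comment> \<open>Density of the range of \<open>I\<close> makes the rough remainder of the
    initial value as small as \<open>small_exists\<close> requires; \<open>c0\<close> itself may be
    large.\<close>
  obtain c0 where c0: "norm (a0 - I c0) \<le> rad" using dense[OF rad_pos] by blast
  obtain v where v: "mild_sol G v" "v 0 = a0 - I c0" "\<And>t. 0 \<le> t \<Longrightarrow> norm (v t) \<le> rad"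
    using small_exists[OF G c0] by blast
  have vc: "continuous_on {0..} v" using mild_continuous v(1) by blast
  define R where "R = norm c0"
  let ?P = "ball_proj R"
  \<comment> \<open>Only the quadratic part has to be cut off, and at the radius of the initial
    value, which the norm of \<open>c\<close> will turn out never to exceed.\<close>
  define F where "F s x = D (J (I (?P x))) (?P x) + 2 *\<^sub>R D (J (v s)) x" for s x
  have R: "0 \<le> R" by (simp add: R_def)
  note P = norm_ball_proj[OF R]
  have JI: "norm (J (I x)) \<le> norm x" for x using norm_J[of "I x"] norm_I[of x] by simp
  have Dv: "norm (D (J (v s)) x) \<le> norm x / 8" if "0 \<le> s" for s x
  proof -
    have "norm (D (J (v s)) x) \<le> K * norm (J (v s)) * norm x" by (rule norm_D)
    also have "\<dots> \<le> K * rad * norm x"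
      using K v(3)[OF that] norm_J[of "v s"] by (intro mult_right_mono mult_left_mono) auto
    finally show ?thesis by (simp add: K_rad)
  qed
  have Fc: "continuous_on {0..} (\<lambda>s. F s (c s))" if "continuous_on {0..} c" for c
  proof -
    have "continuous_on {0..} (\<lambda>s. ?P (c s))"
      by (rule continuous_on_compose2[OF continuous_ball_proj[OF R, of UNIV] that]) auto
    then show ?thesis
      unfolding F_def by (intro continuous_intros D.continuous_on J.continuous_on I.continuous_on vc that)
  qed
  \<comment> \<open>The Lipschitz constant collects \<open>2 * K * R\<close> from each of the two
    slots of \<open>D\<close>, the 2 being that of the projection, and at most 1 from the linear
    term.\<close>
  have "\<exists>c. mild F c \<and> c 0 = c0"
  proof (rule mild_exists[where L = "4 * K * R + 1" and M = 0])
    show "0 \<le> 4 * K * R + 1" using K R by simp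
    show "(\<lambda>s. F s (c s)) \<in> borel_measurable (lebesgue_on {0..})" if "continuous_on {0..} c" for c
      by (rule measurable_half_line[OF Fc[OF that]])
    show "norm (F s 0) \<le> 0" for s using R by (simp add: F_def D.zero_right)
    fix s :: real and x y :: 'a assume s: "0 \<le> s"
    let ?d = "?P x - ?P y"
    have "F s x - F s y = (D (J (I ?d)) (?P x) + D (J (I (?P y))) ?d) + 2 *\<^sub>R D (J (v s)) (x - y)"
      by (simp add: F_def D.diff_left D.diff_right J.diff I.diff scaleR_diff_right)
    then have "norm (F s x - F s y)
        \<le> (norm (D (J (I ?d)) (?P x)) + norm (D (J (I (?P y))) ?d)) + norm (2 *\<^sub>R D (J (v s)) (x - y))"
      by (simp only:) (intro order_trans[OF norm_triangle_ineq] add_mono norm_triangle_ineq order_refl)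
    also have "norm (D (J (I ?d)) (?P x)) \<le> K * norm (J (I ?d)) * norm (?P x)" by (rule norm_D)
    also have "\<dots> \<le> K * (2 * norm (x - y)) * R"
      using K P R order_trans[OF JI ball_proj_lipschitz[OF R]] by (intro mult_mono) auto
    also have "norm (D (J (I (?P y))) ?d) \<le> K * norm (J (I (?P y))) * norm ?d" by (rule norm_D)
    also have "\<dots> \<le> K * R * (2 * norm (x - y))"
      using K P R order_trans[OF JI P] ball_proj_lipschitz[OF R] by (intro mult_mono) auto
    also have "norm (2 *\<^sub>R D (J (v s)) (x - y)) \<le> norm (x - y)"
      using Dv[OF s, of "x - y"] norm_ge_zero[of "D (J (v s)) (x - y)"] by (simp del: norm_ge_zero)
    finally show "norm (F s x - F s y) \<le> (4 * K * R + 1) * norm (x - y)" by (simp add: algebra_simps)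
  qed
  then obtain c where c: "mild F c" "c 0 = c0" by blast
  have cc: "continuous_on {0..} c" using mild_continuous c(1) by blast
  have ceq: "c t = exp (- t) *\<^sub>R c 0 + duhamel (\<lambda>s. F s (c s)) t" if "0 \<le> t" for t
    by (rule mild_eq[OF c(1) that])
  have decay: "norm (c t) \<le> exp (- t / 2) * R" if t: "0 \<le> t" for t
    unfolding R_def c(2)[symmetric]
  proof (rule energy_decay[OF Fc[OF cc] ceq _ t])
    fix s :: real assume s: "0 \<le> s"
    \<comment> \<open>With the projection written as multiplication by \<open>\<alpha>\<close>, the
      cut-off quadratic term is \<open>\<alpha>\<close> squared times the original one and is still
      orthogonal to \<open>c\<close>.\<close>
    obtain \<alpha> where \<alpha>: "?P (c s) = \<alpha> *\<^sub>R c s"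
      by (cases "norm (c s) \<le> R") (auto simp: ball_proj_def intro: that[of 1])
    have "inner (c s) (F s (c s)) = 2 * inner (c s) (D (J (v s)) (c s))"
      by (simp add: F_def \<alpha> inner_add_right D.scaleR_left D.scaleR_right J.scaleR I.scaleR skew)
    also have "inner (c s) (D (J (v s)) (c s)) \<le> norm (c s) * norm (D (J (v s)) (c s))"
      by (rule norm_cauchy_schwarz)
    also have "\<dots> \<le> norm (c s) * (norm (c s) / 8)" by (intro mult_left_mono Dv[OF s]) auto
    finally have "inner (c s) (F s (c s)) \<le> norm (c s) * norm (c s) / 4" by simp
    moreover have "0 \<le> norm (c s) * norm (c s)" by simp
    ultimately show "inner (c s) (F s (c s)) \<le> (norm (c s))\<^sup>2 / 2"
      unfolding power2_eq_square by linarith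
  qed
  have cR: "norm (c t) \<le> R" if "0 \<le> t" for t
    using decay[OF that] mult_left_le_one_le[of R "exp (- t / 2)"] R that by simp
  define a where "a t = v t + I (c t)" for t
  have ac: "continuous_on {0..} a" unfolding a_def by (intro continuous_intros vc cc I.continuous_on)
  \<comment> \<open>By \<open>cR\<close> the projection acts as the identity along \<open>c\<close>,
    so \<open>F\<close> is the true right-hand side.\<close>
  have rhs: "G s + B (a s) (a s) = (G s + B (v s) (v s)) + I (F s (c s))" if "0 \<le> s" for s
  proof -
    have "B (a s) (a s) = B (v s) (v s) + 2 *\<^sub>R B (v s) (I (c s)) + B (I (c s)) (I (c s))"
      by (simp add: a_def B.add_left B.add_right B_sym[of "I (c s)" "v s"] scaleR_2)
    also have "\<dots> = B (v s) (v s) + I (F s (c s))"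
      using cR[OF that] by (simp add: B_I F_def I.add I.scaleR)
    finally show ?thesis by simp
  qed
  have "mild_sol G a"
    unfolding mild_def
  proof (intro conjI allI impI ac)
    fix t :: real assume t: "0 \<le> t"
    obtain C where C: "\<And>s. s \<in> {0..t} \<Longrightarrow> norm (F s (c s)) \<le> C"
      using continuous_half_line_bounded[OF Fc[OF cc]] by blast
    have i: "set_integrable lebesgue {0..t} (\<lambda>s. exp (- (t - s)) *\<^sub>R F s (c s))"
      by (rule duhamel_integrable[OF t measurable_half_line[OF Fc[OF cc]] C])
    have "duhamel (\<lambda>s. G s + B (a s) (a s)) t = duhamel (\<lambda>s. (G s + B (v s) (v s)) + I (F s (c s))) t"
      using rhs by (intro duhamel_cong) simp
    also have "\<dots> = duhamel (\<lambda>s. G s + B (v s) (v s)) t + I (duhamel (\<lambda>s. F s (c s)) t)"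
      using rhs_integrable[OF G vc t] duhamel_bounded_linear[OF I i] by (simp add: duhamel_add)
    moreover have "v t = exp (- t) *\<^sub>R v 0 + duhamel (\<lambda>s. G s + B (v s) (v s)) t"
      by (rule mild_eq[OF v(1) t])
    moreover have "I (c t) = exp (- t) *\<^sub>R I (c 0) + I (duhamel (\<lambda>s. F s (c s)) t)"
      by (subst ceq[OF t]) (simp add: I.add I.scaleR)
    ultimately show "a t = exp (- t) *\<^sub>R a 0 + duhamel (\<lambda>s. G s + B (a s) (a s)) t"
      by (simp add: a_def scaleR_add_right)
  qed
  moreover have "a 0 = a0" by (simp add: a_def v(2) c(2))
  moreover have "norm (a t - v t) \<le> R * exp (- t / 2)" if "0 \<le> t" for t
    using decay[OF that] norm_I[of "c t"] by (simp add: a_def mult.commute)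
  ultimately show ?thesis using v by blast
qed

lemma mild_sol_exists:
  assumes "forced G (rad / 2)" shows "\<exists>a. mild_sol G a \<and> a 0 = a0"
  using near_small_exists[OF assms] by blast

text \<open>By uniqueness every solution is one of those built in \<open>near_small_exists\<close>,
  hence approaches some small solution; two small solutions approach each other by
  \<open>small_contraction\<close>. All three distances decay with rate 1/2.\<close>

lemma mild_sol_attraction:
  assumes G: "forced G (rad / 2)" and a: "mild_sol G a" and b: "mild_sol G b"
  shows "\<exists>C. \<forall>t\<ge>0. norm (a t - b t) \<le> C * exp (- t / 2)"
proof -
  have "\<exists>v C. mild_sol G v \<and> (\<forall>t\<ge>0. norm (v t) \<le> rad) \<and> (\<forall>t\<ge>0. norm (a t - v t) \<le> C * exp (- t / 2))"
    if a: "mild_sol G a" for a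
  proof -
    obtain a' v C where "mild_sol G a'" "a' 0 = a 0" "mild_sol G v" "\<forall>t\<ge>0. norm (v t) \<le> rad"
      "\<forall>t\<ge>0. norm (a' t - v t) \<le> C * exp (- t / 2)"
      using near_small_exists[OF G, of "a 0"] by blast
    then show ?thesis using mild_sol_unique[OF G a, of a'] by (intro exI[of _ v] exI[of _ C]) auto
  qed
  from this[OF a] this[OF b] obtain v C w C' where
    v: "mild_sol G v" "\<And>t. 0 \<le> t \<Longrightarrow> norm (v t) \<le> rad" "\<And>t. 0 \<le> t \<Longrightarrow> norm (a t - v t) \<le> C * exp (- t / 2)" and
    w: "mild_sol G w" "\<And>t. 0 \<le> t \<Longrightarrow> norm (w t) \<le> rad" "\<And>t. 0 \<le> t \<Longrightarrow> norm (b t - w t) \<le> C' * exp (- t / 2)"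
    by blast
  have "norm (a t - b t) \<le> (C + norm (v 0 - w 0) + C') * exp (- t / 2)" if t: "0 \<le> t" for t
  proof -
    have "norm (a t - b t) \<le> norm (a t - v t) + norm (v t - w t) + norm (b t - w t)"
      using norm_triangle_ineq[of "a t - v t" "v t - b t"] norm_triangle_ineq4[of "v t - w t" "b t - w t"] by simp
    also have "\<dots> \<le> C * exp (- t / 2) + exp (- t / 2) * norm (v 0 - w 0) + C' * exp (- t / 2)"
      by (intro add_mono v(3)[OF t] w(3)[OF t] small_contraction[OF G v(1) w(1) v(2) w(2) t])
    finally show ?thesis by (simp add: algebra_simps)
  qed
  then show ?thesis by blast
qed

end

section \<open>Plancherel's theorem\<close>

definition lift_l2 :: "((real \<Rightarrow> 'a::euclidean_space) \<Rightarrow> real \<Rightarrow> 'b::euclidean_space) \<Rightarrow> 'a l2 \<Rightarrow> 'b l2" where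
  "lift_l2 P u = abs_l2 (P (rep_l2 u))"

text \<open>Linearity is required pointwise and for all functions, which lets representatives be
  manipulated before passing to classes.\<close>

definition l2_isometry :: "((real \<Rightarrow> 'a::euclidean_space) \<Rightarrow> real \<Rightarrow> 'b::euclidean_space) \<Rightarrow> bool" where
  "l2_isometry P \<longleftrightarrow> (\<forall>f. sq_integrable f \<longrightarrow> sq_integrable (P f) \<and>
      (\<integral>x. (norm (P f x))\<^sup>2 \<partial>lborel) = (\<integral>x. (norm (f x))\<^sup>2 \<partial>lborel)) \<and>
    (\<forall>f g. P (\<lambda>x. f x + g x) = (\<lambda>x. P f x + P g x)) \<and> (\<forall>c f. P (\<lambda>x. c *\<^sub>R f x) = (\<lambda>x. c *\<^sub>R P f x))"

lemma abs_l2_cong: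
  assumes "sq_integrable f" "g \<in> borel_measurable lborel" "AE x in lborel. f x = g x"
  shows "sq_integrable g" "abs_l2 f = abs_l2 g"
proof -
  have "integrable lborel (\<lambda>x. (norm (f x))\<^sup>2)" "f \<in> borel_measurable lborel"
    using assms by (auto simp: sq_integrable_def)
  from this(1) show g: "sq_integrable g"
    by (rule sq_integrable_bound[OF _ assms(2)]) (use assms(3) in \<open>auto elim: eventually_mono\<close>)
  show "abs_l2 f = abs_l2 g"
    using assms g by (intro Quotient_rel_abs[OF Quotient_l2]) (auto simp: l2_rel_def)
qed

lemma abs_l2_eq_iff:
  assumes "sq_integrable f" "sq_integrable g"
  shows "abs_l2 f = abs_l2 g \<longleftrightarrow> (AE x in lborel. f x = g x)"
  using Quotient_rel[OF Quotient_l2, of f g] assms by (auto simp: l2_rel_def)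

text \<open>Two representatives of a class differ by a function of norm zero; by linearity and
  isometry their images do too. Hence \<open>P\<close> may be applied to any representative.\<close>

lemma lift_l2:
  assumes P: "l2_isometry P"
  shows "norm (lift_l2 P u) = norm u" "bounded_linear (lift_l2 P)"
    "sq_integrable f \<Longrightarrow> lift_l2 P (abs_l2 f) = abs_l2 (P f)"
proof -
  have sq: "sq_integrable (P f)" and nrm: "norm (abs_l2 (P f)) = norm (abs_l2 f)"
    if "sq_integrable f" for f
  proof -
    show s: "sq_integrable (P f)" using P that by (auto simp: l2_isometry_def)
    have "(norm (abs_l2 (P f)))\<^sup>2 = (norm (abs_l2 f))\<^sup>2"
      using P that by (simp add: norm_abs_l2 s l2_isometry_def)
    then show "norm (abs_l2 (P f)) = norm (abs_l2 f)" by (simp add: power2_eq_iff_nonneg)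
  qed
  have add: "P (\<lambda>x. f x + g x) = (\<lambda>x. P f x + P g x)" and scale: "P (\<lambda>x. c *\<^sub>R f x) = (\<lambda>x. c *\<^sub>R P f x)" for c f g
    using P by (auto simp: l2_isometry_def)
  have diff: "P (\<lambda>x. f x - g x) = (\<lambda>x. P f x - P g x)" for f g
    using add[of f "\<lambda>x. (-1) *\<^sub>R g x"] scale[of "-1" g] by simp
  show "norm (lift_l2 P u) = norm u" for u by (simp add: lift_l2_def nrm)
  show abs: "lift_l2 P (abs_l2 f) = abs_l2 (P f)" if f: "sq_integrable f" for f
  proof -
    have "norm (abs_l2 (P (rep_l2 (abs_l2 f))) - abs_l2 (P f)) = norm (abs_l2 (P (\<lambda>x. rep_l2 (abs_l2 f) x - f x)))"
      by (simp add: diff abs_l2_diff sq f)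
    also have "\<dots> = norm (abs_l2 (\<lambda>x. rep_l2 (abs_l2 f) x - f x))"
      by (rule nrm) (simp add: sq_integrable_diff f)
    also have "\<dots> = 0" by (simp add: abs_l2_diff f)
    finally show ?thesis by (simp add: lift_l2_def)
  qed
  show "bounded_linear (lift_l2 P)"
  proof (rule bounded_linear_intro)
    show "lift_l2 P (u + v) = lift_l2 P u + lift_l2 P v" for u v
      using abs[OF sq_integrable_add[OF sq_integrable_rep[of u] sq_integrable_rep[of v]]]
      by (simp add: abs_l2_add add sq) (simp add: lift_l2_def)
    show "lift_l2 P (c *\<^sub>R u) = c *\<^sub>R lift_l2 P u" for c u
      using abs[OF sq_integrable_scaleR[OF sq_integrable_rep[of u], of c]]
      by (simp add: abs_l2_scaleR scale sq) (simp add: lift_l2_def)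
    show "norm (lift_l2 P u) \<le> norm u * 1" for u by (simp add: lift_l2_def nrm)
  qed
qed

section \<open>Translation, modulation, conjugation and reflection as isometries of L2\<close>

lemma integral_shift:
  fixes f :: "real \<Rightarrow> 'a::{banach, second_countable_topology}"
  shows "(\<integral>x. f (x - a) \<partial>lborel) = (\<integral>x. f x \<partial>lborel)"
  using lborel_integral_real_affine[of 1 f "-a"] by (simp add: add.commute)

lemma integrable_shift:
  fixes f :: "real \<Rightarrow> 'a::{banach, second_countable_topology}"
  assumes "integrable lborel f" shows "integrable lborel (\<lambda>x. f (x - a))"
  using lborel_integrable_real_affine[OF assms, of 1 "-a"] by (simp add: add.commute)

lemma integral_reflect:
  fixes f :: "real \<Rightarrow> 'a::{banach, second_countable_topology}"
  shows "(\<integral>x. f (- x) \<partial>lborel) = (\<integral>x. f x \<partial>lborel)"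
  using lborel_integral_real_affine[of "-1" f 0] by simp

lemma integrable_reflect:
  fixes f :: "real \<Rightarrow> 'a::{banach, second_countable_topology}"
  assumes "integrable lborel f" shows "integrable lborel (\<lambda>x. f (- x))"
  using lborel_integrable_real_affine[OF assms, of "-1" 0] by simp

text \<open>The inner product of \<open>complex l2\<close> is only the real part of the Hermitian
  one. The additional phase \<open>c\<close>, here and in \<open>modulate\<close>, allows imaginary
  parts to be recovered by rotating one factor.\<close>

definition translate :: "real \<Rightarrow> real \<Rightarrow> (real \<Rightarrow> complex) \<Rightarrow> real \<Rightarrow> complex" where
  "translate a c f x = cis c * f (x - a)"

definition modulate :: "real \<Rightarrow> real \<Rightarrow> (real \<Rightarrow> complex) \<Rightarrow> real \<Rightarrow> complex" where
  "modulate a c f x = cis (a * x + c) * f x"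

lemma measurable_cis [measurable]: "cis \<in> borel_measurable borel"
  by (intro borel_measurable_continuous_onI continuous_intros)

lemma measurable_cnj [measurable]: "cnj \<in> borel_measurable borel"
  by (intro borel_measurable_continuous_onI continuous_intros)

lemma isometry_translate: "l2_isometry (translate a c)"
  unfolding l2_isometry_def translate_def[abs_def]
proof (intro conjI allI impI)
  fix f :: "real \<Rightarrow> complex" assume f: "sq_integrable f"
  then have [measurable]: "f \<in> borel_measurable borel" by (simp add: sq_integrable_def)
  show "sq_integrable (\<lambda>x. cis c * f (x - a))"
    using f integrable_shift[of "\<lambda>x. (norm (f x))\<^sup>2" a] by (auto simp: sq_integrable_def norm_mult)
  show "(\<integral>x. (norm (cis c * f (x - a)))\<^sup>2 \<partial>lborel) = (\<integral>x. (norm (f x))\<^sup>2 \<partial>lborel)"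
    using integral_shift[of "\<lambda>x. (norm (f x))\<^sup>2" a] by (simp add: norm_mult)
qed (auto simp: algebra_simps)

lemma isometry_modulate: "l2_isometry (modulate a c)"
  unfolding l2_isometry_def modulate_def[abs_def]
proof (intro conjI allI impI)
  fix f :: "real \<Rightarrow> complex" assume f: "sq_integrable f"
  then have [measurable]: "f \<in> borel_measurable borel" by (simp add: sq_integrable_def)
  show "sq_integrable (\<lambda>x. cis (a * x + c) * f x)"
    using f by (auto simp: sq_integrable_def norm_mult)
qed (auto simp: algebra_simps norm_mult)

lemma isometry_cnj: "l2_isometry (\<lambda>f x. cnj (f x))"
  unfolding l2_isometry_def
proof (intro conjI allI impI)
  fix f :: "real \<Rightarrow> complex" assume f: "sq_integrable f"
  then have [measurable]: "f \<in> borel_measurable borel" by (simp add: sq_integrable_def)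
  show "sq_integrable (\<lambda>x. cnj (f x))" using f by (auto simp: sq_integrable_def)
qed auto

lemma isometry_cnj_reflect: "l2_isometry (\<lambda>f x. cnj (f (- x)))"
  unfolding l2_isometry_def
proof (intro conjI allI impI)
  fix f :: "real \<Rightarrow> complex" assume f: "sq_integrable f"
  then have [measurable]: "f \<in> borel_measurable borel" by (simp add: sq_integrable_def)
  show "sq_integrable (\<lambda>x. cnj (f (- x)))"
    using f integrable_reflect[of "\<lambda>x. (norm (f x))\<^sup>2"] by (auto simp: sq_integrable_def)
  show "(\<integral>x. (norm (cnj (f (- x))))\<^sup>2 \<partial>lborel) = (\<integral>x. (norm (f x))\<^sup>2 \<partial>lborel)"
    using integral_reflect[of "\<lambda>x. (norm (f x))\<^sup>2"] by simp
qed (auto simp: algebra_simps)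

lemma isometry_of_real: "l2_isometry (\<lambda>f x. complex_of_real (f x))"
  unfolding l2_isometry_def
proof (intro conjI allI impI)
  fix f :: "real \<Rightarrow> real" assume f: "sq_integrable f"
  then have [measurable]: "f \<in> borel_measurable borel" by (simp add: sq_integrable_def)
  show "sq_integrable (\<lambda>x. complex_of_real (f x))" using f by (auto simp: sq_integrable_def)
qed (auto simp: scaleR_conv_of_real)

text \<open>For indicators of intervals this is dominated convergence. Linear combinations inherit
  it, and as translations are isometries it passes to the closure, which is everything.\<close>

lemma translate_continuous:
  fixes u :: "complex l2"
  assumes a: "a \<longlonglongrightarrow> 0"
  shows "(\<lambda>n. lift_l2 (translate (a n) 0) u) \<longlonglongrightarrow> u"
proof -
  define V where "V = {u :: complex l2. (\<lambda>n. lift_l2 (translate (a n) 0) u) \<longlonglongrightarrow> u}"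
  note tr = lift_l2[OF isometry_translate]
  have 0: "0 \<in> V" using linear_0[OF bounded_linear.linear[OF tr(2)]] by (simp add: V_def)
  have add: "u + v \<in> V" if "u \<in> V" "v \<in> V" for u v
    using that by (auto simp: V_def linear_add[OF bounded_linear.linear[OF tr(2)]] intro: tendsto_add)
  have scale: "c *\<^sub>R u \<in> V" if "u \<in> V" for c u
    using that by (auto simp: V_def linear_scale[OF bounded_linear.linear[OF tr(2)]] intro: tendsto_scaleR)
  have gen: "g \<in> V" if "g \<in> l2_generators" for g
  proof -
    obtain p q e where g: "g = abs_l2 (\<lambda>x. indicator {p..q} x *\<^sub>R (e::complex))"
      using \<open>g \<in> l2_generators\<close> by (auto simp: l2_generators_def)
    obtain M where M: "\<And>n. \<bar>a n\<bar> \<le> M"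
      using convergent_imp_Bseq[OF convergentI[OF a]] by (auto simp: Bseq_def)
    have sq: "sq_integrable (\<lambda>x. indicator {p..q} x *\<^sub>R e)" for p q
      by (rule sq_integrable_indicator) (auto simp: emeasure_lborel_Icc_eq)
    have eq: "lift_l2 (translate (a n) 0) g = abs_l2 (\<lambda>x. indicator {p + a n..q + a n} x *\<^sub>R e)" for n
      unfolding g tr(3)[OF sq] by (rule arg_cong[of _ _ abs_l2]) (auto simp: translate_def indicator_def fun_eq_iff)
    have "(\<lambda>n. abs_l2 (\<lambda>x. indicator {p + a n..q + a n} x *\<^sub>R e)) \<longlonglongrightarrow> abs_l2 (\<lambda>x. indicator {p..q} x *\<^sub>R e)"
    proof (rule tendsto_abs_l2_dominated)
      show "integrable lborel (\<lambda>x. indicator {p - M..q + M} x * (norm e)\<^sup>2)"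
        by (intro integrable_mult_left integrable_real_indicator) (auto simp: emeasure_lborel_Icc_eq)
      show "AE x in lborel. (norm (indicator {p + a n..q + a n} x *\<^sub>R e))\<^sup>2 \<le> indicator {p - M..q + M} x * (norm e)\<^sup>2" for n
        using M[of n] by (intro AE_I2) (auto simp: indicator_def abs_le_iff)
      \<comment> \<open>At the endpoints the translated indicators need not converge; away from them
        they are eventually constant.\<close>
      have "AE x in lborel. x \<noteq> p" "AE x in lborel. x \<noteq> q" by (rule AE_lborel_singleton)+
      then show "AE x in lborel. (\<lambda>n. indicator {p + a n..q + a n} x *\<^sub>R e) \<longlonglongrightarrow> indicator {p..q} x *\<^sub>R e"
      proof eventually_elim
        case (elim x)
        have 1: "(\<lambda>n. x - a n) \<longlonglongrightarrow> x" using tendsto_diff[OF tendsto_const a, of x] by simp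
        have "\<forall>\<^sub>F n in sequentially. (p + a n \<le> x \<and> x \<le> q + a n) = (p \<le> x \<and> x \<le> q)"
        proof -
          have "\<forall>\<^sub>F n in sequentially. (p \<le> x - a n) = (p \<le> x)"
          proof (cases "p < x")
            case True
            with order_tendstoD(1)[OF 1 True] show ?thesis by (auto elim: eventually_mono)
          next
            case False
            with elim have "x < p" by simp
            with order_tendstoD(2)[OF 1 this] show ?thesis by (auto elim!: eventually_mono)
          qed
          moreover have "\<forall>\<^sub>F n in sequentially. (x - a n \<le> q) = (x \<le> q)"
          proof (cases "q < x")
            case True
            with order_tendstoD(1)[OF 1 True] show ?thesis by (auto elim!: eventually_mono)
          next
            case False
            with elim have "x < q" by simp
            with order_tendstoD(2)[OF 1 this] show ?thesis by (auto elim!: eventually_mono)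
          qed
          ultimately show ?thesis by eventually_elim auto
        qed
        then have "\<forall>\<^sub>F n in sequentially. indicator {p + a n..q + a n} x *\<^sub>R e = indicator {p..q} x *\<^sub>R e"
          by eventually_elim (auto simp: indicator_def)
        then show ?case by (rule tendsto_eventually)
      qed
    qed auto
    then show ?thesis by (simp add: V_def eq) (simp add: g)
  qed
  have "l2_dense \<subseteq> V"
  proof
    fix v :: "complex l2" assume "v \<in> l2_dense"
    then obtain xs where xs: "xs \<in> lists (\<rat> \<times> l2_generators)" "v = (\<Sum>(q, g)\<leftarrow>xs. q *\<^sub>R g)"
      by (auto simp: l2_dense_def)
    from xs(1) show "v \<in> V" unfolding xs(2)
      by (induction xs) (auto intro: 0 add scale gen)
  qed
  have "u \<in> closure l2_dense" by (simp add: closure_l2_dense)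
  have "(\<lambda>n. norm (lift_l2 (translate (a n) 0) u - u)) \<longlonglongrightarrow> 0"
  proof (rule LIMSEQ_I)
    fix r :: real assume r: "0 < r"
    obtain v where v: "v \<in> l2_dense" "norm (v - u) < r / 3"
      using \<open>u \<in> closure l2_dense\<close> r by (auto simp: closure_approachable dist_norm dest: spec[of _ "r / 3"])
    then have "(\<lambda>n. lift_l2 (translate (a n) 0) v) \<longlonglongrightarrow> v" using \<open>l2_dense \<subseteq> V\<close> by (auto simp: V_def)
    then obtain N where N: "\<And>n. n \<ge> N \<Longrightarrow> norm (lift_l2 (translate (a n) 0) v - v) < r / 3"
      using LIMSEQ_D[of _ v "r / 3"] r by auto
    have "norm (norm (lift_l2 (translate (a n) 0) u - u) - 0) < r" if "n \<ge> N" for n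
    proof -
      let ?W = "lift_l2 (translate (a n) 0)"
      have "norm (?W u - ?W v) = norm (v - u)"
        using linear_diff[OF bounded_linear.linear[OF tr(2)], of "a n" 0 u v] tr(1)[of "a n" 0 "u - v"]
        by (simp add: norm_minus_commute)
      moreover have "norm (?W u - u) \<le> norm (?W u - ?W v) + norm (?W v - v) + norm (v - u)"
        using norm_triangle_ineq[of "?W u - ?W v" "?W v - u"] norm_triangle_ineq[of "?W v - v" "v - u"] by simp
      ultimately show ?thesis using N[OF that] v by simp
    qed
    then show "\<exists>N. \<forall>n\<ge>N. norm (norm (lift_l2 (translate (a n) 0) u - u) - 0) < r" by blast
  qed
  then show ?thesis by (rule Lim_null[THEN iffD2, OF tendsto_norm_zero_cancel])
qed

section \<open>Plancherel's identity for functions in both L1 and L2\<close>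

definition fti :: "(real \<Rightarrow> complex) \<Rightarrow> real \<Rightarrow> complex" where
  "fti G \<xi> = (\<integral>x. cis (- (\<xi> * x)) * G x \<partial>lborel) / complex_of_real (sqrt (2 * pi))"

lemma integrable_bounded_mult:
  fixes G k :: "real \<Rightarrow> complex"
  assumes "integrable lborel G" "k \<in> borel_measurable borel" "\<And>x. norm (k x) \<le> C"
  shows "integrable lborel (\<lambda>x. k x * G x)"
proof (rule Bochner_Integration.integrable_bound)
  show "integrable lborel (\<lambda>x. C * norm (G x))" using assms(1) by simp
  show "(\<lambda>x. k x * G x) \<in> borel_measurable lborel" using assms(1,2) by measurable
  show "AE x in lborel. norm (k x * G x) \<le> norm (C * norm (G x))"
    using assms(3) by (intro AE_I2) (auto simp: norm_mult abs_mult intro!: mult_right_mono order_trans[OF _ abs_ge_self])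
qed

lemma integrable_fti: "integrable lborel G \<Longrightarrow> integrable lborel (\<lambda>x. cis (- (\<xi> * x)) * G x)"
  by (rule integrable_bounded_mult[of _ _ 1]) auto

lemma norm_fti_le: "norm (fti G \<xi>) \<le> (\<integral>x. norm (G x) \<partial>lborel) / sqrt (2 * pi)"
  using integral_norm_bound[of lborel "\<lambda>x. cis (- (\<xi> * x)) * G x"]
  by (simp add: fti_def norm_divide norm_mult divide_right_mono)

lemma measurable_fti [measurable]:
  assumes [measurable]: "G \<in> borel_measurable borel" shows "fti G \<in> borel_measurable borel"
  unfolding fti_def[abs_def] by measurable

text \<open>A bounded kernel between two integrable factors is integrable on the plane. It serves
  both the Fourier kernel \<open>cis\<close> and bounded convolution kernels.\<close>

lemma fubini_kernel:
  fixes a b :: "real \<Rightarrow> complex"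
  assumes a: "integrable lborel a" and b: "integrable lborel b"
    and k [measurable]: "case_prod k \<in> borel_measurable (borel \<Otimes>\<^sub>M borel)" and C: "\<And>x y. norm (k x y) \<le> C"
  shows "(\<integral>x. a x * (\<integral>y. k x y * b y \<partial>lborel) \<partial>lborel) = (\<integral>y. (\<integral>x. k x y * a x \<partial>lborel) * b y \<partial>lborel)"
proof -
  have [measurable]: "a \<in> borel_measurable borel" "b \<in> borel_measurable borel" using a b by auto
  have [measurable]: "case_prod k \<in> borel_measurable (lborel \<Otimes>\<^sub>M lborel)"
    using k by (simp add: cong: measurable_cong_sets)
  have C0: "0 \<le> C" using C[of 0 0] norm_ge_zero order_trans by blast
  have "integrable (lborel \<Otimes>\<^sub>M lborel) (\<lambda>(x, y). a x * (k x y * b y))"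
  proof (rule lborel_pair.Fubini_integrable)
    show "(\<lambda>(x, y). a x * (k x y * b y)) \<in> borel_measurable (lborel \<Otimes>\<^sub>M lborel)" by measurable
    have "integrable lborel (\<lambda>y. k x y * b y)" for x
      by (rule integrable_bounded_mult[OF b _ C]) measurable
    then show "AE x in lborel. integrable lborel (\<lambda>y. case (x, y) of (x, y) \<Rightarrow> a x * (k x y * b y))" by simp
    show "integrable lborel (\<lambda>x. \<integral>y. norm (case (x, y) of (x, y) \<Rightarrow> a x * (k x y * b y)) \<partial>lborel)"
    proof (rule Bochner_Integration.integrable_bound)
      show "integrable lborel (\<lambda>x. norm (a x) * (C * (\<integral>y. norm (b y) \<partial>lborel)))" using a by simp
      show "(\<lambda>x. \<integral>y. norm (case (x, y) of (x, y) \<Rightarrow> a x * (k x y * b y)) \<partial>lborel) \<in> borel_measurable lborel"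
        by measurable
      have "(\<integral>y. norm (k x y * b y) \<partial>lborel) \<le> (\<integral>y. C * norm (b y) \<partial>lborel)" for x
      proof (rule integral_mono)
        show "integrable lborel (\<lambda>y. norm (k x y * b y))"
          by (rule integrable_norm, rule integrable_bounded_mult[OF b _ C]) measurable
        show "integrable lborel (\<lambda>y. C * norm (b y))" using b by simp
        show "norm (k x y * b y) \<le> C * norm (b y)" for y
          using C[of x y] by (simp add: norm_mult mult_right_mono)
      qed
      then have "norm (a x) * (\<integral>y. norm (k x y * b y) \<partial>lborel) \<le> norm (a x) * (C * (\<integral>y. norm (b y) \<partial>lborel))" for x
        by (intro mult_left_mono) auto
      moreover have "0 \<le> norm (a x) * (\<integral>y. norm (k x y * b y) \<partial>lborel)"
        "0 \<le> norm (a x) * (C * (\<integral>y. norm (b y) \<partial>lborel))" for x using C0 by auto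
      ultimately show "AE x in lborel. norm (\<integral>y. norm (case (x, y) of (x, y) \<Rightarrow> a x * (k x y * b y)) \<partial>lborel)
          \<le> norm (norm (a x) * (C * (\<integral>y. norm (b y) \<partial>lborel)))"
        by (simp add: norm_mult[of "a _"] abs_of_nonneg)
    qed
  qed
  from lborel_pair.Fubini_integral[OF this]
  have "(\<integral>x. (\<integral>y. a x * (k x y * b y) \<partial>lborel) \<partial>lborel) = (\<integral>y. (\<integral>x. a x * (k x y * b y) \<partial>lborel) \<partial>lborel)"
    by simp
  moreover have "(\<integral>y. a x * (k x y * b y) \<partial>lborel) = a x * (\<integral>y. k x y * b y \<partial>lborel)" for x
    by (rule integral_mult_right_zero)
  moreover have "(\<integral>x. a x * (k x y * b y) \<partial>lborel) = (\<integral>x. k x y * a x \<partial>lborel) * b y" for y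
    by (subst integral_mult_left_zero[symmetric]) (simp add: mult_ac)
  ultimately show ?thesis by simp
qed

lemma integral_std_normal_cis:
  "(\<integral>u. cis (u * t) * complex_of_real (std_normal_density u) \<partial>lborel) = complex_of_real (exp (- t\<^sup>2 / 2))"
proof -
  have "complex_of_real (exp (- t\<^sup>2 / 2)) = char std_normal_distribution t"
    by (simp add: char_std_normal_distribution)
  also have "\<dots> = (\<integral>u. std_normal_density u *\<^sub>R iexp (t * u) \<partial>lborel)"
    unfolding char_def by (rule integral_density) auto
  also have "\<dots> = (\<integral>u. cis (u * t) * complex_of_real (std_normal_density u) \<partial>lborel)"
    by (simp add: cis_conv_exp scaleR_conv_of_real mult_ac)
  finally show ?thesis by simp
qed

text \<open>
  Letting \<open>\<epsilon>\<close> tend to \<open>0\<close> gives Plancherel's identity: the left-hand side increases to the squared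
  norm of the transform, and the autocorrelation on the right-hand side tends to its value at \<open>0\<close>.
\<close>

lemma gaussian_plancherel:
  assumes G: "integrable lborel G" and sq: "sq_integrable G" and e: "0 < \<epsilon>"
  defines "u \<equiv> abs_l2 G"
  shows "(\<integral>\<xi>. exp (- (\<epsilon> * \<xi>)\<^sup>2 / 2) * (cmod (fti G \<xi>))\<^sup>2 \<partial>lborel)
      = (\<integral>w. std_normal_density w * inner u (lift_l2 (translate (\<epsilon> * w) 0) u) \<partial>lborel)"
proof -
  have [measurable]: "G \<in> borel_measurable borel" using G by auto
  define n where "n w = complex_of_real (std_normal_density w)" for w
  have n: "integrable lborel n" unfolding n_def by (intro integrable_of_real) simp
  have [measurable]: "n \<in> borel_measurable borel" unfolding n_def by measurable
  \<comment> \<open>Substituting \<open>\<xi> = c * w\<close> turns the Gaussian weight into a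
    multiple of the standard normal density, whose transform is known; \<open>T w\<close> is the
    unnormalised transform of \<open>G\<close> at frequency \<open>c * w\<close>.\<close>
  define c where "c = 1 / \<epsilon>"
  have c: "0 < c" using e by (simp add: c_def)
  define T where "T w = (\<integral>x. cis (- (c * w * x)) * G x \<partial>lborel)" for w
  have [measurable]: "T \<in> borel_measurable borel" unfolding T_def by measurable
  have Tb: "cmod (T w) \<le> (\<integral>x. norm (G x) \<partial>lborel)" for w
    unfolding T_def using integral_norm_bound[of lborel "\<lambda>x. cis (- (c * w * x)) * G x"] by (simp add: norm_mult)
  have T: "T w = complex_of_real (sqrt (2 * pi)) * fti G (c * w)" for w
    by (simp add: T_def fti_def)
  have cnjT: "cnj (T w) = (\<integral>y. cis (c * w * y) * cnj (G y) \<partial>lborel)" for w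
  proof -
    have "cnj (T w) = (\<integral>x. cnj (cis (- (c * w * x)) * G x) \<partial>lborel)"
      unfolding T_def by (rule Bochner_Integration.integral_cnj[symmetric])
    then show ?thesis by (simp add: cis_cnj)
  qed
  define E where "E z = complex_of_real (exp (- (c * z)\<^sup>2 / 2))" for z
  have [measurable]: "E \<in> borel_measurable borel" unfolding E_def by measurable
  have i1: "integrable lborel (\<lambda>w. cnj (T w) * n w)"
    by (rule integrable_bounded_mult[OF n _ order_trans[OF eq_refl Tb]]) (auto simp del: complex_cnj_mult)
  have i2: "integrable lborel (\<lambda>w. cis (- (c * w * x)) * n w)" for x
    by (rule integrable_bounded_mult[OF n, of _ 1]) auto
  have i3: "integrable lborel (\<lambda>y. cnj (G y))" using G by simp
  \<comment> \<open>Both transforms are expanded into integrals and the order is exchanged twice, so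
    that the Gaussian is integrated over frequency first and yields the kernel
    \<open>E (y - x)\<close>.\<close>
  have "(\<integral>w. n w * (T w * cnj (T w)) \<partial>lborel) = (\<integral>w. (cnj (T w) * n w) * T w \<partial>lborel)"
    by (simp add: mult_ac)
  also have "\<dots> = (\<integral>w. (cnj (T w) * n w) * (\<integral>x. cis (- (c * w * x)) * G x \<partial>lborel) \<partial>lborel)"
    by (simp only: T_def)
  also have "\<dots> = (\<integral>x. (\<integral>w. cis (- (c * w * x)) * (cnj (T w) * n w) \<partial>lborel) * G x \<partial>lborel)"
    by (rule fubini_kernel[OF i1 G, of _ 1]) auto
  also have "(\<lambda>x. \<integral>w. cis (- (c * w * x)) * (cnj (T w) * n w) \<partial>lborel)
      = (\<lambda>x. \<integral>y. E (y - x) * cnj (G y) \<partial>lborel)"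
  proof
    fix x
    have "(\<integral>w. cis (- (c * w * x)) * (cnj (T w) * n w) \<partial>lborel)
       = (\<integral>w. (cis (- (c * w * x)) * n w) * cnj (T w) \<partial>lborel)"
      by (simp add: mult_ac)
    also have "\<dots> = (\<integral>w. (cis (- (c * w * x)) * n w) * (\<integral>y. cis (c * w * y) * cnj (G y) \<partial>lborel) \<partial>lborel)"
      by (simp only: cnjT)
    also have "\<dots> = (\<integral>y. (\<integral>w. cis (c * w * y) * (cis (- (c * w * x)) * n w) \<partial>lborel) * cnj (G y) \<partial>lborel)"
      by (rule fubini_kernel[OF i2 i3, of _ 1]) auto
    also have "(\<lambda>y. \<integral>w. cis (c * w * y) * (cis (- (c * w * x)) * n w) \<partial>lborel) = (\<lambda>y. E (y - x))"
    proof
      fix y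
      have "cis (c * w * y) * cis (- (c * w * x)) = cis (w * (c * (y - x)))" for w
        by (simp add: cis_mult algebra_simps)
      then have eq: "cis (c * w * y) * (cis (- (c * w * x)) * n w) = cis (w * (c * (y - x))) * n w" for w
        by (metis mult.assoc)
      show "(\<integral>w. cis (c * w * y) * (cis (- (c * w * x)) * n w) \<partial>lborel) = E (y - x)"
        unfolding eq unfolding n_def E_def by (rule integral_std_normal_cis)
    qed
    finally show "(\<integral>w. cis (- (c * w * x)) * (cnj (T w) * n w) \<partial>lborel) = (\<integral>y. E (y - x) * cnj (G y) \<partial>lborel)" .
  qed
  \<comment> \<open>The substitution \<open>y = x - \<epsilon> * w\<close> turns the kernel back
    into the normal density, now averaging translates of \<open>G\<close>.\<close>
  also have "(\<lambda>x. \<integral>y. E (y - x) * cnj (G y) \<partial>lborel)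
      = (\<lambda>x. complex_of_real (\<epsilon> * sqrt (2 * pi)) * (\<integral>w. n w * cnj (G (x - \<epsilon> * w)) \<partial>lborel))"
  proof
    fix x
    have "E (- (\<epsilon> * w)) = complex_of_real (sqrt (2 * pi)) * n w" for w
      using e by (simp add: E_def n_def c_def std_normal_density_def field_simps)
    then have "\<epsilon> *\<^sub>R (\<integral>w. E (- (\<epsilon> * w)) * cnj (G (x - \<epsilon> * w)) \<partial>lborel)
        = complex_of_real (\<epsilon> * sqrt (2 * pi)) * (\<integral>w. n w * cnj (G (x - \<epsilon> * w)) \<partial>lborel)"
      by (simp add: scaleR_conv_of_real mult.assoc)
    then show "(\<integral>y. E (y - x) * cnj (G y) \<partial>lborel)
      = complex_of_real (\<epsilon> * sqrt (2 * pi)) * (\<integral>w. n w * cnj (G (x - \<epsilon> * w)) \<partial>lborel)"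
      using e lborel_integral_real_affine[of "- \<epsilon>" "\<lambda>y. E (y - x) * cnj (G y)" x] by simp
  qed
  also have "(\<integral>x. complex_of_real (\<epsilon> * sqrt (2 * pi)) * (\<integral>w. n w * cnj (G (x - \<epsilon> * w)) \<partial>lborel) * G x \<partial>lborel)
      = complex_of_real (\<epsilon> * sqrt (2 * pi)) * (\<integral>x. (\<integral>w. n w * (G x * cnj (G (x - \<epsilon> * w))) \<partial>lborel) \<partial>lborel)"
  proof -
    have "(\<integral>w. n w * (G x * cnj (G (x - \<epsilon> * w))) \<partial>lborel) = (\<integral>w. n w * cnj (G (x - \<epsilon> * w)) \<partial>lborel) * G x" for x
      by (subst integral_mult_left_zero[symmetric]) (simp add: mult_ac)
    then show ?thesis by (simp only: mult.assoc integral_mult_right_zero)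
  qed
  finally have main1: "(\<integral>w. n w * (T w * cnj (T w)) \<partial>lborel) = complex_of_real (\<epsilon> * sqrt (2 * pi))
      * (\<integral>x. (\<integral>w. n w * (G x * cnj (G (x - \<epsilon> * w))) \<partial>lborel) \<partial>lborel)" .
  have sqG: "integrable lborel (\<lambda>x. (cmod (G x))\<^sup>2)" using sq by (simp add: sq_integrable_def)
  have bd: "cmod (G x) * cmod (G (x - a)) \<le> (cmod (G x))\<^sup>2 + (cmod (G (x - a)))\<^sup>2" for x a
    using sum_squares_bound[of "cmod (G x)" "cmod (G (x - a))"]
      mult_nonneg_nonneg[OF norm_ge_zero[of "G x"] norm_ge_zero[of "G (x - a)"]] by linarith
  have dom: "integrable lborel (\<lambda>x. (cmod (G x))\<^sup>2 + (cmod (G (x - a)))\<^sup>2)" for a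
    by (intro Bochner_Integration.integrable_add sqG integrable_shift[of "\<lambda>x. (cmod (G x))\<^sup>2"])
  have j: "integrable lborel (\<lambda>x. G x * cnj (G (x - a)))" for a
    by (rule Bochner_Integration.integrable_bound[OF dom[of a]]) (use bd in \<open>auto simp: norm_mult\<close>)
  \<comment> \<open>Absolute integrability uses that \<open>G\<close> is square integrable: products
    of translates are dominated by sums of squares.\<close>
  have prod: "integrable (lborel \<Otimes>\<^sub>M lborel) (\<lambda>(w, x). n w * (G x * cnj (G (x - \<epsilon> * w))))"
  proof -
    have "integrable (lborel \<Otimes>\<^sub>M lborel) (\<lambda>(w, x). n w * (G x * cnj (G (x - \<epsilon> * w))))"
    proof (rule lborel_pair.Fubini_integrable)
      show "(\<lambda>(w, x). n w * (G x * cnj (G (x - \<epsilon> * w)))) \<in> borel_measurable (lborel \<Otimes>\<^sub>M lborel)"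
        by measurable
      show "AE w in lborel. integrable lborel (\<lambda>x. case (w, x) of (w, x) \<Rightarrow> n w * (G x * cnj (G (x - \<epsilon> * w))))"
        using j by simp
      show "integrable lborel (\<lambda>w. \<integral>x. norm (case (w, x) of (w, x) \<Rightarrow> n w * (G x * cnj (G (x - \<epsilon> * w)))) \<partial>lborel)"
      proof (rule Bochner_Integration.integrable_bound)
        define M where "M = (\<integral>x. (cmod (G x))\<^sup>2 \<partial>lborel)"
        show "integrable lborel (\<lambda>w. norm (n w) * (2 * M))" using n by simp
        show "(\<lambda>w. \<integral>x. norm (case (w, x) of (w, x) \<Rightarrow> n w * (G x * cnj (G (x - \<epsilon> * w)))) \<partial>lborel) \<in> borel_measurable lborel"
          by measurable
        have "(\<integral>x. cmod (G x) * cmod (G (x - a)) \<partial>lborel) \<le> (\<integral>x. (cmod (G x))\<^sup>2 + (cmod (G (x - a)))\<^sup>2 \<partial>lborel)" for a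
          by (intro integral_mono dom bd) (use integrable_norm[OF j[of a]] in \<open>simp add: norm_mult\<close>)
        also have "\<dots> a = 2 * M" for a
          using integrable_shift[OF sqG, of a] sqG integral_shift[of "\<lambda>x. (cmod (G x))\<^sup>2" a]
          by (simp add: M_def)
        finally have "norm (n w) * (\<integral>x. cmod (G x) * cmod (G (x - a)) \<partial>lborel) \<le> norm (n w) * (2 * M)" for w a
          by (intro mult_left_mono) auto
        moreover have "0 \<le> M" by (simp add: M_def)
        ultimately show "AE w in lborel. norm (\<integral>x. norm (case (w, x) of (w, x) \<Rightarrow> n w * (G x * cnj (G (x - \<epsilon> * w)))) \<partial>lborel)
            \<le> norm (norm (n w) * (2 * M))"
          by (simp add: norm_mult abs_mult)
      qed
    qed
    then show ?thesis .
  qed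
  define A where "A w = (\<integral>x. G x * cnj (G (x - \<epsilon> * w)) \<partial>lborel)" for w
  have main: "(\<integral>w. n w * (T w * cnj (T w)) \<partial>lborel)
      = complex_of_real (\<epsilon> * sqrt (2 * pi)) * (\<integral>w. n w * A w \<partial>lborel)"
    using lborel_pair.Fubini_integral[OF prod] by (simp add: main1 A_def)
  have nA: "integrable lborel (\<lambda>w. n w * A w)"
    using lborel_pair.integrable_fst'[OF prod] by (simp add: A_def)
  have inn: "inner (abs_l2 f) (abs_l2 g) = (\<integral>x. f x \<bullet> g x \<partial>lborel)"
    if "sq_integrable f" "sq_integrable g" for f g :: "real \<Rightarrow> complex"
    using that by (intro inner_l2.abs_eq) (auto simp: l2_rel_def)
  have ReA: "Re (A w) = inner u (lift_l2 (translate (\<epsilon> * w) 0) u)" for w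
  proof -
    have "sq_integrable (translate (\<epsilon> * w) 0 G)"
      using isometry_translate[of "\<epsilon> * w" 0] sq by (simp add: l2_isometry_def)
    then have "inner u (lift_l2 (translate (\<epsilon> * w) 0) u) = (\<integral>x. G x \<bullet> translate (\<epsilon> * w) 0 G x \<partial>lborel)"
      unfolding u_def lift_l2(3)[OF isometry_translate sq] by (rule inn[OF sq])
    also have "\<dots> = (\<integral>x. Re (G x * cnj (G (x - \<epsilon> * w))) \<partial>lborel)"
      by (simp add: translate_def inner_complex_def)
    also have "\<dots> = Re (A w)" unfolding A_def by (rule integral_Re[OF j])
    finally show ?thesis by simp
  qed
  have lhs: "n w * (T w * cnj (T w)) = complex_of_real (2 * pi * (std_normal_density w * (cmod (fti G (c * w)))\<^sup>2))" for w
  proof -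
    have "T w * cnj (T w) = complex_of_real ((cmod (T w))\<^sup>2)" by (rule complex_norm_square[symmetric])
    moreover have "(cmod (T w))\<^sup>2 = 2 * pi * (cmod (fti G (c * w)))\<^sup>2"
      by (simp add: T norm_mult power_mult_distrib)
    ultimately show ?thesis by (simp only: n_def of_real_mult[symmetric]) (simp only: mult_ac)
  qed
  define X where "X = (\<integral>w. std_normal_density w * (cmod (fti G (c * w)))\<^sup>2 \<partial>lborel)"
  have a: "Re (\<integral>w. n w * (T w * cnj (T w)) \<partial>lborel) = 2 * pi * X"
    unfolding lhs integral_complex_of_real Re_complex_of_real X_def by simp
  have b: "(\<integral>\<xi>. exp (- (\<epsilon> * \<xi>)\<^sup>2 / 2) * (cmod (fti G \<xi>))\<^sup>2 \<partial>lborel) = c * (sqrt (2 * pi) * X)"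
  proof -
    have ec: "\<epsilon> * (0 + c * w) = w" for w using e by (simp add: c_def)
    have "exp (- (\<epsilon> * (0 + c * w))\<^sup>2 / 2) * (cmod (fti G (0 + c * w)))\<^sup>2
        = sqrt (2 * pi) * (std_normal_density w * (cmod (fti G (c * w)))\<^sup>2)" for w
      unfolding ec by (simp add: std_normal_density_def)
    then show ?thesis
      using lborel_integral_real_affine[of c "\<lambda>\<xi>. exp (- (\<epsilon> * \<xi>)\<^sup>2 / 2) * (cmod (fti G \<xi>))\<^sup>2" 0] c
      by (simp only: integral_mult_right_zero) (simp add: X_def)
  qed
  have r: "Re (\<integral>w. n w * A w \<partial>lborel)
      = (\<integral>w. std_normal_density w * inner u (lift_l2 (translate (\<epsilon> * w) 0) u) \<partial>lborel)"
    by (subst integral_Re[OF nA, symmetric]) (simp add: ReA n_def)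
  have "2 * pi * X = \<epsilon> * sqrt (2 * pi) * Re (\<integral>w. n w * A w \<partial>lborel)"
    unfolding a[symmetric] main times_complex.sel by simp
  moreover have "2 * pi = sqrt (2 * pi) * sqrt (2 * pi)" by simp
  ultimately have "sqrt (2 * pi) * (sqrt (2 * pi) * X) = sqrt (2 * pi) * (\<epsilon> * Re (\<integral>w. n w * A w \<partial>lborel))"
    by (metis mult.assoc mult.commute)
  then have "sqrt (2 * pi) * X = \<epsilon> * Re (\<integral>w. n w * A w \<partial>lborel)"
    by (subst (asm) mult_cancel_left) simp
  then show ?thesis using e unfolding b r by (simp add: c_def)
qed

definition l12 :: "(real \<Rightarrow> complex) \<Rightarrow> bool" where
  "l12 G \<longleftrightarrow> integrable lborel G \<and> sq_integrable G"

lemma plancherel: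
  assumes "l12 G"
  shows "sq_integrable (fti G)" and "norm (abs_l2 (fti G)) = norm (abs_l2 G)"
proof -
  have G: "integrable lborel G" and sq: "sq_integrable G" using assms by (auto simp: l12_def)
  have [measurable]: "G \<in> borel_measurable borel" using G by auto
  define u where "u = abs_l2 G"
  define \<epsilon> where "\<epsilon> m = inverse (real (Suc m))" for m
  have e: "0 < \<epsilon> m" for m by (simp add: \<epsilon>_def)
  have elim: "\<epsilon> \<longlonglongrightarrow> 0" unfolding \<epsilon>_def by (rule LIMSEQ_inverse_real_of_nat)
  define F where "F m \<xi> = exp (- (\<epsilon> m * \<xi>)\<^sup>2 / 2) * (cmod (fti G \<xi>))\<^sup>2" for m \<xi>
  define A where "A m w = inner u (lift_l2 (translate (\<epsilon> m * w) 0) u)" for m w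
  have gp: "(\<integral>\<xi>. F m \<xi> \<partial>lborel) = (\<integral>w. std_normal_density w * A m w \<partial>lborel)" for m
    unfolding F_def A_def u_def by (rule gaussian_plancherel[OF G sq e])
  \<comment> \<open>\<open>A m\<close> is continuous in \<open>w\<close>: a translation by
    \<open>\<epsilon> m * w\<close> is a translation by a small amount after the one by
    \<open>\<epsilon> m * w0\<close>, and translations are continuous at 0.\<close>
  have Am: "A m \<in> borel_measurable borel" for m
  proof (rule borel_measurable_continuous_onI, subst continuous_on_sequentially, intro ballI allI impI)
    fix w :: "nat \<Rightarrow> real" and w0 assume "(\<forall>n. w n \<in> UNIV) \<and> w \<longlonglongrightarrow> w0"
    then have "(\<lambda>n. \<epsilon> m * w n - \<epsilon> m * w0) \<longlonglongrightarrow> \<epsilon> m * w0 - \<epsilon> m * w0"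
      by (intro tendsto_diff tendsto_mult tendsto_const) auto
    then have "(\<lambda>n. \<epsilon> m * w n - \<epsilon> m * w0) \<longlonglongrightarrow> 0" by simp
    then have "(\<lambda>n. lift_l2 (translate (\<epsilon> m * w n - \<epsilon> m * w0) 0) (lift_l2 (translate (\<epsilon> m * w0) 0) u))
        \<longlonglongrightarrow> lift_l2 (translate (\<epsilon> m * w0) 0) u"
      by (rule translate_continuous)
    moreover have "lift_l2 (translate (a - b) 0) (lift_l2 (translate b 0) u) = lift_l2 (translate a 0) u" for a b
    proof -
      have s: "sq_integrable (translate b 0 G)"
        using isometry_translate[of b 0] sq by (simp add: l2_isometry_def)
      show ?thesis
        unfolding u_def lift_l2(3)[OF isometry_translate sq] lift_l2(3)[OF isometry_translate s]
        by (rule arg_cong[of _ _ abs_l2]) (simp add: translate_def fun_eq_iff)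
    qed
    ultimately have "(\<lambda>n. lift_l2 (translate (\<epsilon> m * w n) 0) u) \<longlonglongrightarrow> lift_l2 (translate (\<epsilon> m * w0) 0) u"
      by simp
    then show "(A m \<circ> w) \<longlonglongrightarrow> A m w0"
      unfolding A_def comp_def by (intro tendsto_inner tendsto_const)
  qed
  have Ab: "\<bar>A m w\<bar> \<le> (norm u)\<^sup>2" for m w
    using Cauchy_Schwarz_ineq2[of u "lift_l2 (translate (\<epsilon> m * w) 0) u"]
    by (simp add: A_def lift_l2(1)[OF isometry_translate] power2_eq_square)
  have "(\<lambda>m. \<integral>w. std_normal_density w * A m w \<partial>lborel) \<longlonglongrightarrow> (\<integral>w. std_normal_density w * (norm u)\<^sup>2 \<partial>lborel)"
  proof (rule integral_dominated_convergence)
    show "integrable lborel (\<lambda>w. std_normal_density w * (norm u)\<^sup>2)" by simp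
    show "(\<lambda>w. std_normal_density w * A m w) \<in> borel_measurable lborel" for m using Am[of m] by measurable
    have "(\<lambda>m. A m w) \<longlonglongrightarrow> inner u u" for w
      unfolding A_def
    proof (intro tendsto_inner tendsto_const translate_continuous)
      show "(\<lambda>m. \<epsilon> m * w) \<longlonglongrightarrow> 0" using tendsto_mult[OF elim tendsto_const[of w]] by simp
    qed
    then show "AE w in lborel. (\<lambda>m. std_normal_density w * A m w) \<longlonglongrightarrow> std_normal_density w * (norm u)\<^sup>2"
      by (intro AE_I2 tendsto_mult tendsto_const) (simp add: power2_norm_eq_inner)
    show "AE w in lborel. norm (std_normal_density w * A m w) \<le> std_normal_density w * (norm u)\<^sup>2" for m
      using Ab by (intro AE_I2) (simp add: abs_mult mult_left_mono)
  qed simp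
  then have lim1: "(\<lambda>m. \<integral>\<xi>. F m \<xi> \<partial>lborel) \<longlonglongrightarrow> (norm u)\<^sup>2" by (simp add: gp)
  have [measurable]: "F m \<in> borel_measurable borel" for m unfolding F_def by measurable
  have F0: "0 \<le> F m \<xi>" for m \<xi> by (simp add: F_def)
  have Fi: "integrable lborel (F m)" for m
  proof (rule Bochner_Integration.integrable_bound)
    define M where "M = (\<integral>x. norm (G x) \<partial>lborel) / sqrt (2 * pi)"
    have "integrable lborel (\<lambda>\<xi>. sqrt (2 * pi) * std_normal_density (0 + \<epsilon> m * \<xi>) * M\<^sup>2)"
      by (intro integrable_mult_left integrable_mult_right lborel_integrable_real_affine) (use e[of m] in auto)
    then show "integrable lborel (\<lambda>\<xi>. exp (- (\<epsilon> m * \<xi>)\<^sup>2 / 2) * M\<^sup>2)"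
      by (simp add: std_normal_density_def)
    have "(cmod (fti G \<xi>))\<^sup>2 \<le> M\<^sup>2" for \<xi> unfolding M_def by (rule power_mono[OF norm_fti_le]) simp
    then show "AE \<xi> in lborel. norm (F m \<xi>) \<le> norm (exp (- (\<epsilon> m * \<xi>)\<^sup>2 / 2) * M\<^sup>2)"
      by (intro AE_I2) (simp add: F_def abs_mult mult_left_mono)
  qed measurable
  \<comment> \<open>Square integrability of the transform is not yet known, so monotone convergence
    of nonnegative integrals is used; finiteness of the limit then supplies it.\<close>
  have "(\<lambda>m. \<integral>\<^sup>+\<xi>. ennreal (F m \<xi>) \<partial>lborel) \<longlonglongrightarrow> (\<integral>\<^sup>+\<xi>. ennreal ((cmod (fti G \<xi>))\<^sup>2) \<partial>lborel)"
  proof (rule nn_integral_LIMSEQ)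
    show "incseq (\<lambda>m \<xi>. ennreal (F m \<xi>))"
    proof (intro incseq_SucI le_funI ennreal_leI)
      fix m \<xi>
      have "\<epsilon> (Suc m) \<le> \<epsilon> m" by (simp add: \<epsilon>_def)
      then have "(\<epsilon> (Suc m))\<^sup>2 * \<xi>\<^sup>2 \<le> (\<epsilon> m)\<^sup>2 * \<xi>\<^sup>2"
        using e[of "Suc m"] by (intro mult_right_mono power_mono) auto
      then show "F m \<xi> \<le> F (Suc m) \<xi>"
        unfolding F_def by (intro mult_right_mono) (auto simp: power_mult_distrib)
    qed
    show "(\<lambda>m. ennreal (F m \<xi>)) \<longlonglongrightarrow> ennreal ((cmod (fti G \<xi>))\<^sup>2)" for \<xi>
    proof (rule tendsto_ennrealI)
      have "(\<lambda>m. F m \<xi>) \<longlonglongrightarrow> exp (- (0 * \<xi>)\<^sup>2 / 2) * (cmod (fti G \<xi>))\<^sup>2"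
        unfolding F_def by (intro tendsto_intros elim) simp
      then show "(\<lambda>m. F m \<xi>) \<longlonglongrightarrow> (cmod (fti G \<xi>))\<^sup>2" by simp
    qed
  qed measurable
  moreover have "(\<integral>\<^sup>+\<xi>. ennreal (F m \<xi>) \<partial>lborel) = ennreal (\<integral>\<xi>. F m \<xi> \<partial>lborel)" for m
    by (rule nn_integral_eq_integral[OF Fi]) (simp add: F0)
  ultimately have "(\<lambda>m. ennreal (\<integral>\<xi>. F m \<xi> \<partial>lborel)) \<longlonglongrightarrow> (\<integral>\<^sup>+\<xi>. ennreal ((cmod (fti G \<xi>))\<^sup>2) \<partial>lborel)"
    by simp
  then have nn: "(\<integral>\<^sup>+\<xi>. ennreal ((cmod (fti G \<xi>))\<^sup>2) \<partial>lborel) = ennreal ((norm u)\<^sup>2)"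
    using tendsto_ennrealI[OF lim1] by (rule LIMSEQ_unique)
  have "integrable lborel (\<lambda>\<xi>. (cmod (fti G \<xi>))\<^sup>2)"
    by (rule integrableI_nn_integral_finite[OF _ _ nn]) auto
  then show sqf: "sq_integrable (fti G)" by (simp add: sq_integrable_def)
  have "(norm (abs_l2 (fti G)))\<^sup>2 = (norm (abs_l2 G))\<^sup>2"
    unfolding norm_abs_l2[OF sqf] u_def[symmetric]
    by (rule integral_eq_nn_integral[THEN trans]) (auto simp: nn)
  then show "norm (abs_l2 (fti G)) = norm (abs_l2 G)" by (simp add: power2_eq_iff_nonneg)
qed

lemma l12_add: "l12 G \<Longrightarrow> l12 H \<Longrightarrow> l12 (\<lambda>x. G x + H x)"
  and l12_diff: "l12 G \<Longrightarrow> l12 H \<Longrightarrow> l12 (\<lambda>x. G x - H x)"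
  and l12_scaleR: "l12 G \<Longrightarrow> l12 (\<lambda>x. c *\<^sub>R G x)"
  by (auto simp: l12_def sq_integrable_add sq_integrable_diff sq_integrable_scaleR)

lemma fti_add: "l12 G \<Longrightarrow> l12 H \<Longrightarrow> fti (\<lambda>x. G x + H x) = (\<lambda>\<xi>. fti G \<xi> + fti H \<xi>)"
  by (simp add: fun_eq_iff fti_def l12_def distrib_left integrable_fti add_divide_distrib)

lemma fti_diff: "l12 G \<Longrightarrow> l12 H \<Longrightarrow> fti (\<lambda>x. G x - H x) = (\<lambda>\<xi>. fti G \<xi> - fti H \<xi>)"
  by (simp add: fun_eq_iff fti_def l12_def right_diff_distrib integrable_fti diff_divide_distrib)

lemma fti_scaleR: "fti (\<lambda>x. c *\<^sub>R G x) = (\<lambda>\<xi>. c *\<^sub>R fti G \<xi>)"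
  by (simp add: fun_eq_iff fti_def scaleR_conv_of_real mult.left_commute[of _ "of_real c"])

lemma norm_fti_diff:
  assumes "l12 G" "l12 H"
  shows "norm (abs_l2 (fti G) - abs_l2 (fti H)) = norm (abs_l2 G - abs_l2 H)"
  using plancherel(2)[OF l12_diff[OF assms]] plancherel(1)[OF assms(1)] plancherel(1)[OF assms(2)] assms
  by (simp add: fti_diff abs_l2_diff l12_def)

lemma truncation:
  fixes f :: "real \<Rightarrow> 'a::euclidean_space"
  assumes f: "sq_integrable f"
  shows "integrable lborel (\<lambda>x. indicator {- real n..real n} x *\<^sub>R f x)"
    "sq_integrable (\<lambda>x. indicator {- real n..real n} x *\<^sub>R f x)"
    "(\<lambda>n. abs_l2 (\<lambda>x. indicator {- real n..real n} x *\<^sub>R f x)) \<longlonglongrightarrow> abs_l2 f"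
proof -
  have [measurable]: "f \<in> borel_measurable borel" and int: "integrable lborel (\<lambda>x. (norm (f x))\<^sup>2)"
    using f by (auto simp: sq_integrable_def)
  show "integrable lborel (\<lambda>x. indicator {- real n..real n} x *\<^sub>R f x)"
  proof (rule Bochner_Integration.integrable_bound)
    show "integrable lborel (\<lambda>x. indicator {- real n..real n} x + (norm (f x))\<^sup>2)"
      by (intro Bochner_Integration.integrable_add int integrable_real_indicator)
         (auto simp: emeasure_lborel_Icc_eq)
    have "norm (f x) \<le> 1 + (norm (f x))\<^sup>2" for x
    proof -
      have "2 * norm (f x) \<le> 1 + (norm (f x))\<^sup>2" using sum_squares_bound[of 1 "norm (f x)"] by simp
      then show ?thesis using norm_ge_zero[of "f x"] by linarith
    qed
    then show "AE x in lborel. norm (indicator {- real n..real n} x *\<^sub>R f x)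
        \<le> norm (indicator {- real n..real n} x + (norm (f x))\<^sup>2)"
      by (intro AE_I2) (auto simp: indicator_def)
  qed measurable
  show "sq_integrable (\<lambda>x. indicator {- real n..real n} x *\<^sub>R f x)"
    by (rule sq_integrable_bound[OF int]) (auto simp: indicator_def)
  show "(\<lambda>n. abs_l2 (\<lambda>x. indicator {- real n..real n} x *\<^sub>R f x)) \<longlonglongrightarrow> abs_l2 f"
  proof (rule tendsto_abs_l2_dominated[OF _ _ int])
    show "AE x in lborel. (\<lambda>n. indicator {- real n..real n} x *\<^sub>R f x) \<longlonglongrightarrow> f x"
    proof (intro AE_I2 tendsto_eventually)
      fix x
      obtain N where "\<bar>x\<bar> \<le> real N" using real_arch_simple by blast
      then show "\<forall>\<^sub>F n in sequentially. indicator {- real n..real n} x *\<^sub>R f x = f x"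
        by (intro eventually_sequentiallyI[of N]) (auto simp: indicator_def)
    qed
  qed (auto simp: indicator_def)
qed

section \<open>Extension of the transform to L2 and its inversion\<close>

definition trunc :: "nat \<Rightarrow> complex l2 \<Rightarrow> real \<Rightarrow> complex" where
  "trunc n u x = indicator {- real n..real n} x *\<^sub>R rep_l2 u x"

lemma l12_trunc: "l12 (trunc n u)" and trunc_lim: "(\<lambda>n. abs_l2 (trunc n u)) \<longlonglongrightarrow> u"
  using truncation[OF sq_integrable_rep[of u]] by (auto simp: trunc_def[abs_def] l12_def)

text \<open>The complex-valued counterpart of \<open>fourier\<close>, introduced because modulation
  and inversion leave the real functions.\<close>

definition cft :: "complex l2 \<Rightarrow> complex l2" where
  "cft u = lim (\<lambda>n. abs_l2 (fti (trunc n u)))"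

text \<open>By Plancherel the transforms of two approximating sequences are as close as the
  sequences themselves, so the truncations in the definition can be replaced by any others.\<close>

lemma cft_lim:
  assumes G: "\<And>n. l12 (G n)" "(\<lambda>n. abs_l2 (G n)) \<longlonglongrightarrow> u"
  shows "(\<lambda>n. abs_l2 (fti (G n))) \<longlonglongrightarrow> cft u"
proof -
  let ?F = "\<lambda>n. abs_l2 (fti (trunc n u))"
  have "Cauchy ?F"
    using LIMSEQ_imp_Cauchy[OF trunc_lim[of u]]
    by (simp add: Cauchy_def dist_norm norm_fti_diff l12_trunc)
  then have 1: "?F \<longlonglongrightarrow> cft u"
    unfolding cft_def by (simp add: Cauchy_convergent_iff convergent_LIMSEQ_iff)
  have "(\<lambda>n. norm (abs_l2 (G n) - abs_l2 (trunc n u))) \<longlonglongrightarrow> norm (u - u)"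
    by (intro tendsto_norm tendsto_diff G trunc_lim)
  then have "(\<lambda>n. norm (abs_l2 (fti (G n)) - ?F n)) \<longlonglongrightarrow> 0"
    by (simp add: norm_fti_diff G l12_trunc)
  then have "(\<lambda>n. (abs_l2 (fti (G n)) - ?F n) + ?F n) \<longlonglongrightarrow> 0 + cft u"
    by (rule tendsto_add[OF tendsto_norm_zero_cancel 1])
  then show ?thesis by simp
qed

lemma cft_abs: "l12 G \<Longrightarrow> cft (abs_l2 G) = abs_l2 (fti G)"
  using cft_lim[of "\<lambda>_. G" "abs_l2 G"] LIMSEQ_unique[OF _ tendsto_const] by auto

lemma bounded_linear_cft: "bounded_linear cft" and norm_cft: "norm (cft u) = norm u"
proof -
  show n: "norm (cft u) = norm u" for u
  proof (rule LIMSEQ_unique)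
    show "(\<lambda>n. norm (abs_l2 (fti (trunc n u)))) \<longlonglongrightarrow> norm (cft u)"
      by (intro tendsto_norm cft_lim l12_trunc trunc_lim)
    show "(\<lambda>n. norm (abs_l2 (fti (trunc n u)))) \<longlonglongrightarrow> norm u"
      using tendsto_norm[OF trunc_lim[of u]] by (simp add: plancherel(2) l12_trunc)
  qed
  have sq: "sq_integrable (trunc n u)" for n u using l12_trunc[of n u] by (simp add: l12_def)
  show "bounded_linear cft"
  proof (rule bounded_linear_intro)
    fix u v :: "complex l2" and c :: real
    have "(\<lambda>n. abs_l2 (fti (\<lambda>x. trunc n u x + trunc n v x))) \<longlonglongrightarrow> cft (u + v)"
      using tendsto_add[OF trunc_lim[of u] trunc_lim[of v]]
      by (intro cft_lim l12_add l12_trunc) (simp add: abs_l2_add sq)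
    moreover have "(\<lambda>n. abs_l2 (fti (\<lambda>x. trunc n u x + trunc n v x))) \<longlonglongrightarrow> cft u + cft v"
      using tendsto_add[OF cft_lim[OF l12_trunc trunc_lim[of u]] cft_lim[OF l12_trunc trunc_lim[of v]]]
      by (simp add: fti_add l12_trunc abs_l2_add plancherel(1))
    ultimately show "cft (u + v) = cft u + cft v" by (rule LIMSEQ_unique)
    have "(\<lambda>n. abs_l2 (fti (\<lambda>x. c *\<^sub>R trunc n u x))) \<longlonglongrightarrow> cft (c *\<^sub>R u)"
      using tendsto_scaleR[OF tendsto_const trunc_lim[of u], of c]
      by (intro cft_lim l12_scaleR l12_trunc) (simp add: abs_l2_scaleR sq)
    moreover have "(\<lambda>n. abs_l2 (fti (\<lambda>x. c *\<^sub>R trunc n u x))) \<longlonglongrightarrow> c *\<^sub>R cft u"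
      using tendsto_scaleR[OF tendsto_const cft_lim[OF l12_trunc trunc_lim[of u]], of c]
      by (simp add: fti_scaleR l12_trunc abs_l2_scaleR plancherel(1))
    ultimately show "cft (c *\<^sub>R u) = c *\<^sub>R cft u" by (rule LIMSEQ_unique)
    show "norm (cft u) \<le> norm u * 1" by (simp add: n)
  qed
qed

lemma eq_on_l12:
  fixes A A' :: "complex l2 \<Rightarrow> 'b::real_normed_vector"
  assumes "bounded_linear A" "bounded_linear A'" and eq: "\<And>G. l12 G \<Longrightarrow> A (abs_l2 G) = A' (abs_l2 G)"
  shows "A u = A' u"
proof (rule LIMSEQ_unique)
  show "(\<lambda>n. A (abs_l2 (trunc n u))) \<longlonglongrightarrow> A u"
    by (rule bounded_linear.tendsto[OF assms(1) trunc_lim])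
  show "(\<lambda>n. A (abs_l2 (trunc n u))) \<longlonglongrightarrow> A' u"
    using bounded_linear.tendsto[OF assms(2) trunc_lim[of u]] by (simp add: eq l12_trunc)
qed

lemma inner_isometry:
  fixes W :: "'a::real_inner \<Rightarrow> 'b::real_inner"
  assumes "linear W" "\<And>u. norm (W u) = norm u"
  shows "inner (W u) (W v) = inner u v"
  using assms(2)[of "u + v"] by (simp add: dot_norm linear_add[OF assms(1)] assms(2) dot_norm[of "W u"])

lemma inner_abs_l2:
  "sq_integrable f \<Longrightarrow> sq_integrable g \<Longrightarrow> inner (abs_l2 f) (abs_l2 g) = (\<integral>x. f x \<bullet> g x \<partial>lborel)"
  by (intro inner_l2.abs_eq) (auto simp: l2_rel_def)

abbreviation cnj_l2 :: "complex l2 \<Rightarrow> complex l2" where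
  "cnj_l2 \<equiv> lift_l2 (\<lambda>f x. cnj (f x))"

text \<open>Conjugating before and after reverses the sign in the exponent of the Fourier kernel, so
  this is the inverse transform.\<close>

definition icft :: "complex l2 \<Rightarrow> complex l2" where
  "icft u = cnj_l2 (cft (cnj_l2 u))"

lemma bounded_linear_icft: "bounded_linear icft" and norm_icft: "norm (icft u) = norm u"
  unfolding icft_def
  by (intro bounded_linear_compose[OF lift_l2(2)[OF isometry_cnj]] bounded_linear_compose[OF bounded_linear_cft]
      lift_l2(2)[OF isometry_cnj]) (simp add: lift_l2(1)[OF isometry_cnj] norm_cft)

text \<open>On functions in both L1 and L2 this is the multiplication formula, which moves the
  transform from one factor to the other by Fubini. Density extends it first in \<open>u\<close>,
  then in \<open>v\<close>.\<close>

lemma inner_cft: "inner (cft u) v = inner u (icft v)"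
proof -
  have l12_cnj: "l12 (\<lambda>x. cnj (H x))" if "l12 H" for H
    using that isometry_cnj by (auto simp: l12_def l2_isometry_def)
  have 1: "inner (cft (abs_l2 G)) (abs_l2 H) = inner (abs_l2 G) (icft (abs_l2 H))" if G: "l12 G" and H: "l12 H" for G H
  proof -
    have iG: "integrable lborel G" and sG: "sq_integrable G" and iH: "integrable lborel H" and sH: "sq_integrable H"
      using G H by (auto simp: l12_def)
    note cH = l12_cnj[OF H]
    have iF: "integrable lborel (\<lambda>x. fti K x * L x)" if "l12 K" "l12 L" for K L
      using that by (intro integrable_bounded_mult[OF _ _ norm_fti_le]) (auto simp: l12_def)
    define s where "s = complex_of_real (sqrt (2 * pi))"
    have "(\<integral>\<xi>. fti G \<xi> * cnj (H \<xi>) \<partial>lborel) = (\<integral>\<xi>. cnj (H \<xi>) * (\<integral>x. cis (- (\<xi> * x)) * G x \<partial>lborel) \<partial>lborel) / s"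
      by (simp add: fti_def s_def mult.commute)
    also have "(\<integral>\<xi>. cnj (H \<xi>) * (\<integral>x. cis (- (\<xi> * x)) * G x \<partial>lborel) \<partial>lborel)
        = (\<integral>x. (\<integral>\<xi>. cis (- (\<xi> * x)) * cnj (H \<xi>) \<partial>lborel) * G x \<partial>lborel)"
      using cH by (intro fubini_kernel[OF _ iG, of _ _ 1]) (auto simp: l12_def)
    also have "\<dots> / s = (\<integral>x. fti (\<lambda>\<xi>. cnj (H \<xi>)) x * G x \<partial>lborel)"
      by (simp add: fti_def s_def mult.commute)
    finally have main: "(\<integral>\<xi>. fti G \<xi> * cnj (H \<xi>) \<partial>lborel) = (\<integral>x. fti (\<lambda>\<xi>. cnj (H \<xi>)) x * G x \<partial>lborel)" .
    have "inner (cft (abs_l2 G)) (abs_l2 H) = (\<integral>\<xi>. Re (fti G \<xi> * cnj (H \<xi>)) \<partial>lborel)"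
      by (simp add: cft_abs[OF G] inner_abs_l2 plancherel(1)[OF G] sH inner_complex_def)
    also have "\<dots> = Re (\<integral>\<xi>. fti G \<xi> * cnj (H \<xi>) \<partial>lborel)" by (rule integral_Re[OF iF[OF G cH]])
    also have "\<dots> = (\<integral>x. Re (fti (\<lambda>\<xi>. cnj (H \<xi>)) x * G x) \<partial>lborel)"
      unfolding main by (rule integral_Re[OF iF[OF cH G], symmetric])
    also have "\<dots> = inner (abs_l2 G) (abs_l2 (\<lambda>x. cnj (fti (\<lambda>\<xi>. cnj (H \<xi>)) x)))"
      using plancherel(1)[OF cH] isometry_cnj sG
      by (subst inner_abs_l2) (auto simp: l2_isometry_def inner_complex_def mult.commute)
    also have "abs_l2 (\<lambda>x. cnj (fti (\<lambda>\<xi>. cnj (H \<xi>)) x)) = icft (abs_l2 H)"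
      by (simp add: icft_def lift_l2(3)[OF isometry_cnj] sH cft_abs cH plancherel(1))
    finally show ?thesis .
  qed
  have 2: "inner (cft u) (abs_l2 H) = inner u (icft (abs_l2 H))" if H: "l12 H" for H u
    by (rule eq_on_l12[where A = "\<lambda>u. inner (cft u) (abs_l2 H)" and A' = "\<lambda>u. inner u (icft (abs_l2 H))"])
       (use 1 H in \<open>auto intro!: bounded_linear_inner_left bounded_linear_compose[OF bounded_linear_inner_left bounded_linear_cft]\<close>)
  show ?thesis
    by (rule eq_on_l12[where A = "\<lambda>v. inner (cft u) v" and A' = "\<lambda>v. inner u (icft v)"])
       (use 2 in \<open>auto intro!: bounded_linear_inner_right bounded_linear_compose[OF bounded_linear_inner_right bounded_linear_icft]\<close>)
qed

lemma eq_by_inner: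
  fixes a b :: "'a::real_inner"
  assumes "\<And>v. inner v a = inner v b" shows "a = b"
proof -
  have "inner (a - b) (a - b) = 0" using assms[of "a - b"] by (simp add: inner_diff_right)
  then show ?thesis by simp
qed

text \<open>An isometry composed with its adjoint gives the identity on one side; since the adjoint
  \<open>icft\<close> is isometric as well, the other side follows in the same way.\<close>

lemma icft_cft: "icft (cft u) = u" and cft_icft: "cft (icft u) = u"
proof -
  show "icft (cft u) = u"
    by (rule eq_by_inner)
       (simp add: inner_cft[symmetric] inner_isometry[OF bounded_linear.linear[OF bounded_linear_cft] norm_cft])
  show "cft (icft u) = u"
  proof (rule eq_by_inner)
    fix v
    have "inner v (cft (icft u)) = inner (icft u) (icft v)" by (simp add: inner_commute[of v] inner_cft)
    then show "inner v (cft (icft u)) = inner v u"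
      by (simp add: inner_isometry[OF bounded_linear.linear[OF bounded_linear_icft] norm_icft] inner_commute)
  qed
qed

lemma cft_modulate: "cft (lift_l2 (modulate a c) u) = lift_l2 (translate a c) (cft u)"
proof (rule eq_on_l12[where A = "\<lambda>u. cft (lift_l2 (modulate a c) u)" and A' = "\<lambda>u. lift_l2 (translate a c) (cft u)"])
  fix G assume G: "l12 G"
  have m: "l12 (modulate a c G)"
    using G isometry_modulate[of a c]
    by (auto simp: l12_def l2_isometry_def modulate_def[abs_def] intro!: integrable_bounded_mult[of _ _ 1])
  have "fti (modulate a c G) \<xi> = translate a c (fti G) \<xi>" for \<xi>
  proof -
    have eq: "cis (- (\<xi> * x)) * (cis (a * x + c) * G x) = cis c * (cis (- ((\<xi> - a) * x)) * G x)" for x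
    proof -
      have "- (\<xi> * x) + (a * x + c) = c + - ((\<xi> - a) * x)" by (simp add: algebra_simps)
      then show ?thesis by (simp only: mult.assoc[symmetric] cis_mult)
    qed
    show ?thesis unfolding fti_def modulate_def translate_def eq integral_mult_right_zero by simp
  qed
  then have "fti (modulate a c G) = translate a c (fti G)" by (rule ext)
  then show "cft (lift_l2 (modulate a c) (abs_l2 G)) = lift_l2 (translate a c) (cft (abs_l2 G))"
    using G m by (simp add: lift_l2(3)[OF isometry_modulate] lift_l2(3)[OF isometry_translate] cft_abs plancherel(1) l12_def)
qed (intro bounded_linear_compose[OF lift_l2(2)[OF isometry_translate] bounded_linear_cft]
      bounded_linear_compose[OF bounded_linear_cft lift_l2(2)[OF isometry_modulate]])+

lemma cft_cnj: "cft (cnj_l2 u) = lift_l2 (\<lambda>f x. cnj (f (- x))) (cft u)"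
proof (rule eq_on_l12[where A = "\<lambda>u. cft (cnj_l2 u)" and A' = "\<lambda>u. lift_l2 (\<lambda>f x. cnj (f (- x))) (cft u)"])
  fix G assume G: "l12 G"
  have m: "l12 (\<lambda>x. cnj (G x))"
    using G isometry_cnj by (auto simp: l12_def l2_isometry_def)
  have "fti (\<lambda>x. cnj (G x)) \<xi> = cnj (fti G (- \<xi>))" for \<xi>
    by (simp add: fti_def cis_cnj flip: Bochner_Integration.integral_cnj)
  then have "fti (\<lambda>x. cnj (G x)) = (\<lambda>\<xi>. cnj (fti G (- \<xi>)))" by (rule ext)
  then show "cft (cnj_l2 (abs_l2 G)) = lift_l2 (\<lambda>f x. cnj (f (- x))) (cft (abs_l2 G))"
    using G m by (simp add: lift_l2(3)[OF isometry_cnj] lift_l2(3)[OF isometry_cnj_reflect] cft_abs plancherel(1) l12_def)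
qed (intro bounded_linear_compose[OF lift_l2(2)[OF isometry_cnj_reflect] bounded_linear_cft]
      bounded_linear_compose[OF bounded_linear_cft lift_l2(2)[OF isometry_cnj]])+

section \<open>Transforms of real functions and Hermitian symmetry\<close>

abbreviation complex_l2 :: "real l2 \<Rightarrow> complex l2" where
  "complex_l2 \<equiv> lift_l2 (\<lambda>f x. complex_of_real (f x))"

text \<open>The truncations used to define \<open>fourier\<close>, regarded as complex functions,
  are an admissible sequence for \<open>cft_lim\<close>.\<close>

lemma fourier_eq_cft: "fourier u = cft (complex_l2 u)"
proof -
  define G where "G n x = complex_of_real (indicator {- real n..real n} x * rep_l2 u x)" for n x
  have sq: "sq_integrable (\<lambda>x. indicator {- real n..real n} x * rep_l2 u x)" for n
    using truncation(2)[OF sq_integrable_rep[of u], of n] by simp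
  have "l12 (G n)" for n
    using truncation(1)[OF sq_integrable_rep[of u], of n] isometry_of_real sq[of n]
    by (auto simp: l12_def G_def[abs_def] l2_isometry_def simp del: of_real_mult)
  moreover have "(\<lambda>n. abs_l2 (G n)) \<longlonglongrightarrow> complex_l2 u"
    using bounded_linear.tendsto[OF lift_l2(2)[OF isometry_of_real] truncation(3)[OF sq_integrable_rep[of u]]]
    by (simp add: lift_l2(3)[OF isometry_of_real sq] G_def[abs_def] del: of_real_mult)
  ultimately have "(\<lambda>n. abs_l2 (fti (G n))) \<longlonglongrightarrow> cft (complex_l2 u)" by (rule cft_lim)
  moreover have "fti (G n) = fourier_integral (\<lambda>x. indicator {- real n..real n} x * rep_l2 u x)" for n
    by (simp add: fun_eq_iff fti_def fourier_integral_def G_def)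
  ultimately show ?thesis unfolding fourier_def by (simp add: limI)
qed

lemma bounded_linear_fourier: "bounded_linear fourier" and norm_fourier: "norm (fourier u) = norm u"
  unfolding fourier_eq_cft[abs_def]
  by (intro bounded_linear_compose[OF bounded_linear_cft] lift_l2(2)[OF isometry_of_real])
     (simp add: norm_cft lift_l2(1)[OF isometry_of_real])

lemma inner_fourier: "inner (fourier u) (fourier v) = inner u v"
  by (rule inner_isometry[OF bounded_linear.linear[OF bounded_linear_fourier] norm_fourier])

lemma fourier_inject: "fourier u = fourier v \<longleftrightarrow> u = v"
  using norm_fourier[of "u - v"] linear_diff[OF bounded_linear.linear[OF bounded_linear_fourier], of u v] by auto

definition hermitian :: "(real \<Rightarrow> complex) \<Rightarrow> bool" where
  "hermitian F \<longleftrightarrow> (AE \<xi> in lborel. F (- \<xi>) = cnj (F \<xi>))"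

lemma hermitian_fourier: "hermitian (rep_l2 (fourier u))"
proof -
  have sc: "sq_integrable (\<lambda>x. complex_of_real (rep_l2 u x))"
    using isometry_of_real by (auto simp: l2_isometry_def)
  have "cnj_l2 (complex_l2 u) = complex_l2 u"
    using lift_l2(3)[OF isometry_cnj sc] by (simp add: lift_l2_def[of "\<lambda>f x. complex_of_real (f x)"])
  then have "lift_l2 (\<lambda>f x. cnj (f (- x))) (fourier u) = fourier u"
    using cft_cnj[of "complex_l2 u"] by (simp add: fourier_eq_cft)
  then have "abs_l2 (\<lambda>x. cnj (rep_l2 (fourier u) (- x))) = abs_l2 (rep_l2 (fourier u))"
    by (simp add: lift_l2_def)
  moreover have "sq_integrable (\<lambda>x. cnj (rep_l2 (fourier u) (- x)))"
    using isometry_cnj_reflect by (auto simp: l2_isometry_def)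
  ultimately have "AE x in lborel. cnj (rep_l2 (fourier u) (- x)) = rep_l2 (fourier u) x"
    by (subst (asm) abs_l2_eq_iff) auto
  then show ?thesis unfolding hermitian_def by eventually_elim (metis complex_cnj_cnj)
qed

text \<open>Hermitian symmetry of \<open>F\<close> says that conjugation fixes its inverse
  transform, which is therefore real almost everywhere. This is why the multipliers below may be
  defined on real functions by their symbols.\<close>

lemma fourier_surj:
  assumes F: "sq_integrable F" "hermitian F"
  shows "\<exists>u. AE \<xi> in lborel. rep_l2 (fourier u) \<xi> = F \<xi>"
proof -
  define v where "v = icft (abs_l2 F)"
  have "lift_l2 (\<lambda>f x. cnj (f (- x))) (abs_l2 F) = abs_l2 F"
  proof -
    have s: "sq_integrable (\<lambda>x. cnj (F (- x)))" using isometry_cnj_reflect F by (auto simp: l2_isometry_def)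
    show ?thesis
      unfolding lift_l2(3)[OF isometry_cnj_reflect F(1)] abs_l2_eq_iff[OF s F(1)]
      using F(2) unfolding hermitian_def by eventually_elim simp
  qed
  then have "cft (cnj_l2 v) = cft v" by (simp add: cft_cnj v_def cft_icft)
  then have "cnj_l2 v = v" by (metis icft_cft)
  then have "abs_l2 (\<lambda>x. cnj (rep_l2 v x)) = abs_l2 (rep_l2 v)" by (simp add: lift_l2_def)
  moreover have "sq_integrable (\<lambda>x. cnj (rep_l2 v x))" using isometry_cnj by (auto simp: l2_isometry_def)
  ultimately have "AE x in lborel. cnj (rep_l2 v x) = rep_l2 v x" by (subst (asm) abs_l2_eq_iff) auto
  then have ae: "AE x in lborel. complex_of_real (Re (rep_l2 v x)) = rep_l2 v x"
    by eventually_elim (metis complex_cnj_cancel_iff complex_is_Real_iff cnj.sel(2) neg_equal_zero of_real_Re)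
  have sr: "sq_integrable (\<lambda>x. Re (rep_l2 v x))"
  proof (rule sq_integrable_bound)
    show "integrable lborel (\<lambda>x. (norm (rep_l2 v x))\<^sup>2)" "(\<lambda>x. Re (rep_l2 v x)) \<in> borel_measurable lborel"
      using sq_integrable_rep[of v] by (auto simp: sq_integrable_def)
    show "AE x in lborel. (norm (Re (rep_l2 v x)))\<^sup>2 \<le> (norm (rep_l2 v x))\<^sup>2"
      by (intro AE_I2 power_mono abs_Re_le_cmod) (auto simp: abs_Re_le_cmod)
  qed
  define u where "u = abs_l2 (\<lambda>x. Re (rep_l2 v x))"
  have s: "sq_integrable (\<lambda>x. complex_of_real (Re (rep_l2 v x)))"
    using isometry_of_real sr by (auto simp: l2_isometry_def)
  have "complex_l2 u = v"
    using abs_l2_eq_iff[OF s sq_integrable_rep[of v]] ae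
    by (simp add: u_def lift_l2(3)[OF isometry_of_real sr])
  then have "fourier u = abs_l2 F" by (simp add: fourier_eq_cft v_def cft_icft)
  then show ?thesis using rep_abs_l2[OF F(1)] by (intro exI[of _ u]) simp
qed

section \<open>Fourier multipliers on Sobolev spaces\<close>

text \<open>Phrased with an arbitrary function \<open>F\<close>, so that identities between
  operators become pointwise identities between symbols, settled by
  \<open>has_ft_unique\<close>.\<close>

definition has_ft :: "real l2 \<Rightarrow> (real \<Rightarrow> complex) \<Rightarrow> bool" where
  "has_ft v F \<longleftrightarrow> (AE \<xi> in lborel. rep_l2 (fourier v) \<xi> = F \<xi>)"

text \<open>Follows the pattern of \<open>inv_helmholtz\<close>, to which it specialises; meaningful
  by \<open>has_ft_inv_ft\<close> for square integrable Hermitian symbols.\<close>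

definition inv_ft :: "(real \<Rightarrow> complex) \<Rightarrow> real l2" where
  "inv_ft F = (THE v. has_ft v F)"

lemma measurable_rep_l2 [measurable]: "rep_l2 u \<in> borel_measurable borel"
  using sq_integrable_rep[of u] by (simp add: sq_integrable_def)

lemma rep_l2_eqI:
  assumes "AE x in lborel. rep_l2 u x = rep_l2 v x" shows "u = v"
  using abs_l2_eq_iff[OF sq_integrable_rep[of u] sq_integrable_rep[of v]] assms by simp

lemma rep_l2_add: "AE x in lborel. rep_l2 (u + v) x = rep_l2 u x + rep_l2 v x"
  using rep_abs_l2[OF sq_integrable_add[OF sq_integrable_rep[of u] sq_integrable_rep[of v]]]
  by (simp add: abs_l2_add)

lemma rep_l2_scaleR: "AE x in lborel. rep_l2 (c *\<^sub>R u) x = c *\<^sub>R rep_l2 u x"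
  using rep_abs_l2[OF sq_integrable_scaleR[OF sq_integrable_rep[of u], of c]]
  by (simp add: abs_l2_scaleR)

lemma has_ft_rep: "has_ft v (rep_l2 (fourier v))"
  by (simp add: has_ft_def)

lemma has_ft_unique:
  assumes "has_ft v F" "has_ft w F" shows "v = w"
proof -
  have "AE \<xi> in lborel. rep_l2 (fourier v) \<xi> = rep_l2 (fourier w) \<xi>"
    using assms unfolding has_ft_def by eventually_elim simp
  then show ?thesis using rep_l2_eqI fourier_inject by blast
qed

lemma inv_ft_eq: "has_ft v F \<Longrightarrow> inv_ft F = v"
  unfolding inv_ft_def by (rule the_equality) (auto intro: has_ft_unique)

lemma has_ft_inv_ft:
  assumes "sq_integrable F" "hermitian F" shows "has_ft (inv_ft F) F"
proof -
  obtain v where "has_ft v F" using fourier_surj[OF assms] by (auto simp: has_ft_def)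
  then show ?thesis using inv_ft_eq by metis
qed

lemma has_ft_add:
  assumes "has_ft v F" "has_ft w G" shows "has_ft (v + w) (\<lambda>\<xi>. F \<xi> + G \<xi>)"
  using assms rep_l2_add[of "fourier v" "fourier w"]
  unfolding has_ft_def linear_add[OF bounded_linear.linear[OF bounded_linear_fourier]]
  by eventually_elim simp

lemma has_ft_scaleR:
  assumes "has_ft v F" shows "has_ft (c *\<^sub>R v) (\<lambda>\<xi>. c *\<^sub>R F \<xi>)"
  using assms rep_l2_scaleR[of c "fourier v"]
  unfolding has_ft_def linear_scale[OF bounded_linear.linear[OF bounded_linear_fourier]]
  by eventually_elim simp

lemma has_ft_cong:
  assumes "has_ft v F" "AE \<xi> in lborel. F \<xi> = G \<xi>" shows "has_ft v G"
  using assms unfolding has_ft_def by eventually_elim simp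

text \<open>Reflections preserve null sets. Needed wherever a convolution evaluates an almost
  everywhere defined symbol at \<open>\<xi> - \<eta>\<close>.\<close>

lemma AE_shift_reflect:
  assumes "AE x in lborel. P x" shows "AE x in lborel. P (a - x :: real)"
proof -
  obtain N where N: "N \<in> null_sets lborel" "{x. \<not> P x} \<subseteq> N"
    using assms by (auto elim!: AE_E2 simp: eventually_ae_filter)
  have [measurable]: "N \<in> sets borel" using N(1) by auto
  have "emeasure lborel N = ennreal \<bar>-1\<bar> * (\<integral>\<^sup>+x. indicator N (a + (-1) * x) \<partial>lborel)"
    using nn_integral_real_affine[of "indicator N" "-1" a] by simp
  then have "(\<integral>\<^sup>+x. indicator N (a - x) \<partial>lborel) = 0" using N(1) by auto
  then have "AE x in lborel. indicator N (a - x) = (0::ennreal)"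
    by (subst (asm) nn_integral_0_iff_AE) auto
  then show ?thesis by eventually_elim (use N(2) in \<open>auto simp: indicator_def split: if_splits\<close>)
qed

lemma has_ft_abs_l2:
  assumes "has_ft v F" "F \<in> borel_measurable borel"
  shows "sq_integrable F" "fourier v = abs_l2 F"
  using abs_l2_cong[OF sq_integrable_rep[of "fourier v"], of F] assms by (auto simp: has_ft_def)

lemma hermitian_mult:
  assumes "hermitian F" "\<And>\<xi>. m (- \<xi>) = cnj (m \<xi>)" shows "hermitian (\<lambda>\<xi>. m \<xi> * F \<xi>)"
  using assms(1) unfolding hermitian_def by eventually_elim (simp add: assms(2))

lemma sq_integrable_mult:
  fixes F m :: "real \<Rightarrow> complex"
  assumes F: "sq_integrable F" and m: "m \<in> borel_measurable borel" "\<And>\<xi>. cmod (m \<xi>) \<le> C"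
  shows "sq_integrable (\<lambda>\<xi>. m \<xi> * F \<xi>)"
proof (rule sq_integrable_bound)
  show "integrable lborel (\<lambda>\<xi>. C\<^sup>2 * (norm (F \<xi>))\<^sup>2)" using F by (simp add: sq_integrable_def)
  show "(\<lambda>\<xi>. m \<xi> * F \<xi>) \<in> borel_measurable lborel" using F m by (auto simp: sq_integrable_def)
  show "AE \<xi> in lborel. (norm (m \<xi> * F \<xi>))\<^sup>2 \<le> C\<^sup>2 * (norm (F \<xi>))\<^sup>2"
    using power_mono[OF m(2) norm_ge_zero, where n = 2] by (intro AE_I2) (simp add: norm_mult power_mult_distrib mult_right_mono)
qed

section \<open>Weights and Bessel potentials\<close>

definition wt :: "real \<Rightarrow> real \<Rightarrow> real" where
  "wt s \<xi> = (1 + \<xi>\<^sup>2) powr s"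

lemma one_plus_square_pos: "0 < 1 + \<xi>\<^sup>2" for \<xi> :: real
  using zero_le_power2[of \<xi>] by linarith

lemma wt_pos [simp]: "0 < wt s \<xi>"
  using one_plus_square_pos[of \<xi>] by (simp add: wt_def)

lemma wt_nonneg [simp]: "0 \<le> wt s \<xi>" by (rule less_imp_le[OF wt_pos])

lemma wt_minus [simp]: "wt s (- \<xi>) = wt s \<xi>" by (simp add: wt_def)

lemma wt_add: "wt (s + t) \<xi> = wt s \<xi> * wt t \<xi>" by (simp add: wt_def powr_add)

lemma wt_0 [simp]: "wt 0 \<xi> = 1" using one_plus_square_pos[of \<xi>] by (simp add: wt_def)

lemma wt_mult_inverse: "wt (- s) \<xi> * wt s \<xi> = 1" using wt_add[of "-s" s \<xi>] by simp

lemma wt_1: "wt 1 \<xi> = 1 + \<xi>\<^sup>2" using one_plus_square_pos[of \<xi>] by (simp add: wt_def)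

lemma wt_minus_1: "wt (- 1) \<xi> = inverse (1 + \<xi>\<^sup>2)"
  using wt_mult_inverse[of 1 \<xi>] by (simp add: wt_1 inverse_unique mult.commute)

lemma wt_square: "(wt s \<xi>)\<^sup>2 = wt (2 * s) \<xi>"
  using wt_add[of s s \<xi>] by (simp add: power2_eq_square)

lemma wt_le_1: "0 \<le> s \<Longrightarrow> wt (- s) \<xi> \<le> 1"
  using powr_mono[of "- s" 0 "1 + \<xi>\<^sup>2"] one_plus_square_pos[of \<xi>] by (simp add: wt_def)

lemma measurable_wt [measurable]: "wt s \<in> borel_measurable borel"
  unfolding wt_def[abs_def] by measurable

text \<open>Peetre's inequality: 1 + \<xi>^2 is at most twice the product of 1 + (\<xi> - \<eta>)^2
  and 1 + \<eta>^2, raised to the power \<open>s\<close>. It distributes an output weight over the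
  two factors of a convolution.\<close>

lemma wt_peetre:
  assumes "0 \<le> s" shows "wt (- s) (\<xi> - \<eta>) * wt (- s) \<eta> * wt s \<xi> \<le> 2 powr s"
proof -
  have "1 + \<xi>\<^sup>2 \<le> 2 * ((1 + (\<xi> - \<eta>)\<^sup>2) * (1 + \<eta>\<^sup>2))"
  proof -
    have "\<xi>\<^sup>2 \<le> 2 * (\<xi> - \<eta>)\<^sup>2 + 2 * \<eta>\<^sup>2" using norm_add_sq_le[of "\<xi> - \<eta>" \<eta>] by simp
    moreover have "0 \<le> (\<xi> - \<eta>)\<^sup>2 * \<eta>\<^sup>2" by simp
    moreover have "2 * ((1 + (\<xi> - \<eta>)\<^sup>2) * (1 + \<eta>\<^sup>2)) = 2 + 2 * (\<xi> - \<eta>)\<^sup>2 + 2 * \<eta>\<^sup>2 + 2 * ((\<xi> - \<eta>)\<^sup>2 * \<eta>\<^sup>2)"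
      by (simp only: distrib_left distrib_right)
    ultimately show ?thesis using zero_le_power2[of "\<xi> - \<eta>"] zero_le_power2[of \<eta>] by linarith
  qed
  then have "wt s \<xi> \<le> (2 * ((1 + (\<xi> - \<eta>)\<^sup>2) * (1 + \<eta>\<^sup>2))) powr s"
    unfolding wt_def using assms one_plus_square_pos[of \<xi>] by (intro powr_mono2) auto
  also have "\<dots> = 2 powr s * (wt s (\<xi> - \<eta>) * wt s \<eta>)"
    using one_plus_square_pos[of \<eta>] one_plus_square_pos[of "\<xi> - \<eta>"] by (simp add: wt_def powr_mult)
  finally have "wt (- s) (\<xi> - \<eta>) * wt (- s) \<eta> * wt s \<xi>
      \<le> wt (- s) (\<xi> - \<eta>) * wt (- s) \<eta> * (2 powr s * (wt s (\<xi> - \<eta>) * wt s \<eta>))"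
    by (intro mult_left_mono) auto
  also have "\<dots> = 2 powr s * (wt (- s) (\<xi> - \<eta>) * wt s (\<xi> - \<eta>)) * (wt (- s) \<eta> * wt s \<eta>)" by simp
  finally show ?thesis by (simp only: wt_mult_inverse)
qed

text \<open>
  The operator \<open>(1 - \<partial>\<^sub>x\<^sub>x)\<^bsup>-s/2\<^esup>\<close>. For \<open>s < 0\<close> the symbol need not be square integrable, and the value is
  then unspecified.
\<close>

definition bessel :: "real \<Rightarrow> real l2 \<Rightarrow> real l2" where
  "bessel s u = inv_ft (\<lambda>\<xi>. complex_of_real (wt (- s / 2) \<xi>) * rep_l2 (fourier u) \<xi>)"

lemma has_ft_bessel:
  assumes "0 \<le> s"
  shows "has_ft (bessel s u) (\<lambda>\<xi>. complex_of_real (wt (- s / 2) \<xi>) * rep_l2 (fourier u) \<xi>)"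
  unfolding bessel_def
proof (rule has_ft_inv_ft)
  show "sq_integrable (\<lambda>\<xi>. complex_of_real (wt (- s / 2) \<xi>) * rep_l2 (fourier u) \<xi>)"
    using assms wt_le_1[of "s / 2"] by (intro sq_integrable_mult[of _ _ 1]) auto
  show "hermitian (\<lambda>\<xi>. complex_of_real (wt (- s / 2) \<xi>) * rep_l2 (fourier u) \<xi>)"
    by (intro hermitian_mult hermitian_fourier) simp
qed

lemma has_ft_bessel':
  assumes s: "0 \<le> s" and u: "has_ft u F"
  shows "has_ft (bessel s u) (\<lambda>\<xi>. complex_of_real (wt (- s / 2) \<xi>) * F \<xi>)"
  by (rule has_ft_cong[OF has_ft_bessel[OF s, of u]])
     (use u in \<open>auto simp: has_ft_def elim: eventually_mono\<close>)

lemma norm_bessel_le: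
  assumes "0 \<le> s" shows "norm (bessel s u) \<le> norm u"
proof -
  let ?F = "\<lambda>\<xi>. complex_of_real (wt (- s / 2) \<xi>) * rep_l2 (fourier u) \<xi>"
  have m: "?F \<in> borel_measurable borel" by measurable
  note F = has_ft_abs_l2[OF has_ft_bessel[OF assms, of u] m]
  have "(norm (bessel s u))\<^sup>2 = (\<integral>\<xi>. (norm (?F \<xi>))\<^sup>2 \<partial>lborel)"
    using norm_abs_l2[OF F(1)] unfolding F(2)[symmetric] norm_fourier .
  also have "\<dots> \<le> (\<integral>\<xi>. (norm (rep_l2 (fourier u) \<xi>))\<^sup>2 \<partial>lborel)"
  proof (rule integral_mono)
    show "integrable lborel (\<lambda>\<xi>. (norm (?F \<xi>))\<^sup>2)" using F(1) by (simp add: sq_integrable_def)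
    show "integrable lborel (\<lambda>\<xi>. (norm (rep_l2 (fourier u) \<xi>))\<^sup>2)"
      using sq_integrable_rep[of "fourier u"] by (simp add: sq_integrable_def)
    show "(norm (?F \<xi>))\<^sup>2 \<le> (norm (rep_l2 (fourier u) \<xi>))\<^sup>2" for \<xi>
      using assms wt_le_1[of "s / 2" \<xi>] by (intro power_mono) (auto simp: norm_mult intro: mult_left_le_one_le)
  qed
  also have "\<dots> = (norm u)\<^sup>2" using norm_l2_sq[of "fourier u"] by (simp add: norm_fourier)
  finally show ?thesis by (rule power2_le_imp_le) simp
qed

lemma bounded_linear_bessel:
  assumes "0 \<le> s" shows "bounded_linear (bessel s)"
proof (rule bounded_linear_intro)
  show "bessel s (u + v) = bessel s u + bessel s v" for u v
  proof (rule has_ft_unique)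
    show "has_ft (bessel s (u + v)) (\<lambda>\<xi>. complex_of_real (wt (- s / 2) \<xi>) * (rep_l2 (fourier u) \<xi> + rep_l2 (fourier v) \<xi>))"
      by (intro has_ft_bessel' assms has_ft_add has_ft_rep)
    show "has_ft (bessel s u + bessel s v) (\<lambda>\<xi>. complex_of_real (wt (- s / 2) \<xi>) * (rep_l2 (fourier u) \<xi> + rep_l2 (fourier v) \<xi>))"
      unfolding distrib_left by (intro has_ft_bessel assms has_ft_add)
  qed
  show "bessel s (c *\<^sub>R u) = c *\<^sub>R bessel s u" for c u
  proof (rule has_ft_unique)
    show "has_ft (bessel s (c *\<^sub>R u)) (\<lambda>\<xi>. complex_of_real (wt (- s / 2) \<xi>) * (c *\<^sub>R rep_l2 (fourier u) \<xi>))"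
      by (intro has_ft_bessel' assms has_ft_scaleR has_ft_rep)
    show "has_ft (c *\<^sub>R bessel s u) (\<lambda>\<xi>. complex_of_real (wt (- s / 2) \<xi>) * (c *\<^sub>R rep_l2 (fourier u) \<xi>))"
      unfolding mult_scaleR_right by (intro has_ft_bessel assms has_ft_scaleR)
  qed
  show "norm (bessel s u) \<le> norm u * 1" for u using norm_bessel_le[OF assms, of u] by simp
qed

lemma bessel_0 [simp]: "bessel 0 u = u"
  by (rule has_ft_unique[OF has_ft_bessel has_ft_cong[OF has_ft_rep]]) auto

lemma bessel_bessel:
  assumes "0 \<le> s" "0 \<le> t" shows "bessel s (bessel t u) = bessel (s + t) u"
proof (rule has_ft_unique[OF has_ft_bessel'[OF assms(1) has_ft_bessel[OF assms(2)]]])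
  have "wt (- (s + t) / 2) \<xi> = wt (- s / 2) \<xi> * wt (- t / 2) \<xi>" for \<xi>
  proof -
    have "- (s + t) / 2 = - s / 2 + - t / 2" by (simp add: field_simps)
    then show ?thesis by (simp only: wt_add)
  qed
  then show "has_ft (bessel (s + t) u)
      (\<lambda>\<xi>. complex_of_real (wt (- s / 2) \<xi>) * (complex_of_real (wt (- t / 2) \<xi>) * rep_l2 (fourier u) \<xi>))"
    using has_ft_bessel[of "s + t" u] assms by (simp add: mult.assoc)
qed

lemma bessel_inject:
  assumes "0 \<le> s" shows "bessel s u = bessel s v \<longleftrightarrow> u = v"
proof
  assume "bessel s u = bessel s v"
  then have "has_ft (bessel s u) (\<lambda>\<xi>. complex_of_real (wt (- s / 2) \<xi>) * rep_l2 (fourier v) \<xi>)"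
    using has_ft_bessel[OF assms, of v] by simp
  with has_ft_bessel[OF assms, of u]
  have "AE \<xi> in lborel. rep_l2 (fourier u) \<xi> = rep_l2 (fourier v) \<xi>"
    unfolding has_ft_def by eventually_elim (use wt_pos in \<open>auto simp: less_imp_neq[symmetric]\<close>)
  then show "u = v" using rep_l2_eqI fourier_inject by blast
qed simp

text \<open>The Sobolev weight cancels the square of the Bessel symbol. Together with
  \<open>sobolev_bessel_ex\<close> this identifies H^l isometrically with L2.\<close>

lemma sobolev_bessel:
  assumes l: "0 \<le> l"
  shows "bessel l a \<in> sobolev l" "sobolev_norm l (bessel l a) = norm a"
proof -
  have ae: "AE \<xi> in lborel. (cmod (rep_l2 (fourier a) \<xi>))\<^sup>2
      = (1 + \<xi>\<^sup>2) powr l * (cmod (rep_l2 (fourier (bessel l a)) \<xi>))\<^sup>2"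
    using has_ft_bessel[OF l, of a] unfolding has_ft_def
  proof eventually_elim
    case (elim \<xi>)
    have "(1 + \<xi>\<^sup>2) powr l * (wt (- l / 2) \<xi>)\<^sup>2 = 1"
      unfolding wt_square using wt_mult_inverse[of l \<xi>] by (simp add: wt_def mult.commute)
    then show ?case by (simp add: elim norm_mult power_mult_distrib flip: mult.assoc)
  qed
  have *: "integrable lborel (\<lambda>\<xi>. (1 + \<xi>\<^sup>2) powr l * (cmod (rep_l2 (fourier (bessel l a)) \<xi>))\<^sup>2)
        \<longleftrightarrow> integrable lborel (\<lambda>\<xi>. (cmod (rep_l2 (fourier a) \<xi>))\<^sup>2)"
    "(\<integral>\<xi>. (1 + \<xi>\<^sup>2) powr l * (cmod (rep_l2 (fourier (bessel l a)) \<xi>))\<^sup>2 \<partial>lborel)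
        = (\<integral>\<xi>. (cmod (rep_l2 (fourier a) \<xi>))\<^sup>2 \<partial>lborel)"
    using integrable_cong_AE[OF _ _ ae] integral_cong_AE[OF _ _ ae] by simp_all
  show "bessel l a \<in> sobolev l"
    using * sq_integrable_rep[of "fourier a"] by (simp add: sobolev_def sq_integrable_def)
  have "(\<integral>\<xi>. (cmod (rep_l2 (fourier a) \<xi>))\<^sup>2 \<partial>lborel) = (norm a)\<^sup>2"
    using norm_l2_sq[of "fourier a"] by (simp add: norm_fourier)
  then show "sobolev_norm l (bessel l a) = norm a" by (simp add: sobolev_norm_def *(2))
qed

text \<open>Membership in H^l is exactly square integrability of the transform weighted by
  \<open>wt (l / 2)\<close>; that weight is real and even, so the product stays Hermitian and is the
  transform of a real function.\<close>

lemma sobolev_bessel_ex: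
  assumes l: "0 \<le> l" and u: "u \<in> sobolev l" shows "\<exists>a. u = bessel l a"
proof -
  let ?F = "\<lambda>\<xi>. complex_of_real (wt (l / 2) \<xi>) * rep_l2 (fourier u) \<xi>"
  have "has_ft (inv_ft ?F) ?F"
  proof (rule has_ft_inv_ft)
    have "(norm (?F \<xi>))\<^sup>2 = (1 + \<xi>\<^sup>2) powr l * (cmod (rep_l2 (fourier u) \<xi>))\<^sup>2" for \<xi>
      using wt_square[of "l / 2" \<xi>] by (simp add: norm_mult power_mult_distrib wt_def)
    then show "sq_integrable ?F" using u by (simp add: sq_integrable_def sobolev_def)
    show "hermitian ?F" by (intro hermitian_mult hermitian_fourier) simp
  qed
  from has_ft_bessel'[OF l this]
  have "has_ft (bessel l (inv_ft ?F)) (\<lambda>\<xi>. complex_of_real (wt (- l / 2) \<xi>) * ?F \<xi>)" .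
  moreover have "complex_of_real (wt (- l / 2) \<xi>) * ?F \<xi> = rep_l2 (fourier u) \<xi>" for \<xi>
  proof -
    have "complex_of_real (wt (- l / 2) \<xi>) * complex_of_real (wt (l / 2) \<xi>) = 1"
      using wt_mult_inverse[of "l / 2" \<xi>] by (simp flip: of_real_mult)
    then show ?thesis by (simp only: mult.assoc[symmetric] mult_1_left)
  qed
  ultimately have "has_ft (bessel l (inv_ft ?F)) (rep_l2 (fourier u))" by (simp only:)
  then show ?thesis using has_ft_unique has_ft_rep by blast
qed

lemma fourier_tendsto_cancel:
  assumes "(\<lambda>n. fourier (c n)) \<longlonglongrightarrow> fourier c'" shows "c \<longlonglongrightarrow> c'"
proof -
  have "(\<lambda>n. norm (fourier (c n) - fourier c')) \<longlonglongrightarrow> 0" using assms by (simp add: tendsto_norm_zero_iff Lim_null[symmetric])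
  then have "(\<lambda>n. norm (c n - c')) \<longlonglongrightarrow> 0"
    by (simp add: norm_fourier flip: linear_diff[OF bounded_linear.linear[OF bounded_linear_fourier]])
  then show ?thesis by (simp add: tendsto_norm_zero_iff Lim_null[symmetric])
qed

text \<open>On a bounded frequency band the inverse weight is bounded, so every band-limited
  truncation of \<open>a\<close> has a preimage; the truncations converge to
  \<open>a\<close>.\<close>

lemma bessel_dense:
  assumes s: "0 \<le> s" and e: "0 < e" shows "\<exists>c. norm (a - bessel s c) \<le> e"
proof -
  let ?I = "\<lambda>n \<xi>. complex_of_real (indicator {- real n..real n} \<xi>)"
  define F where "F n \<xi> = (?I n \<xi> * complex_of_real (wt (s / 2) \<xi>)) * rep_l2 (fourier a) \<xi>" for n \<xi>
  have ft: "has_ft (inv_ft (F n)) (F n)" for n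
  proof (rule has_ft_inv_ft)
    have "wt (s / 2) \<xi> \<le> (1 + (real n)\<^sup>2) powr (s / 2)" if "\<bar>\<xi>\<bar> \<le> real n" for \<xi>
      unfolding wt_def using s that one_plus_square_pos[of \<xi>]
      by (intro powr_mono2) (auto simp: abs_le_square_iff[symmetric])
    then show "sq_integrable (F n)"
      unfolding F_def
      by (intro sq_integrable_mult[of _ _ "(1 + (real n)\<^sup>2) powr (s / 2)"]) (auto simp: norm_mult indicator_def)
    show "hermitian (F n)"
      unfolding F_def by (intro hermitian_mult hermitian_fourier) (auto simp: indicator_def)
  qed
  define c where "c n = bessel s (inv_ft (F n))" for n
  define G where "G n \<xi> = indicator {- real n..real n} \<xi> *\<^sub>R rep_l2 (fourier a) \<xi>" for n \<xi>
  have "has_ft (c n) (G n)" for n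
  proof -
    have "complex_of_real (wt (- s / 2) \<xi>) * F n \<xi> = G n \<xi>" for \<xi>
      using wt_mult_inverse[of "s / 2" \<xi>]
      by (auto simp: F_def G_def indicator_def mult.assoc[symmetric] simp flip: of_real_mult)
    then show ?thesis using has_ft_bessel'[OF s ft[of n]] by (simp add: c_def)
  qed
  moreover have "G n \<in> borel_measurable borel" for n unfolding G_def by measurable
  ultimately have "fourier (c n) = abs_l2 (G n)" for n by (rule has_ft_abs_l2)
  then have "(\<lambda>n. fourier (c n)) \<longlonglongrightarrow> fourier a"
    using truncation(3)[OF sq_integrable_rep[of "fourier a"]] by (simp add: G_def[abs_def])
  then have "c \<longlonglongrightarrow> a" by (rule fourier_tendsto_cancel)
  then obtain n where "norm (c n - a) < e" using LIMSEQ_D[OF _ e] by blast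
  then show ?thesis unfolding c_def by (metis less_imp_le norm_minus_commute)
qed

section \<open>The bilinear operators of the equation\<close>

definition ft_prod :: "real l2 \<Rightarrow> real l2 \<Rightarrow> real \<Rightarrow> complex" where
  "ft_prod a b = fourier_integral (\<lambda>x. rep_l2 a x * rep_l2 b x)"

lemma integrable_mult_l2:
  fixes f g :: "real \<Rightarrow> 'a::{real_normed_algebra, euclidean_space}"
  assumes f: "sq_integrable f" and g: "sq_integrable g" shows "integrable lborel (\<lambda>x. f x * g x)"
proof (rule Bochner_Integration.integrable_bound)
  show "integrable lborel (\<lambda>x. (norm (f x))\<^sup>2 + (norm (g x))\<^sup>2)" using f g by (auto simp: sq_integrable_def)
  show "(\<lambda>x. f x * g x) \<in> borel_measurable lborel" using f g by (auto simp: sq_integrable_def)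
  have "norm a * norm b \<le> (norm a)\<^sup>2 + (norm b)\<^sup>2" for a b :: 'a
    using sum_squares_bound[of "norm a" "norm b"] mult_nonneg_nonneg[OF norm_ge_zero[of a] norm_ge_zero[of b]]
    by linarith
  then show "AE x in lborel. norm (f x * g x) \<le> norm ((norm (f x))\<^sup>2 + (norm (g x))\<^sup>2)"
    by (intro AE_I2) (simp add: order_trans[OF norm_mult_ineq])
qed

lemma fourier_integral_eq_fti: "fourier_integral g = fti (\<lambda>x. complex_of_real (g x))"
  by (simp add: fun_eq_iff fourier_integral_def fti_def)

lemma ft_prod_eq_fti: "ft_prod a b = fti (\<lambda>x. complex_of_real (rep_l2 a x * rep_l2 b x))"
  by (simp add: ft_prod_def fourier_integral_eq_fti del: of_real_mult)

lemma integrable_ft_prod: "integrable lborel (\<lambda>x. complex_of_real (rep_l2 a x * rep_l2 b x))"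
  by (intro integrable_of_real integrable_mult_l2) auto

lemma measurable_ft_prod [measurable]: "ft_prod a b \<in> borel_measurable borel"
  unfolding ft_prod_eq_fti by measurable

lemma ft_prod_sym: "ft_prod a b = ft_prod b a"
  by (simp add: ft_prod_def mult.commute)

lemma ft_prod_minus: "ft_prod a b (- \<xi>) = cnj (ft_prod a b \<xi>)"
  by (simp add: ft_prod_eq_fti fti_def cis_cnj flip: Bochner_Integration.integral_cnj)

lemma ft_prod_add: "ft_prod (a + a') b \<xi> = ft_prod a b \<xi> + ft_prod a' b \<xi>"
proof -
  let ?p = "\<lambda>a x. complex_of_real (rep_l2 a x * rep_l2 b x)"
  have "(\<integral>x. cis (- (\<xi> * x)) * ?p (a + a') x \<partial>lborel) = (\<integral>x. cis (- (\<xi> * x)) * ?p a x + cis (- (\<xi> * x)) * ?p a' x \<partial>lborel)"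
  proof (rule integral_cong_AE)
    show "AE x in lborel. cis (- (\<xi> * x)) * ?p (a + a') x = cis (- (\<xi> * x)) * ?p a x + cis (- (\<xi> * x)) * ?p a' x"
      using rep_l2_add[of a a'] by eventually_elim (simp add: algebra_simps)
  qed measurable
  also have "\<dots> = (\<integral>x. cis (- (\<xi> * x)) * ?p a x \<partial>lborel) + (\<integral>x. cis (- (\<xi> * x)) * ?p a' x \<partial>lborel)"
    by (intro Bochner_Integration.integral_add integrable_fti integrable_ft_prod)
  finally show ?thesis by (simp add: ft_prod_eq_fti fti_def add_divide_distrib del: of_real_mult)
qed

lemma ft_prod_scaleR: "ft_prod (c *\<^sub>R a) b \<xi> = c *\<^sub>R ft_prod a b \<xi>"
proof -
  let ?p = "\<lambda>a x. complex_of_real (rep_l2 a x * rep_l2 b x)"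
  have "(\<integral>x. cis (- (\<xi> * x)) * ?p (c *\<^sub>R a) x \<partial>lborel) = (\<integral>x. complex_of_real c * (cis (- (\<xi> * x)) * ?p a x) \<partial>lborel)"
  proof (rule integral_cong_AE)
    show "AE x in lborel. cis (- (\<xi> * x)) * ?p (c *\<^sub>R a) x = complex_of_real c * (cis (- (\<xi> * x)) * ?p a x)"
      using rep_l2_scaleR[of c a] by eventually_elim (simp add: mult_ac)
  qed measurable
  also have "\<dots> = complex_of_real c * (\<integral>x. cis (- (\<xi> * x)) * ?p a x \<partial>lborel)" by (rule integral_mult_right_zero)
  finally show ?thesis by (simp add: ft_prod_eq_fti fti_def scaleR_conv_of_real del: of_real_mult)
qed

lemma sq_integrable_shift_reflect:
  fixes f :: "real \<Rightarrow> complex"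
  assumes "sq_integrable f" shows "sq_integrable (\<lambda>\<eta>. f (\<xi> - \<eta>))"
proof -
  have [measurable]: "f \<in> borel_measurable borel" using assms by (simp add: sq_integrable_def)
  show ?thesis
    using lborel_integrable_real_affine[of "\<lambda>\<eta>. (norm (f \<eta>))\<^sup>2" "-1" \<xi>] assms
    by (simp add: sq_integrable_def)
qed

text \<open>The integral defining \<open>ft_prod a b \<xi>\<close> pairs \<open>b\<close> with the
  modulation of \<open>a\<close> by \<xi>. The transform is isometric and turns modulation into
  translation, and Hermitian symmetry converts the conjugated translate of the transform of
  \<open>a\<close> into its value at \<open>\<xi> - \<eta>\<close>.\<close>

lemma ft_prod_convolution:
  "ft_prod a b \<xi> = (\<integral>\<eta>. rep_l2 (fourier a) (\<xi> - \<eta>) * rep_l2 (fourier b) \<eta> \<partial>lborel) / complex_of_real (sqrt (2 * pi))"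
proof -
  let ?A = "rep_l2 (fourier a)" and ?B = "rep_l2 (fourier b)"
  define X where "X = (\<integral>x. cis (- (\<xi> * x)) * complex_of_real (rep_l2 a x * rep_l2 b x) \<partial>lborel)"
  define Y where "Y = (\<integral>\<eta>. ?A (\<xi> - \<eta>) * ?B \<eta> \<partial>lborel)"
  have sr: "sq_integrable (\<lambda>x. complex_of_real (rep_l2 a x))" for a
    using isometry_of_real by (auto simp: l2_isometry_def)
  have Xi: "integrable lborel (\<lambda>x. cis (- (\<xi> * x)) * complex_of_real (rep_l2 a x * rep_l2 b x))"
    by (rule integrable_fti[OF integrable_ft_prod])
  have Yi: "integrable lborel (\<lambda>\<eta>. ?A (\<xi> - \<eta>) * ?B \<eta>)"
    by (intro integrable_mult_l2 sq_integrable_shift_reflect sq_integrable_rep)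
  have "Re (cis (- c) * X) = Re (cis (- c) * Y)" for c
  proof -
    have m: "sq_integrable (modulate \<xi> c (\<lambda>x. complex_of_real (rep_l2 a x)))"
      using isometry_modulate[of \<xi> c] sr[of a] by (simp add: l2_isometry_def)
    have t: "sq_integrable (translate \<xi> c ?A)"
      using isometry_translate[of \<xi> c] by (simp add: l2_isometry_def)
    have "inner (lift_l2 (modulate \<xi> c) (complex_l2 a)) (complex_l2 b)
        = (\<integral>x. modulate \<xi> c (\<lambda>x. complex_of_real (rep_l2 a x)) x \<bullet> complex_of_real (rep_l2 b x) \<partial>lborel)"
      using inner_abs_l2[OF m sr[of b]] lift_l2(3)[OF isometry_modulate sr[of a]]
      by (simp add: lift_l2_def[of "\<lambda>f x. complex_of_real (f x)"])
    also have "\<dots> = (\<integral>x. Re (cis (- c) * (cis (- (\<xi> * x)) * complex_of_real (rep_l2 a x * rep_l2 b x))) \<partial>lborel)"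
    proof (intro Bochner_Integration.integral_cong refl)
      fix x
      have "cis (- c) * (cis (- (\<xi> * x)) * complex_of_real (rep_l2 a x * rep_l2 b x))
          = cnj (cis (\<xi> * x + c)) * complex_of_real (rep_l2 a x * rep_l2 b x)"
      proof -
        have "cis (- c) * cis (- (\<xi> * x)) = cnj (cis (\<xi> * x + c))"
          unfolding cis_mult cis_cnj by (rule arg_cong[of _ _ cis]) simp
        then show ?thesis by (simp only: mult.assoc[symmetric])
      qed
      then show "modulate \<xi> c (\<lambda>x. complex_of_real (rep_l2 a x)) x \<bullet> complex_of_real (rep_l2 b x)
          = Re (cis (- c) * (cis (- (\<xi> * x)) * complex_of_real (rep_l2 a x * rep_l2 b x)))"
        by (simp only:) (simp add: modulate_def inner_complex_def)
    qed
    also have "\<dots> = Re (cis (- c) * X)"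
      unfolding X_def using Xi by (subst integral_Re) auto
    finally have 1: "inner (lift_l2 (modulate \<xi> c) (complex_l2 a)) (complex_l2 b) = Re (cis (- c) * X)" .
    have "inner (lift_l2 (modulate \<xi> c) (complex_l2 a)) (complex_l2 b)
        = inner (lift_l2 (translate \<xi> c) (fourier a)) (fourier b)"
      unfolding fourier_eq_cft cft_modulate[symmetric]
      by (rule inner_isometry[OF bounded_linear.linear[OF bounded_linear_cft] norm_cft, symmetric])
    also have "\<dots> = (\<integral>\<eta>. translate \<xi> c ?A \<eta> \<bullet> ?B \<eta> \<partial>lborel)"
      using inner_abs_l2[OF t sq_integrable_rep[of "fourier b"]] by (simp add: lift_l2_def[of "translate _ _"])
    also have "\<dots> = (\<integral>\<eta>. Re (cis (- c) * (?A (\<xi> - \<eta>) * ?B \<eta>)) \<partial>lborel)"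
    proof (rule integral_cong_AE)
      have "AE \<eta> in lborel. ?A (- (\<xi> - \<eta>)) = cnj (?A (\<xi> - \<eta>))"
        using AE_shift_reflect[OF hermitian_fourier[unfolded hermitian_def, of a], of \<xi>] by simp
      then show "AE \<eta> in lborel. translate \<xi> c ?A \<eta> \<bullet> ?B \<eta> = Re (cis (- c) * (?A (\<xi> - \<eta>) * ?B \<eta>))"
      proof eventually_elim
        case (elim \<eta>)
        have "translate \<xi> c ?A \<eta> \<bullet> ?B \<eta> = Re (cnj (translate \<xi> c ?A \<eta>) * ?B \<eta>)"
          by (simp add: inner_complex_def)
        also have "cnj (translate \<xi> c ?A \<eta>) = cis (- c) * ?A (\<xi> - \<eta>)"
          using elim by (simp add: translate_def cis_cnj)
        finally show ?case by (simp add: mult.assoc)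
      qed
      show "(\<lambda>\<eta>. translate \<xi> c ?A \<eta> \<bullet> ?B \<eta>) \<in> borel_measurable lborel"
        unfolding translate_def by measurable
    qed measurable
    also have "\<dots> = Re (cis (- c) * Y)"
      unfolding Y_def using Yi by (subst integral_Re) auto
    finally show ?thesis using 1 by simp
  qed
  \<comment> \<open>The phases 0 and pi/2 give equality of the real and of the imaginary
    parts.\<close>
  from this[of 0] this[of "pi / 2"] have "X = Y" by (simp add: complex_eq_iff)
  then show ?thesis by (simp add: X_def Y_def ft_prod_eq_fti fti_def del: of_real_mult)
qed

text \<open>
  The Fourier transform of \<open>(1 - \<partial>\<^sub>x\<^sub>x)\<^bsup>s/2\<^esup> (1 - \<partial>\<^sub>x\<^sub>x)\<^sup>-\<^sup>1 (- 1/2 \<partial>\<^sub>x (J\<^sub>p a J\<^sub>q b))\<close>, where \<open>J\<^sub>p\<close> stands for \<open>bessel p\<close>.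
\<close>

definition bil_symbol :: "real \<Rightarrow> real \<Rightarrow> real \<Rightarrow> real l2 \<Rightarrow> real l2 \<Rightarrow> real \<Rightarrow> complex" where
  "bil_symbol s p q a b \<xi> = complex_of_real (wt (s / 2 - 1) \<xi>) *
     (- (1 / 2) * (\<i> * complex_of_real \<xi>) * ft_prod (bessel p a) (bessel q b) \<xi>)"

definition bil :: "real \<Rightarrow> real \<Rightarrow> real \<Rightarrow> real l2 \<Rightarrow> real l2 \<Rightarrow> real l2" where
  "bil s p q a b = inv_ft (bil_symbol s p q a b)"

text \<open>The nonnegative integral makes square integrability of the symbol part of the condition.
  The constant 1 becomes \<open>K\<close> = 1 for the abstract equation.\<close>

definition bil_bounded :: "real \<Rightarrow> real \<Rightarrow> real \<Rightarrow> bool" where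
  "bil_bounded s p q \<longleftrightarrow> 0 \<le> p \<and> 0 \<le> q \<and>
     (\<forall>a b. (\<integral>\<^sup>+\<xi>. ennreal ((cmod (bil_symbol s p q a b \<xi>))\<^sup>2) \<partial>lborel) \<le> ennreal ((norm a * norm b)\<^sup>2))"

lemma measurable_bil_symbol [measurable]: "bil_symbol s p q a b \<in> borel_measurable borel"
  unfolding bil_symbol_def[abs_def] by measurable

lemma has_ft_bil:
  assumes "bil_bounded s p q"
  shows "has_ft (bil s p q a b) (bil_symbol s p q a b)" "norm (bil s p q a b) \<le> norm a * norm b"
proof -
  let ?S = "bil_symbol s p q a b"
  have le: "(\<integral>\<^sup>+\<xi>. ennreal ((cmod (?S \<xi>))\<^sup>2) \<partial>lborel) \<le> ennreal ((norm a * norm b)\<^sup>2)"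
    using assms by (simp add: bil_bounded_def)
  also have "\<dots> < \<infinity>" by simp
  finally have int: "integrable lborel (\<lambda>\<xi>. (cmod (?S \<xi>))\<^sup>2)"
    by (intro integrableI_bounded) auto
  have h: "hermitian ?S"
    unfolding hermitian_def bil_symbol_def by (simp add: ft_prod_minus)
  show ft: "has_ft (bil s p q a b) ?S"
    unfolding bil_def by (rule has_ft_inv_ft[OF _ h]) (use int in \<open>simp add: sq_integrable_def\<close>)
  have F: "sq_integrable ?S" "fourier (bil s p q a b) = abs_l2 ?S"
    by (rule has_ft_abs_l2[OF ft], simp)+
  have "ennreal ((norm (bil s p q a b))\<^sup>2) = ennreal (\<integral>\<xi>. (cmod (?S \<xi>))\<^sup>2 \<partial>lborel)"
    using norm_abs_l2[OF F(1)] unfolding F(2)[symmetric] norm_fourier by simp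
  also have "\<dots> = (\<integral>\<^sup>+\<xi>. ennreal ((cmod (?S \<xi>))\<^sup>2) \<partial>lborel)"
    by (rule nn_integral_eq_integral[OF int, symmetric]) simp
  finally have "ennreal ((norm (bil s p q a b))\<^sup>2) \<le> ennreal ((norm a * norm b)\<^sup>2)" using le by simp
  then have "(norm (bil s p q a b))\<^sup>2 \<le> (norm a * norm b)\<^sup>2" by (simp add: ennreal_le_iff)
  then show "norm (bil s p q a b) \<le> norm a * norm b" by (rule power2_le_imp_le) simp
qed

lemma bounded_bilinear_bil:
  assumes b: "bil_bounded s p q" shows "bounded_bilinear (bil s p q)"
proof -
  have pq: "0 \<le> p" "0 \<le> q" using b by (auto simp: bil_bounded_def)
  note lin = linear_add[OF bounded_linear.linear[OF bounded_linear_bessel]]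
    linear_scale[OF bounded_linear.linear[OF bounded_linear_bessel]]
  have addl: "bil s p q (a + a') c = bil s p q a c + bil s p q a' c" for a a' c
  proof (rule has_ft_unique[OF has_ft_bil(1)[OF b]])
    have "bil_symbol s p q (a + a') c = (\<lambda>\<xi>. bil_symbol s p q a c \<xi> + bil_symbol s p q a' c \<xi>)"
      by (simp add: fun_eq_iff bil_symbol_def lin[OF pq(1)] ft_prod_add algebra_simps)
    then show "has_ft (bil s p q a c + bil s p q a' c) (bil_symbol s p q (a + a') c)"
      by (simp only:) (intro has_ft_add has_ft_bil(1) b)
  qed
  have addr: "bil s p q c (a + a') = bil s p q c a + bil s p q c a'" for a a' c
  proof (rule has_ft_unique[OF has_ft_bil(1)[OF b]])
    have "bil_symbol s p q c (a + a') = (\<lambda>\<xi>. bil_symbol s p q c a \<xi> + bil_symbol s p q c a' \<xi>)"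
      by (simp add: fun_eq_iff bil_symbol_def lin[OF pq(2)] ft_prod_sym[of "bessel p c"] ft_prod_add algebra_simps)
    then show "has_ft (bil s p q c a + bil s p q c a') (bil_symbol s p q c (a + a'))"
      by (simp only:) (intro has_ft_add has_ft_bil(1) b)
  qed
  have scl: "bil s p q (r *\<^sub>R a) c = r *\<^sub>R bil s p q a c" for a c r
  proof (rule has_ft_unique[OF has_ft_bil(1)[OF b]])
    have "bil_symbol s p q (r *\<^sub>R a) c = (\<lambda>\<xi>. r *\<^sub>R bil_symbol s p q a c \<xi>)"
      by (simp add: fun_eq_iff bil_symbol_def lin[OF pq(1)] ft_prod_scaleR)
    then show "has_ft (r *\<^sub>R bil s p q a c) (bil_symbol s p q (r *\<^sub>R a) c)"
      by (simp only:) (intro has_ft_scaleR has_ft_bil(1) b)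
  qed
  have scr: "bil s p q c (r *\<^sub>R a) = r *\<^sub>R bil s p q c a" for a c r
  proof (rule has_ft_unique[OF has_ft_bil(1)[OF b]])
    have "bil_symbol s p q c (r *\<^sub>R a) = (\<lambda>\<xi>. r *\<^sub>R bil_symbol s p q c a \<xi>)"
      by (simp add: fun_eq_iff bil_symbol_def lin[OF pq(2)] ft_prod_sym[of "bessel p c"] ft_prod_scaleR)
    then show "has_ft (r *\<^sub>R bil s p q c a) (bil_symbol s p q c (r *\<^sub>R a))"
      by (simp only:) (intro has_ft_scaleR has_ft_bil(1) b)
  qed
  show ?thesis
    using has_ft_bil(2)[OF b]
    by (intro bounded_bilinear.intro) (auto simp: addl addr scl scr intro!: exI[of _ 1])
qed

section \<open>Boundedness of the bilinear operators\<close>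

lemma nn_integral_shift_reflect:
  fixes f :: "real \<Rightarrow> ennreal"
  assumes "f \<in> borel_measurable borel"
  shows "(\<integral>\<^sup>+\<eta>. f (\<xi> - \<eta>) \<partial>lborel) = (\<integral>\<^sup>+\<eta>. f \<eta> \<partial>lborel)"
  using nn_integral_real_affine[of f "-1" \<xi>] assms by simp

lemma nn_integral_fourier: "(\<integral>\<^sup>+\<eta>. ennreal ((cmod (rep_l2 (fourier a) \<eta>))\<^sup>2) \<partial>lborel) = ennreal ((norm a)\<^sup>2)"
proof -
  have "(\<integral>\<^sup>+\<eta>. ennreal ((cmod (rep_l2 (fourier a) \<eta>))\<^sup>2) \<partial>lborel) = ennreal (\<integral>\<eta>. (cmod (rep_l2 (fourier a) \<eta>))\<^sup>2 \<partial>lborel)"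
    using sq_integrable_rep[of "fourier a"] by (intro nn_integral_eq_integral) (auto simp: sq_integrable_def)
  also have "\<dots> = ennreal ((norm a)\<^sup>2)" using norm_l2_sq[of "fourier a"] by (simp add: norm_fourier)
  finally show ?thesis .
qed

lemma nn_integral_wt_minus_1: "(\<integral>\<^sup>+\<eta>. ennreal (wt (- 1) \<eta>) \<partial>lborel) = ennreal pi"
proof -
  have i: "integrable lborel (\<lambda>x::real. inverse (1 + x\<^sup>2))"
    using integrable_inverse_1_plus_square by (simp add: set_integrable_def)
  have "(\<integral>x. inverse (1 + x\<^sup>2) \<partial>lborel) = pi"
    using LBINT_inverse_1_plus_square
    by (simp add: interval_lebesgue_integral_def set_lebesgue_integral_def)
  then show ?thesis
    unfolding wt_minus_1 by (subst nn_integral_eq_integral[OF i]) auto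
qed

text \<open>The convolution theorem with moduli taken inside, which exposes the Bessel weights. The
  nonnegative integral makes Cauchy-Schwarz applicable without integrability conditions.\<close>

lemma ft_prod_bessel_bound:
  assumes "0 \<le> p" "0 \<le> q"
  shows "ennreal (sqrt (2 * pi) * cmod (ft_prod (bessel p a) (bessel q b) \<xi>))
    \<le> (\<integral>\<^sup>+\<eta>. ennreal (wt (- p / 2) (\<xi> - \<eta>) * cmod (rep_l2 (fourier a) (\<xi> - \<eta>))
        * (wt (- q / 2) \<eta> * cmod (rep_l2 (fourier b) \<eta>))) \<partial>lborel)"
proof -
  let ?A = "rep_l2 (fourier (bessel p a))" and ?B = "rep_l2 (fourier (bessel q b))"
  have i: "integrable lborel (\<lambda>\<eta>. ?A (\<xi> - \<eta>) * ?B \<eta>)"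
    by (intro integrable_mult_l2 sq_integrable_shift_reflect sq_integrable_rep)
  have "ennreal (sqrt (2 * pi) * cmod (ft_prod (bessel p a) (bessel q b) \<xi>)) = ennreal (cmod (\<integral>\<eta>. ?A (\<xi> - \<eta>) * ?B \<eta> \<partial>lborel))"
    by (simp add: ft_prod_convolution norm_divide)
  also have "\<dots> \<le> (\<integral>\<^sup>+\<eta>. ennreal (cmod (?A (\<xi> - \<eta>) * ?B \<eta>)) \<partial>lborel)"
    by (rule integral_norm_bound_ennreal[OF i])
  also have "\<dots> = (\<integral>\<^sup>+\<eta>. ennreal (wt (- p / 2) (\<xi> - \<eta>) * cmod (rep_l2 (fourier a) (\<xi> - \<eta>))
        * (wt (- q / 2) \<eta> * cmod (rep_l2 (fourier b) \<eta>))) \<partial>lborel)"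
  proof (rule nn_integral_cong_AE)
    have "AE \<eta> in lborel. ?A (\<xi> - \<eta>) = complex_of_real (wt (- p / 2) (\<xi> - \<eta>)) * rep_l2 (fourier a) (\<xi> - \<eta>)"
      by (rule AE_shift_reflect) (use has_ft_bessel[OF assms(1), of a] in \<open>simp add: has_ft_def\<close>)
    then show "AE \<eta> in lborel. ennreal (cmod (?A (\<xi> - \<eta>) * ?B \<eta>)) =
        ennreal (wt (- p / 2) (\<xi> - \<eta>) * cmod (rep_l2 (fourier a) (\<xi> - \<eta>))
        * (wt (- q / 2) \<eta> * cmod (rep_l2 (fourier b) \<eta>)))"
      using has_ft_bessel[OF assms(2), of b] unfolding has_ft_def
      by eventually_elim (simp add: norm_mult)
  qed
  finally show ?thesis .
qed

lemma cmod_bil_symbol: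
  "(cmod (bil_symbol s p q a b \<xi>))\<^sup>2 = wt (s - 2) \<xi> * \<xi>\<^sup>2 / 4 * (cmod (ft_prod (bessel p a) (bessel q b) \<xi>))\<^sup>2"
proof -
  have "(wt (s / 2 - 1) \<xi>)\<^sup>2 = wt (s - 2) \<xi>" by (simp add: wt_square right_diff_distrib)
  then show ?thesis by (simp add: bil_symbol_def norm_mult power_mult_distrib power_divide)
qed

lemma square_wt_minus_1_le: "wt (- 1) \<xi> * \<xi>\<^sup>2 \<le> 1"
  using one_plus_square_pos[of \<xi>] by (simp add: wt_minus_1 field_simps)

lemma ennreal_square_le:
  assumes "ennreal x \<le> Y" "Y\<^sup>2 \<le> Z" "0 \<le> x" shows "ennreal (x\<^sup>2) \<le> Z"
proof -
  have "ennreal (x\<^sup>2) = (ennreal x)\<^sup>2" using assms(3) by (simp add: ennreal_power)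
  also have "\<dots> \<le> Y\<^sup>2" by (rule power_mono[OF assms(1)]) simp
  finally show ?thesis using assms(2) by simp
qed

text \<open>Peetre's inequality cancels the weights of the factors against
  \<open>wt (l / 2) \<xi>\<close> at the cost of a factor 2, and Cauchy-Schwarz bounds the remaining
  convolution uniformly in \<xi>. What is left of the multiplier is at most \<open>wt (- 1)\<close>,
  whose integral is pi.\<close>

lemma bil_bounded_diagonal:
  assumes l: "0 \<le> l" "l \<le> 2" shows "bil_bounded l l l"
  unfolding bil_bounded_def
proof (intro conjI allI l(1))
  fix a b :: "real l2"
  let ?A = "\<lambda>\<eta>. cmod (rep_l2 (fourier a) \<eta>)" and ?B = "\<lambda>\<eta>. cmod (rep_l2 (fourier b) \<eta>)"
  define M where "M = (norm a * norm b)\<^sup>2"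
  have M: "0 \<le> M" by (simp add: M_def)
  define P where "P \<xi> = cmod (ft_prod (bessel l a) (bessel l b) \<xi>)" for \<xi>
  have P: "2 * pi * (wt l \<xi> * (P \<xi>)\<^sup>2) \<le> 4 * M" for \<xi>
  proof -
    have "ennreal (wt (l / 2) \<xi> * (sqrt (2 * pi) * P \<xi>))
        \<le> ennreal (wt (l / 2) \<xi>) * (\<integral>\<^sup>+\<eta>. ennreal (wt (- l / 2) (\<xi> - \<eta>) * ?A (\<xi> - \<eta>) * (wt (- l / 2) \<eta> * ?B \<eta>)) \<partial>lborel)"
      using mult_left_mono[OF ft_prod_bessel_bound[OF l(1) l(1), of a b \<xi>], of "ennreal (wt (l / 2) \<xi>)"]
      by (simp add: P_def ennreal_mult)
    also have "\<dots> = (\<integral>\<^sup>+\<eta>. ennreal (wt (l / 2) \<xi>) * ennreal (wt (- l / 2) (\<xi> - \<eta>) * ?A (\<xi> - \<eta>) * (wt (- l / 2) \<eta> * ?B \<eta>)) \<partial>lborel)"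
      by (rule nn_integral_cmult[symmetric]) measurable
    also have "\<dots> \<le> (\<integral>\<^sup>+\<eta>. 2 * (ennreal (?A (\<xi> - \<eta>)) * ennreal (?B \<eta>)) \<partial>lborel)"
    proof (intro nn_integral_mono)
      fix \<eta>
      have "wt (- (l / 2)) (\<xi> - \<eta>) * wt (- (l / 2)) \<eta> * wt (l / 2) \<xi> \<le> 2"
        using wt_peetre[of "l / 2" \<xi> \<eta>] powr_mono[of "l / 2" 1 2] l by simp
      then have "(wt (- (l / 2)) (\<xi> - \<eta>) * wt (- (l / 2)) \<eta> * wt (l / 2) \<xi>) * (?A (\<xi> - \<eta>) * ?B \<eta>)
          \<le> 2 * (?A (\<xi> - \<eta>) * ?B \<eta>)"
        by (intro mult_right_mono) auto
      then have "ennreal (wt (l / 2) \<xi> * (wt (- l / 2) (\<xi> - \<eta>) * ?A (\<xi> - \<eta>) * (wt (- l / 2) \<eta> * ?B \<eta>)))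
          \<le> ennreal (2 * (?A (\<xi> - \<eta>) * ?B \<eta>))"
        by (intro ennreal_leI) (simp add: mult_ac)
      then show "ennreal (wt (l / 2) \<xi>) * ennreal (wt (- l / 2) (\<xi> - \<eta>) * ?A (\<xi> - \<eta>) * (wt (- l / 2) \<eta> * ?B \<eta>))
          \<le> 2 * (ennreal (?A (\<xi> - \<eta>)) * ennreal (?B \<eta>))"
        by (simp add: ennreal_mult)
    qed
    also have "\<dots> = 2 * (\<integral>\<^sup>+\<eta>. ennreal (?A (\<xi> - \<eta>)) * ennreal (?B \<eta>) \<partial>lborel)"
      by (rule nn_integral_cmult) measurable
    finally have 1: "ennreal (wt (l / 2) \<xi> * (sqrt (2 * pi) * P \<xi>)) \<le> \<dots>" .
    have "(\<integral>\<^sup>+\<eta>. ennreal (?A (\<xi> - \<eta>)) * ennreal (?B \<eta>) \<partial>lborel)\<^sup>2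
        \<le> (\<integral>\<^sup>+\<eta>. (ennreal (?A (\<xi> - \<eta>)))\<^sup>2 \<partial>lborel) * (\<integral>\<^sup>+\<eta>. (ennreal (?B \<eta>))\<^sup>2 \<partial>lborel)"
      by (rule Cauchy_Schwarz_nn_integral) measurable
    also have "\<dots> = ennreal ((norm a)\<^sup>2) * ennreal ((norm b)\<^sup>2)"
      using nn_integral_shift_reflect[of "\<lambda>\<eta>. ennreal ((?A \<eta>)\<^sup>2)" \<xi>]
      by (simp add: ennreal_power nn_integral_fourier)
    also have "\<dots> = ennreal M" by (simp add: M_def power_mult_distrib ennreal_mult)
    finally have "(2 * (\<integral>\<^sup>+\<eta>. ennreal (?A (\<xi> - \<eta>)) * ennreal (?B \<eta>) \<partial>lborel))\<^sup>2 \<le> 4 * ennreal M"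
      by (simp add: power_mult_distrib mult_left_mono)
    also have "4 * ennreal M = ennreal (4 * M)" using M by (simp add: ennreal_mult)
    finally have "ennreal ((wt (l / 2) \<xi> * (sqrt (2 * pi) * P \<xi>))\<^sup>2) \<le> ennreal (4 * M)"
      by (rule ennreal_square_le[OF 1]) (simp add: P_def)
    then have "(wt (l / 2) \<xi> * (sqrt (2 * pi) * P \<xi>))\<^sup>2 \<le> 4 * M" using M by (simp add: ennreal_le_iff)
    then show ?thesis by (simp add: power_mult_distrib wt_square mult_ac)
  qed
  have "(cmod (bil_symbol l l l a b \<xi>))\<^sup>2 \<le> M / (2 * pi) * wt (- 1) \<xi>" for \<xi>
  proof -
    have "wt (l - 2) \<xi> = wt (- 1) \<xi> * wt (- 1) \<xi> * wt l \<xi>"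
      by (simp flip: wt_add)
    then have "(cmod (bil_symbol l l l a b \<xi>))\<^sup>2 = wt (- 1) \<xi> * (wt (- 1) \<xi> * \<xi>\<^sup>2) * (wt l \<xi> * (P \<xi>)\<^sup>2) / 4"
      by (simp add: cmod_bil_symbol P_def)
    also have "\<dots> \<le> wt (- 1) \<xi> * 1 * (2 * M / pi) / 4"
    proof (intro divide_right_mono mult_mono square_wt_minus_1_le mult_nonneg_nonneg order_refl)
      show "wt l \<xi> * (P \<xi>)\<^sup>2 \<le> 2 * M / pi" using P[of \<xi>] pi_gt_zero by (simp add: field_simps)
    qed (use M in auto)
    finally show ?thesis by (simp add: field_simps)
  qed
  then have "(\<integral>\<^sup>+\<xi>. ennreal ((cmod (bil_symbol l l l a b \<xi>))\<^sup>2) \<partial>lborel) \<le> (\<integral>\<^sup>+\<xi>. ennreal (M / (2 * pi)) * ennreal (wt (- 1) \<xi>) \<partial>lborel)"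
    using M by (intro nn_integral_mono) (simp add: ennreal_leI flip: ennreal_mult)
  also have "\<dots> = ennreal (M / (2 * pi)) * ennreal pi"
    by (subst nn_integral_cmult) (auto simp: nn_integral_wt_minus_1)
  also have "\<dots> = ennreal (M / 2)" using M by (simp flip: ennreal_mult)
  also have "\<dots> \<le> ennreal M" using M by (intro ennreal_leI) simp
  finally show "(\<integral>\<^sup>+\<xi>. ennreal ((cmod (bil_symbol l l l a b \<xi>))\<^sup>2) \<partial>lborel) \<le> ennreal ((norm a * norm b)\<^sup>2)"
    by (simp add: M_def)
qed

text \<open>Reflects that the product of an L2 and an H^1 function lies in L2. Cauchy-Schwarz splits
  off \<open>wt (- 1 / 2) \<eta>\<close>, which is square integrable, and leaves the convolution
  \<open>Q\<close> of the squared moduli; its integral factorises by Fubini, the multiplier in \<xi>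
  being bounded.\<close>

lemma bil_bounded_energy: "bil_bounded 1 0 1"
  unfolding bil_bounded_def
proof (intro conjI allI)
  fix a b :: "real l2"
  let ?A = "\<lambda>\<eta>. cmod (rep_l2 (fourier a) \<eta>)" and ?B = "\<lambda>\<eta>. cmod (rep_l2 (fourier b) \<eta>)"
  define P where "P \<xi> = cmod (ft_prod (bessel 0 a) (bessel 1 b) \<xi>)" for \<xi>
  define Q where "Q \<xi> = (\<integral>\<^sup>+\<eta>. ennreal ((?A (\<xi> - \<eta>))\<^sup>2) * ennreal ((?B \<eta>)\<^sup>2) \<partial>lborel)" for \<xi>
  have P: "ennreal (2 * pi * (P \<xi>)\<^sup>2) \<le> ennreal pi * Q \<xi>" for \<xi>
  proof -
    have 1: "ennreal (sqrt (2 * pi) * P \<xi>) \<le> (\<integral>\<^sup>+\<eta>. ennreal (wt (- 1 / 2) \<eta>) * ennreal (?A (\<xi> - \<eta>) * ?B \<eta>) \<partial>lborel)"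
      using ft_prod_bessel_bound[of 0 1 a b \<xi>] by (simp add: P_def mult_ac flip: ennreal_mult)
    have "(\<integral>\<^sup>+\<eta>. ennreal (wt (- 1 / 2) \<eta>) * ennreal (?A (\<xi> - \<eta>) * ?B \<eta>) \<partial>lborel)\<^sup>2
        \<le> (\<integral>\<^sup>+\<eta>. (ennreal (wt (- 1 / 2) \<eta>))\<^sup>2 \<partial>lborel) * (\<integral>\<^sup>+\<eta>. (ennreal (?A (\<xi> - \<eta>) * ?B \<eta>))\<^sup>2 \<partial>lborel)"
      by (rule Cauchy_Schwarz_nn_integral) measurable
    also have "\<dots> = ennreal pi * Q \<xi>"
      by (simp add: Q_def ennreal_power wt_square nn_integral_wt_minus_1 power_mult_distrib ennreal_mult)
    finally have "ennreal ((sqrt (2 * pi) * P \<xi>)\<^sup>2) \<le> ennreal pi * Q \<xi>"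
      by (rule ennreal_square_le[OF 1]) (simp add: P_def)
    then show ?thesis by (simp add: power_mult_distrib)
  qed
  have S: "ennreal ((cmod (bil_symbol 1 0 1 a b \<xi>))\<^sup>2) \<le> Q \<xi>" for \<xi>
  proof -
    have "(cmod (bil_symbol 1 0 1 a b \<xi>))\<^sup>2 = (wt (- 1) \<xi> * \<xi>\<^sup>2) * (P \<xi>)\<^sup>2 / 4"
      by (simp add: cmod_bil_symbol P_def)
    also have "\<dots> \<le> 1 * (P \<xi>)\<^sup>2 / 4"
      by (intro divide_right_mono mult_right_mono square_wt_minus_1_le) auto
    also have "\<dots> \<le> 1 / pi * (2 * pi * (P \<xi>)\<^sup>2)" by simp
    finally have "ennreal ((cmod (bil_symbol 1 0 1 a b \<xi>))\<^sup>2) \<le> ennreal (1 / pi) * ennreal (2 * pi * (P \<xi>)\<^sup>2)"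
      by (subst ennreal_mult[symmetric]) (auto intro: ennreal_leI)
    also have "\<dots> \<le> ennreal (1 / pi) * (ennreal pi * Q \<xi>)" by (intro mult_left_mono P) auto
    also have "\<dots> = Q \<xi>" by (simp flip: mult.assoc ennreal_mult)
    finally show ?thesis .
  qed
  have "(\<integral>\<^sup>+\<xi>. ennreal ((cmod (bil_symbol 1 0 1 a b \<xi>))\<^sup>2) \<partial>lborel) \<le> (\<integral>\<^sup>+\<xi>. Q \<xi> \<partial>lborel)"
    by (intro nn_integral_mono S)
  also have "\<dots> = (\<integral>\<^sup>+\<eta>. (\<integral>\<^sup>+\<xi>. ennreal ((?A (\<xi> - \<eta>))\<^sup>2) * ennreal ((?B \<eta>)\<^sup>2) \<partial>lborel) \<partial>lborel)"
    unfolding Q_def by (rule lborel_pair.Fubini') measurable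
  also have "\<dots> = (\<integral>\<^sup>+\<eta>. ennreal ((norm a)\<^sup>2) * ennreal ((?B \<eta>)\<^sup>2) \<partial>lborel)"
  proof (intro nn_integral_cong)
    fix \<eta>
    have "(\<integral>\<^sup>+\<xi>. ennreal ((?A (\<xi> - \<eta>))\<^sup>2) \<partial>lborel) = ennreal ((norm a)\<^sup>2)"
      using nn_integral_real_affine[of "\<lambda>\<eta>. ennreal ((?A \<eta>)\<^sup>2)" 1 "- \<eta>"] nn_integral_fourier[of a] by simp
    then show "(\<integral>\<^sup>+\<xi>. ennreal ((?A (\<xi> - \<eta>))\<^sup>2) * ennreal ((?B \<eta>)\<^sup>2) \<partial>lborel) = ennreal ((norm a)\<^sup>2) * ennreal ((?B \<eta>)\<^sup>2)"
      by (subst nn_integral_multc) auto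
  qed
  also have "\<dots> = ennreal ((norm a)\<^sup>2) * ennreal ((norm b)\<^sup>2)"
    by (subst nn_integral_cmult) (auto simp: nn_integral_fourier)
  also have "\<dots> = ennreal ((norm a * norm b)\<^sup>2)" by (simp add: power_mult_distrib ennreal_mult)
  finally show "(\<integral>\<^sup>+\<xi>. ennreal ((cmod (bil_symbol 1 0 1 a b \<xi>))\<^sup>2) \<partial>lborel) \<le> ennreal ((norm a * norm b)\<^sup>2)" .
qed auto

section \<open>Symmetry, smoothing and skewness of the bilinear operators\<close>

lemma bil_sym: "bil s p p a b = bil s p p b a"
  by (simp add: bil_def bil_symbol_def[abs_def] ft_prod_sym[of "bessel p a"])

text \<open>On symbols this is the bookkeeping l/2 - 1 = -(1 - l)/2 + (1/2 - 1), together with the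
  fact that orders \<open>l\<close> and \<open>1 - l\<close> compose to order 1 in the second
  argument.\<close>

lemma bil_smooth:
  assumes l: "0 \<le> l" "l \<le> 1"
  shows "bil l l l a (bessel (1 - l) c) = bessel (1 - l) (bil 1 0 1 (bessel l a) c)"
proof (rule has_ft_unique)
  show "has_ft (bil l l l a (bessel (1 - l) c)) (bil_symbol l l l a (bessel (1 - l) c))"
    using l by (intro has_ft_bil(1) bil_bounded_diagonal) auto
  have "l / 2 - 1 = - (1 - l) / 2 + (1 / 2 - 1)" by (simp add: field_simps)
  then have "wt (l / 2 - 1) \<xi> = wt (- (1 - l) / 2) \<xi> * wt (1 / 2 - 1) \<xi>" for \<xi> by (simp only: wt_add)
  then have "bil_symbol l l l a (bessel (1 - l) c)
      = (\<lambda>\<xi>. complex_of_real (wt (- (1 - l) / 2) \<xi>) * bil_symbol 1 0 1 (bessel l a) c \<xi>)"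
    using l by (simp add: fun_eq_iff bil_symbol_def bessel_bessel mult.assoc)
  then show "has_ft (bessel (1 - l) (bil 1 0 1 (bessel l a) c)) (bil_symbol l l l a (bessel (1 - l) c))"
    using l by (simp only:) (intro has_ft_bessel' has_ft_bil(1) bil_bounded_energy, simp)
qed

text \<open>
  The trilinear form \<open>\<integral>\<integral> \<xi> k(-\<xi>) k(\<xi> - \<eta>) k(\<eta>)\<close> vanishes since symmetrising it over the three
  frequencies \<open>-\<xi>\<close>, \<open>\<xi> - \<eta>\<close>, \<open>\<eta>\<close> replaces the factor by a multiple of their sum, which is zero.
\<close>

lemma trilinear_vanishes:
  fixes k :: "real \<Rightarrow> complex"
  assumes k [measurable]: "k \<in> borel_measurable borel" and bd: "\<And>x. cmod (k x) \<le> M"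
    and supp: "\<And>x. R < \<bar>x\<bar> \<Longrightarrow> k x = 0"
  shows "(\<integral>\<xi>. complex_of_real \<xi> * k (- \<xi>) * (\<integral>\<eta>. k (\<xi> - \<eta>) * k \<eta> \<partial>lborel) \<partial>lborel) = 0" (is "?T = 0")
proof -
  have M: "0 \<le> M" using bd[of 0] norm_ge_zero order_trans by blast
  have I: "integrable lborel (\<lambda>x. indicator {-R..R} x * (\<bar>R\<bar> * M + M) :: real)"
    by (intro integrable_mult_left integrable_real_indicator) (auto simp: emeasure_lborel_Icc_eq)
  have int: "integrable lborel g"
    if [measurable]: "g \<in> borel_measurable borel"
      and "\<And>x. \<bar>x\<bar> \<le> R \<Longrightarrow> cmod (g x) \<le> \<bar>R\<bar> * M + M" "\<And>x. R < \<bar>x\<bar> \<Longrightarrow> g x = 0" for g :: "real \<Rightarrow> complex"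
  proof (rule Bochner_Integration.integrable_bound[OF I])
    have "norm (g x) \<le> norm (indicator {-R..R} x * (\<bar>R\<bar> * M + M))" for x
    proof (cases "\<bar>x\<bar> \<le> R")
      case True
      then have "x \<in> {-R..R}" by auto
      then show ?thesis using that(2)[OF True] M by simp
    qed (use that(3)[of x] in simp)
    then show "AE x in lborel. norm (g x) \<le> norm (indicator {-R..R} x * (\<bar>R\<bar> * M + M))" by simp
  qed measurable
  have ik: "integrable lborel k"
    by (rule int) (use supp M in \<open>auto intro!: order_trans[OF bd]\<close>)
  have ixk: "integrable lborel (\<lambda>x. complex_of_real x * k x)"
  proof (rule int)
    show "cmod (complex_of_real x * k x) \<le> \<bar>R\<bar> * M + M" if "\<bar>x\<bar> \<le> R" for x
    proof -
      have "\<bar>x\<bar> * cmod (k x) \<le> \<bar>R\<bar> * M" using that M by (intro mult_mono bd) auto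
      then show ?thesis using M by (simp add: norm_mult)
    qed
  qed (use supp in auto)
  have ik': "integrable lborel (\<lambda>x. k (- x))" by (rule integrable_reflect[OF ik])
  have ixk': "integrable lborel (\<lambda>x. complex_of_real x * k (- x))"
    using integrable_reflect[OF ixk] by (subst (asm) minus_minus[symmetric]) simp
  have prodi: "integrable lborel (\<lambda>\<eta>. k (\<xi> - \<eta>) * g \<eta>)" if "integrable lborel g" for g \<xi>
    by (rule integrable_bounded_mult[OF that _ bd]) measurable
  define U where "U = (\<integral>\<xi>. k (- \<xi>) * (\<integral>\<eta>. k (\<xi> - \<eta>) * (complex_of_real \<eta> * k \<eta>) \<partial>lborel) \<partial>lborel)"
  \<comment> \<open>The substitution exchanging \<open>\<eta>\<close> and
    \<open>\<xi> - \<eta>\<close> replaces the factor \<open>\<eta>\<close> by half of their sum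
    \<xi>.\<close>
  have W: "2 * (\<integral>\<eta>. k (\<xi> - \<eta>) * (complex_of_real \<eta> * k \<eta>) \<partial>lborel) = complex_of_real \<xi> * (\<integral>\<eta>. k (\<xi> - \<eta>) * k \<eta> \<partial>lborel)" for \<xi>
  proof -
    let ?V = "\<integral>\<eta>. k (\<xi> - \<eta>) * (complex_of_real \<eta> * k \<eta>) \<partial>lborel"
    have "?V = (\<integral>\<eta>. k \<eta> * (complex_of_real (\<xi> - \<eta>) * k (\<xi> - \<eta>)) \<partial>lborel)"
      using lborel_integral_real_affine[of "-1" "\<lambda>\<eta>. k (\<xi> - \<eta>) * (complex_of_real \<eta> * k \<eta>)" \<xi>] by simp
    also have "\<dots> = (\<integral>\<eta>. complex_of_real \<xi> * (k (\<xi> - \<eta>) * k \<eta>) - k (\<xi> - \<eta>) * (complex_of_real \<eta> * k \<eta>) \<partial>lborel)"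
      by (simp add: algebra_simps)
    also have "\<dots> = complex_of_real \<xi> * (\<integral>\<eta>. k (\<xi> - \<eta>) * k \<eta> \<partial>lborel) - ?V"
      by (subst Bochner_Integration.integral_diff) (auto intro!: prodi ik ixk)
    finally show ?thesis by simp
  qed
  have T1: "complex_of_real \<xi> * k (- \<xi>) * (\<integral>\<eta>. k (\<xi> - \<eta>) * k \<eta> \<partial>lborel)
      = 2 * (k (- \<xi>) * (\<integral>\<eta>. k (\<xi> - \<eta>) * (complex_of_real \<eta> * k \<eta>) \<partial>lborel))" for \<xi>
    using arg_cong[OF W[of \<xi>], of "\<lambda>z. k (- \<xi>) * z"] by (simp only: mult.assoc mult.left_commute)
  have TU: "?T = 2 * U" unfolding U_def T1 by (rule integral_mult_right_zero)
  \<comment> \<open>The same for the frequencies \<open>- \<xi>\<close> and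
    \<open>\<xi> - \<eta>\<close>, whose sum is \<open>- \<eta>\<close>.\<close>
  have V: "2 * (\<integral>\<xi>. k (\<xi> - \<eta>) * (complex_of_real \<xi> * k (- \<xi>)) \<partial>lborel) = complex_of_real \<eta> * (\<integral>\<xi>. k (\<xi> - \<eta>) * k (- \<xi>) \<partial>lborel)" for \<eta>
  proof -
    let ?V = "\<integral>\<xi>. k (\<xi> - \<eta>) * (complex_of_real \<xi> * k (- \<xi>)) \<partial>lborel"
    have prodi': "integrable lborel (\<lambda>\<xi>. k (\<xi> - \<eta>) * g \<xi>)" if "integrable lborel g" for g
      by (rule integrable_bounded_mult[OF that _ bd]) measurable
    have "?V = (\<integral>\<xi>. k (- \<xi>) * (complex_of_real (\<eta> - \<xi>) * k (\<xi> - \<eta>)) \<partial>lborel)"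
      using lborel_integral_real_affine[of "-1" "\<lambda>\<xi>. k (\<xi> - \<eta>) * (complex_of_real \<xi> * k (- \<xi>))" \<eta>] by simp
    also have "\<dots> = (\<integral>\<xi>. complex_of_real \<eta> * (k (\<xi> - \<eta>) * k (- \<xi>)) - k (\<xi> - \<eta>) * (complex_of_real \<xi> * k (- \<xi>)) \<partial>lborel)"
      by (simp add: algebra_simps)
    also have "\<dots> = complex_of_real \<eta> * (\<integral>\<xi>. k (\<xi> - \<eta>) * k (- \<xi>) \<partial>lborel) - ?V"
      by (subst Bochner_Integration.integral_diff) (auto intro!: prodi' ik' ixk')
    finally show ?thesis by simp
  qed
  have TT: "?T = (\<integral>\<eta>. (\<integral>\<xi>. k (\<xi> - \<eta>) * (complex_of_real \<xi> * k (- \<xi>)) \<partial>lborel) * k \<eta> \<partial>lborel)"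
    by (rule fubini_kernel[OF ixk' ik _ bd]) measurable
  have UT: "U = (\<integral>\<eta>. (\<integral>\<xi>. k (\<xi> - \<eta>) * k (- \<xi>) \<partial>lborel) * (complex_of_real \<eta> * k \<eta>) \<partial>lborel)"
    unfolding U_def by (rule fubini_kernel[OF ik' ixk _ bd]) measurable
  have T2: "(\<integral>\<xi>. k (\<xi> - \<eta>) * k (- \<xi>) \<partial>lborel) * (complex_of_real \<eta> * k \<eta>)
      = 2 * ((\<integral>\<xi>. k (\<xi> - \<eta>) * (complex_of_real \<xi> * k (- \<xi>)) \<partial>lborel) * k \<eta>)" for \<eta>
    using arg_cong[OF V[of \<eta>], of "\<lambda>z. z * k \<eta>"] by (simp only: mult.assoc mult.left_commute mult.commute)
  \<comment> \<open>Combined with \<open>TU\<close> this gives \<open>?T = 4 * ?T\<close>.\<close>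
  have "U = 2 * ?T" unfolding UT TT T2 by (rule integral_mult_right_zero)
  then show ?thesis unfolding TU by simp
qed

text \<open>The weight \<open>wt (1 / 2 - 1)\<close> of the symbol turns
  \<open>cnj (h \<xi>)\<close> into \<open>k (- \<xi>)\<close>, where \<open>k\<close> is the
  transform of \<open>bessel 1 c\<close>; the inner product becomes the real part of a multiple of
  the trilinear form of \<open>k\<close>. Bounded, compactly supported \<open>h\<close> makes all
  integrals there converge absolutely.\<close>

lemma bil_skew_bounded:
  assumes c: "has_ft c h" and h [measurable]: "h \<in> borel_measurable borel"
    and bd: "\<And>\<xi>. cmod (h \<xi>) \<le> M" and supp: "\<And>\<xi>. R < \<bar>\<xi>\<bar> \<Longrightarrow> h \<xi> = 0"
  shows "inner c (bil 1 0 1 (bessel 1 c) c) = 0"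
proof -
  define k where "k \<xi> = complex_of_real (wt (- 1 / 2) \<xi>) * h \<xi>" for \<xi>
  have [measurable]: "k \<in> borel_measurable borel" unfolding k_def by measurable
  have fk: "has_ft (bessel 1 c) k" unfolding k_def by (rule has_ft_bessel'[OF _ c]) simp
  then have ae: "AE \<xi> in lborel. rep_l2 (fourier (bessel 1 c)) \<xi> = k \<xi>" by (simp add: has_ft_def)
  let ?F = "rep_l2 (fourier (bessel 1 c))"
  define S where "S = bil_symbol 1 0 1 (bessel 1 c) c"
  have [measurable]: "S \<in> borel_measurable borel" by (simp add: S_def)
  have fS: "has_ft (bil 1 0 1 (bessel 1 c) c) S" unfolding S_def by (rule has_ft_bil(1)[OF bil_bounded_energy])
  note H = has_ft_abs_l2[OF c h] and SS = has_ft_abs_l2[OF fS]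
  define \<gamma> where "\<gamma> = - (1 / 2) * \<i> / complex_of_real (sqrt (2 * pi))"
  have ft: "ft_prod (bessel 1 c) (bessel 1 c) \<xi> = (\<integral>\<eta>. k (\<xi> - \<eta>) * k \<eta> \<partial>lborel) / complex_of_real (sqrt (2 * pi))" for \<xi>
  proof -
    have "(\<integral>\<eta>. ?F (\<xi> - \<eta>) * ?F \<eta> \<partial>lborel) = (\<integral>\<eta>. k (\<xi> - \<eta>) * k \<eta> \<partial>lborel)"
    proof (rule integral_cong_AE)
      show "AE \<eta> in lborel. ?F (\<xi> - \<eta>) * ?F \<eta> = k (\<xi> - \<eta>) * k \<eta>"
        using ae AE_shift_reflect[OF ae, of \<xi>] by eventually_elim simp
    qed measurable
    then show ?thesis by (simp add: ft_prod_convolution)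
  qed
  have sc: "sq_integrable (\<lambda>\<xi>. cnj (h \<xi>))" using isometry_cnj H(1) by (auto simp: l2_isometry_def)
  have i: "integrable lborel (\<lambda>\<xi>. cnj (h \<xi>) * S \<xi>)"
    by (rule integrable_mult_l2[OF sc]) (rule SS(1), measurable)
  have "inner c (bil 1 0 1 (bessel 1 c) c) = inner (fourier c) (fourier (bil 1 0 1 (bessel 1 c) c))"
    by (rule inner_fourier[symmetric])
  also have "\<dots> = inner (abs_l2 h) (abs_l2 S)" using H(2) SS(2) by simp
  also have "\<dots> = (\<integral>\<xi>. h \<xi> \<bullet> S \<xi> \<partial>lborel)" using H(1) SS(1) by (intro inner_abs_l2) auto
  also have "\<dots> = (\<integral>\<xi>. Re (cnj (h \<xi>) * S \<xi>) \<partial>lborel)" by (simp add: inner_complex_def)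
  also have "\<dots> = Re (\<integral>\<xi>. cnj (h \<xi>) * S \<xi> \<partial>lborel)" by (rule integral_Re[OF i])
  also have "(\<integral>\<xi>. cnj (h \<xi>) * S \<xi> \<partial>lborel)
      = (\<integral>\<xi>. \<gamma> * (complex_of_real \<xi> * k (- \<xi>) * (\<integral>\<eta>. k (\<xi> - \<eta>) * k \<eta> \<partial>lborel)) \<partial>lborel)"
  proof (rule integral_cong_AE)
    have "AE \<xi> in lborel. ?F (0 - \<xi>) = k (0 - \<xi>)" by (rule AE_shift_reflect[OF ae])
    then show "AE \<xi> in lborel. cnj (h \<xi>) * S \<xi>
        = \<gamma> * (complex_of_real \<xi> * k (- \<xi>) * (\<integral>\<eta>. k (\<xi> - \<eta>) * k \<eta> \<partial>lborel))"
      using ae hermitian_fourier[of "bessel 1 c", unfolded hermitian_def]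
    proof eventually_elim
      case (elim \<xi>)
      have "k (- \<xi>) = cnj (k \<xi>)"
        using elim by (simp del: minus_diff_eq)
      then have "k (- \<xi>) = cnj (h \<xi>) * complex_of_real (wt (1 / 2 - 1) \<xi>)"
        by (simp add: k_def)
      then show ?case by (simp add: S_def bil_symbol_def ft \<gamma>_def)
    qed
  qed measurable
  also have "\<dots> = 0"
  proof -
    have "cmod (k \<xi>) \<le> M" for \<xi>
      using mult_mono[OF wt_le_1[of "1 / 2" \<xi>] bd[of \<xi>]] by (simp add: k_def norm_mult)
    moreover have "k \<xi> = 0" if "R < \<bar>\<xi>\<bar>" for \<xi> using supp[OF that] by (simp add: k_def)
    ultimately show ?thesis
      unfolding integral_mult_right_zero by (subst trilinear_vanishes[of k M R]) auto
  qed
  finally show ?thesis by simp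
qed

text \<open>With w = \<open>bessel 1 c\<close> this is the vanishing of the integral of w w w_x.
  Cutting the transform off in frequency and in size preserves Hermitian symmetry, and both sides
  depend continuously on \<open>c\<close>.\<close>

lemma bil_skew: "inner c (bil 1 0 1 (bessel 1 c) c) = 0"
proof -
  let ?F = "rep_l2 (fourier c)"
  define h where "h n \<xi> = (if \<bar>\<xi>\<bar> \<le> real n \<and> cmod (?F \<xi>) \<le> real n then ?F \<xi> else 0)" for n \<xi>
  have [measurable]: "h n \<in> borel_measurable borel" for n unfolding h_def by measurable
  have sqF: "integrable lborel (\<lambda>\<xi>. (cmod (?F \<xi>))\<^sup>2)"
    using sq_integrable_rep[of "fourier c"] by (simp add: sq_integrable_def)
  have ft: "has_ft (inv_ft (h n)) (h n)" for n
  proof (rule has_ft_inv_ft)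
    show "sq_integrable (h n)" by (rule sq_integrable_bound[OF sqF]) (auto simp: h_def)
    show "hermitian (h n)"
      using hermitian_fourier[of c] unfolding hermitian_def by eventually_elim (simp add: h_def)
  qed
  have "fourier (inv_ft (h n)) = abs_l2 (h n)" for n by (rule has_ft_abs_l2[OF ft]) measurable
  moreover have "(\<lambda>n. abs_l2 (h n)) \<longlonglongrightarrow> abs_l2 ?F"
  proof (rule tendsto_abs_l2_dominated[OF _ _ sqF])
    show "AE \<xi> in lborel. (\<lambda>n. h n \<xi>) \<longlonglongrightarrow> ?F \<xi>"
    proof (intro AE_I2 tendsto_eventually)
      fix \<xi>
      obtain N where "max \<bar>\<xi>\<bar> (cmod (?F \<xi>)) \<le> real N" using real_arch_simple by blast
      then show "\<forall>\<^sub>F n in sequentially. h n \<xi> = ?F \<xi>"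
        by (intro eventually_sequentiallyI[of N]) (auto simp: h_def)
    qed
  qed (auto simp: h_def)
  ultimately have lim: "(\<lambda>n. inv_ft (h n)) \<longlonglongrightarrow> c" by (intro fourier_tendsto_cancel) simp
  have "(\<lambda>n. inner (inv_ft (h n)) (bil 1 0 1 (bessel 1 (inv_ft (h n))) (inv_ft (h n))))
      \<longlonglongrightarrow> inner c (bil 1 0 1 (bessel 1 c) c)"
    by (intro tendsto_inner bounded_bilinear.tendsto[OF bounded_bilinear_bil[OF bil_bounded_energy]]
        bounded_linear.tendsto[OF bounded_linear_bessel] lim) simp
  moreover have "inner (inv_ft (h n)) (bil 1 0 1 (bessel 1 (inv_ft (h n))) (inv_ft (h n))) = 0" for n
    by (rule bil_skew_bounded[OF ft, of n "real n" "real n"]) (auto simp: h_def)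
  ultimately show ?thesis using LIMSEQ_unique[OF _ tendsto_const] by auto
qed

text \<open>The orders are arranged so that the outer weight of order -l/2 completes both that of
  the forcing, -(2 - l)/2, and that of the quadratic term, l/2 - 1, to the symbol 1 / (1 +
  \<xi>^2).\<close>

lemma bbm_rhs_bessel:
  assumes l: "0 \<le> l" "l < 1"
  shows "bbm_rhs g (bessel l a) = bessel l (bessel (2 - l) g + bil l l l a a)"
proof -
  have ft: "has_ft (bessel l (bessel (2 - l) g + bil l l l a a))
      (\<lambda>\<xi>. complex_of_real (wt (- l / 2) \<xi>) *
        (complex_of_real (wt (- (2 - l) / 2) \<xi>) * rep_l2 (fourier g) \<xi> + bil_symbol l l l a a \<xi>))"
    using l by (intro has_ft_bessel' has_ft_add has_ft_bessel has_ft_bil(1) bil_bounded_diagonal) auto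
  have eq: "complex_of_real (wt (- l / 2) \<xi>) *
        (complex_of_real (wt (- (2 - l) / 2) \<xi>) * rep_l2 (fourier g) \<xi> + bil_symbol l l l a a \<xi>)
      = (rep_l2 (fourier g) \<xi> - 1 / 2 * (\<i> * complex_of_real \<xi> * fourier_integral (\<lambda>x. (rep_l2 (bessel l a) x)\<^sup>2) \<xi>))
        / complex_of_real (1 + \<xi>\<^sup>2)" for \<xi>
  proof -
    have e: "- l / 2 + - (2 - l) / 2 = - 1" "- l / 2 + (l / 2 - 1) = - 1" by (simp_all add: field_simps)
    have w: "complex_of_real (wt (- l / 2) \<xi>) * complex_of_real (wt (- (2 - l) / 2) \<xi>) = inverse (complex_of_real (1 + \<xi>\<^sup>2))"
      "complex_of_real (wt (- l / 2) \<xi>) * complex_of_real (wt (l / 2 - 1) \<xi>) = inverse (complex_of_real (1 + \<xi>\<^sup>2))"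
      unfolding of_real_mult[symmetric] wt_add[symmetric] e wt_minus_1 of_real_inverse by (rule refl)+
    have p: "fourier_integral (\<lambda>x. (rep_l2 (bessel l a) x)\<^sup>2) \<xi> = ft_prod (bessel l a) (bessel l a) \<xi>"
      by (simp add: ft_prod_def power2_eq_square)
    have gen: "w1 * (w2 * g + w3 * (- (1 / 2) * x * y)) = (g - 1 / 2 * (x * y)) / d"
      if "w1 * w2 = inverse d" "w1 * w3 = inverse d" for w1 w2 w3 g x y d :: complex
    proof -
      have "w1 * (w2 * g + w3 * (- (1 / 2) * x * y)) = (w1 * w2) * g + (w1 * w3) * (- (1 / 2) * x * y)"
        by (simp only: distrib_left mult.assoc)
      also have "\<dots> = (g + - (1 / 2) * x * y) * inverse d"
        unfolding that by (simp only: distrib_right mult.commute[of "inverse d"])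
      also have "g + - (1 / 2) * x * y = g - 1 / 2 * (x * y)" by simp
      finally show ?thesis by (simp only: divide_inverse[of _ d])
    qed
    show ?thesis unfolding p bil_symbol_def by (rule gen[OF w])
  qed
  have "has_ft (bessel l (bessel (2 - l) g + bil l l l a a))
     (\<lambda>\<xi>. (rep_l2 (fourier g) \<xi> - 1 / 2 * (\<i> * complex_of_real \<xi> * fourier_integral (\<lambda>x. (rep_l2 (bessel l a) x)\<^sup>2) \<xi>))
        / complex_of_real (1 + \<xi>\<^sup>2))"
    by (rule has_ft_cong[OF ft AE_I2]) (rule eq)
  from inv_ft_eq[OF this] show ?thesis
    unfolding bbm_rhs_def inv_helmholtz_def inv_ft_def has_ft_def .
qed

section \<open>Mild solutions in Bessel coordinates\<close>

definition bessel_forcing :: "real \<Rightarrow> (real \<Rightarrow> real l2) \<Rightarrow> real \<Rightarrow> real l2" where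
  "bessel_forcing l f s = bessel (2 - l) (f s)"

text \<open>\<open>bil 1 0 1\<close> takes its first argument as a function and its second as an H^1
  coordinate, which is why \<open>J\<close> is \<open>bessel l\<close>; \<open>I\<close> bridges the
  orders from 1 to \<open>l\<close>.\<close>

lemma smoothing_quadratic_bil:
  assumes l: "0 \<le> l" "l < 1"
  shows "smoothing_quadratic (bil l l l) 1 (bil 1 0 1) (bessel l) (bessel (1 - l))"
proof (intro smoothing_quadratic.intro quadratic.intro smoothing_quadratic_axioms.intro)
  have b: "bil_bounded l l l" using l by (intro bil_bounded_diagonal) auto
  show "bounded_bilinear (bil l l l)" by (rule bounded_bilinear_bil[OF b])
  show "norm (bil l l l a c) \<le> 1 * norm a * norm c" for a c using has_ft_bil(2)[OF b, of a c] by simp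
  show "bounded_bilinear (bil 1 0 1)" by (rule bounded_bilinear_bil[OF bil_bounded_energy])
  show "norm (bil 1 0 1 a c) \<le> 1 * norm a * norm c" for a c
    using has_ft_bil(2)[OF bil_bounded_energy, of a c] by simp
  show "bounded_linear (bessel l)" "bounded_linear (bessel (1 - l))"
    using l by (auto intro!: bounded_linear_bessel)
  show "norm (bessel l a) \<le> norm a" "norm (bessel (1 - l) a) \<le> norm a" for a
    using l by (auto intro!: norm_bessel_le)
  show "bil l l l a c = bil l l l c a" for a c by (rule bil_sym)
  show "bil l l l a (bessel (1 - l) c) = bessel (1 - l) (bil 1 0 1 (bessel l a) c)" for a c
    using l by (intro bil_smooth) auto
  show "inner c (bil 1 0 1 (bessel l (bessel (1 - l) c)) c) = 0" for c
    using l by (simp add: bessel_bessel bil_skew)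
  show "\<exists>c. norm (a - bessel (1 - l) c) \<le> e" if "0 < e" for a e
    using l that by (intro bessel_dense) auto
qed simp

lemma forced_mono: "forced f m \<Longrightarrow> m \<le> m' \<Longrightarrow> forced f m'"
  by (auto simp: forced_def intro: order_trans)

text \<open>The real number \<open>m\<close> is the supremum itself and not just a bound, because
  the a priori estimate is linear in the size of the data.\<close>

lemma forcing_sup_forced:
  assumes f: "forcing_term f" and le: "forcing_sup f \<le> ennreal \<delta>" and \<delta>: "0 \<le> \<delta>"
  obtains m where "0 \<le> m" "m \<le> \<delta>" "forcing_sup f = ennreal m" "forced f m"
proof -
  define m where "m = enn2real (forcing_sup f)"
  have fin: "forcing_sup f < top" using le by (rule le_less_trans) simp
  then have m: "forcing_sup f = ennreal m" by (simp add: m_def)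
  have m0: "0 \<le> m" by (simp add: m_def)
  have "norm (f s) \<le> m" if "0 \<le> s" for s
  proof -
    have "ennreal (norm (f s)) \<le> forcing_sup f" unfolding forcing_sup_def by (rule SUP_upper) (use that in simp)
    then show ?thesis using m m0 by simp
  qed
  moreover have "m \<le> \<delta>" using le m \<delta> by simp
  ultimately show ?thesis using that m m0 f by (auto simp: forced_def forcing_term_def)
qed

text \<open>If \<open>g\<close> is not integrable, its integral is 0 by convention and the
  nonnegative right-hand side still dominates, so measurability of \<open>g\<close> need not be
  established.\<close>

lemma set_integral_le_length:
  fixes g :: "real \<Rightarrow> real"
  assumes "0 \<le> c" "0 \<le> T" "\<And>s. s \<in> {\<tau>..\<tau> + T} \<Longrightarrow> g s \<le> c"
  shows "(LINT s:{\<tau>..\<tau> + T}|lebesgue. g s) \<le> c * T"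
proof (cases "set_integrable lebesgue {\<tau>..\<tau> + T} g")
  case True
  have "(LINT s:{\<tau>..\<tau> + T}|lebesgue. g s) \<le> (LINT s:{\<tau>..\<tau> + T}|lebesgue. c)"
    using assms(3) by (intro set_integral_mono True)
      (auto simp: set_integrable_def integrable_completion emeasure_lborel_Icc_eq intro!: integrable_real_indicator)
  also have "\<dots> = c * T" using assms by (simp add: set_lebesgue_integral_def)
  finally show ?thesis .
next
  case False
  then show ?thesis
    using assms by (simp add: set_lebesgue_integral_def set_integrable_def not_integrable_integral_eq)
qed

context
  fixes l :: real
  assumes l: "0 \<le> l" "l < 1"
begin

interpretation smoothing_quadratic "bil l l l" 1 "bil 1 0 1" "bessel l" "bessel (1 - l)"
  by (rule smoothing_quadratic_bil[OF l])

lemma forced_bessel_forcing: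
  assumes "forced f m" shows "forced (bessel_forcing l f) m"
proof -
  have bl: "bounded_linear (bessel (2 - l))" using l by (intro bounded_linear_bessel) simp
  have "bessel (2 - l) \<in> borel_measurable borel"
    by (intro borel_measurable_continuous_onI linear_continuous_on bl)
  then have "(\<lambda>s. bessel (2 - l) (f s)) \<in> borel_measurable (lebesgue_on {0..})"
    using assms by (auto simp: forced_def intro: measurable_compose)
  then show ?thesis
    using assms l norm_bessel_le[of "2 - l"] by (auto simp: forced_def bessel_forcing_def[abs_def] intro: order_trans)
qed

text \<open>As \<open>bessel l\<close> is an isometry of L2 onto H^l, continuity of \<open>u\<close>
  in H^l is continuity of its coordinate. As a bounded operator it commutes with the Duhamel
  integral, and injectivity carries the equation back to the coordinate.\<close>

lemma mild_solution_iff: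
  assumes f: "forced f m"
  shows "mild_solution l f u \<longleftrightarrow>
    (\<exists>a. mild_sol (bessel_forcing l f) a \<and> (\<forall>t\<ge>0. u t = bessel l (a t)))" (is "?L \<longleftrightarrow> ?R")
proof -
  let ?G = "bessel_forcing l f"
  note G = forced_bessel_forcing[OF f]
  have bl: "bounded_linear (bessel l)" by (rule bounded_linear_bessel[OF l(1)])
  note diff = linear_diff[OF bounded_linear.linear[OF bl]]
  have rhs: "bbm_rhs (f s) (u s) = bessel l (?G s + bil l l l (a s) (a s))"
    if "\<And>t. 0 \<le> t \<Longrightarrow> u t = bessel l (a t)" "0 \<le> s" for a s
    using bbm_rhs_bessel[OF l, of "f s" "a s"] that by (simp add: bessel_forcing_def)
  have int: "(LINT s:{0..t}|lebesgue. exp (- (t - s)) *\<^sub>R bbm_rhs (f s) (u s))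
        = bessel l (duhamel (\<lambda>s. ?G s + bil l l l (a s) (a s)) t)"
    "set_integrable lebesgue {0..t} (\<lambda>s. exp (- (t - s)) *\<^sub>R bbm_rhs (f s) (u s))"
    if a: "continuous_on {0..} a" "\<And>t. 0 \<le> t \<Longrightarrow> u t = bessel l (a t)" and t: "0 \<le> t" for a t
  proof -
    note i = duhamel_bounded_linear[OF bl rhs_integrable[OF G a(1) t]]
    have "(LINT s:{0..t}|lebesgue. exp (- (t - s)) *\<^sub>R bbm_rhs (f s) (u s))
        = duhamel (\<lambda>s. bbm_rhs (f s) (u s)) t" by (simp add: duhamel_def)
    also have "\<dots> = duhamel (\<lambda>s. bessel l (?G s + bil l l l (a s) (a s))) t"
      by (rule duhamel_cong) (use rhs[OF a(2)] in auto)
    finally show "(LINT s:{0..t}|lebesgue. exp (- (t - s)) *\<^sub>R bbm_rhs (f s) (u s))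
        = bessel l (duhamel (\<lambda>s. ?G s + bil l l l (a s) (a s)) t)" unfolding i(1) .
    have "indicator {0..t} s *\<^sub>R exp (- (t - s)) *\<^sub>R bbm_rhs (f s) (u s)
        = indicator {0..t} s *\<^sub>R exp (- (t - s)) *\<^sub>R bessel l (?G s + bil l l l (a s) (a s))" for s
      using rhs[OF a(2), of s] by (cases "s \<in> {0..t}") auto
    then show "set_integrable lebesgue {0..t} (\<lambda>s. exp (- (t - s)) *\<^sub>R bbm_rhs (f s) (u s))"
      using i(2) by (simp only: set_integrable_def)
  qed
  have cont: "((\<lambda>s. sobolev_norm l (u s - u t)) \<longlongrightarrow> 0) (at t within {0..}) \<longleftrightarrow> (a \<longlongrightarrow> a t) (at t within {0..})"
    if a: "\<And>t. 0 \<le> t \<Longrightarrow> u t = bessel l (a t)" and t: "0 \<le> t" for a t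
  proof -
    have "\<forall>\<^sub>F s in at t within {0..}. sobolev_norm l (u s - u t) = norm (a s - a t)"
      unfolding eventually_at_filter using a t
      by (intro always_eventually) (auto simp: sobolev_bessel[OF l(1)] simp flip: diff)
    then have "((\<lambda>s. sobolev_norm l (u s - u t)) \<longlongrightarrow> 0) (at t within {0..})
        \<longleftrightarrow> ((\<lambda>s. norm (a s - a t)) \<longlongrightarrow> 0) (at t within {0..})"
      by (rule tendsto_cong)
    then show ?thesis by (simp add: tendsto_norm_zero_iff Lim_null[of a "a t"])
  qed
  show ?thesis
  proof
    assume L: ?L
    have "u t \<in> sobolev l" if "0 \<le> t" for t using L that unfolding mild_solution_def by blast
    then have "\<forall>t\<in>{0..}. \<exists>b. u t = bessel l b" using sobolev_bessel_ex[OF l(1)] by simp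
    then have "\<exists>a. \<forall>t\<in>{0..}. u t = bessel l (a t)" by (rule bchoice)
    then obtain a where a: "\<And>t. 0 \<le> t \<Longrightarrow> u t = bessel l (a t)" by auto
    have ac: "continuous_on {0..} a"
      unfolding continuous_on_def
    proof
      fix t :: real assume "t \<in> {0..}"
      then have t: "0 \<le> t" by simp
      have "((\<lambda>s. sobolev_norm l (u s - u t)) \<longlongrightarrow> 0) (at t within {0..})"
        using L t unfolding mild_solution_def by blast
      moreover have "((\<lambda>s. sobolev_norm l (u s - u t)) \<longlongrightarrow> 0) (at t within {0..})
          \<longleftrightarrow> (a \<longlongrightarrow> a t) (at t within {0..})"
        by (rule cont) (fact a, fact t)
      ultimately show "(a \<longlongrightarrow> a t) (at t within {0..})" by blast
    qed
    have "a t = exp (- t) *\<^sub>R a 0 + duhamel (\<lambda>s. ?G s + bil l l l (a s) (a s)) t" if t: "0 \<le> t" for t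
    proof -
      have I: "(LINT s:{0..t}|lebesgue. exp (- (t - s)) *\<^sub>R bbm_rhs (f s) (u s))
          = bessel l (duhamel (\<lambda>s. ?G s + bil l l l (a s) (a s)) t)"
        by (rule int(1)[OF ac]) (fact a, fact t)
      have "u t = exp (- t) *\<^sub>R u 0 + (LINT s:{0..t}|lebesgue. exp (- (t - s)) *\<^sub>R bbm_rhs (f s) (u s))"
        using L t unfolding mild_solution_def by blast
      then have "bessel l (a t) = bessel l (exp (- t) *\<^sub>R a 0 + duhamel (\<lambda>s. ?G s + bil l l l (a s) (a s)) t)"
        unfolding I a[OF t] a[OF order_refl]
        by (simp add: linear_add[OF bounded_linear.linear[OF bl]] linear_scale[OF bounded_linear.linear[OF bl]])
      then show ?thesis unfolding bessel_inject[OF l(1)] .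
    qed
    then have "mild_sol ?G a" unfolding mild_def using ac by blast
    then show ?R using a by blast
  next
    assume ?R
    then obtain a where m: "mild_sol ?G a" and a: "\<And>t. 0 \<le> t \<Longrightarrow> u t = bessel l (a t)" by blast
    note ac = mild_continuous[OF m]
    have "u t = exp (- t) *\<^sub>R u 0 + (LINT s:{0..t}|lebesgue. exp (- (t - s)) *\<^sub>R bbm_rhs (f s) (u s))"
      if t: "0 \<le> t" for t
    proof -
      have I: "(LINT s:{0..t}|lebesgue. exp (- (t - s)) *\<^sub>R bbm_rhs (f s) (u s))
          = bessel l (duhamel (\<lambda>s. ?G s + bil l l l (a s) (a s)) t)"
        by (rule int(1)[OF ac]) (fact a, fact t)
      show ?thesis
        unfolding I a[OF t] a[OF order_refl]
        by (subst mild_eq[OF m t])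
           (simp add: linear_add[OF bounded_linear.linear[OF bl]] linear_scale[OF bounded_linear.linear[OF bl]])
    qed
    moreover have "((\<lambda>s. sobolev_norm l (u s - u t)) \<longlongrightarrow> 0) (at t within {0..})" if t: "0 \<le> t" for t
    proof -
      have "((\<lambda>s. sobolev_norm l (u s - u t)) \<longlongrightarrow> 0) (at t within {0..})
          \<longleftrightarrow> (a \<longlongrightarrow> a t) (at t within {0..})"
        by (rule cont) (fact a, fact t)
      then show ?thesis using ac t by (simp add: continuous_on_def)
    qed
    moreover have "u t \<in> sobolev l" if "0 \<le> t" for t using a[OF that] sobolev_bessel(1)[OF l(1)] by simp
    moreover have "set_integrable lebesgue {0..t} (\<lambda>s. exp (- (t - s)) *\<^sub>R bbm_rhs (f s) (u s))"
      if t: "0 \<le> t" for t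
      by (rule int(2)[OF ac]) (fact a, fact t)
    ultimately show ?L unfolding mild_solution_def by blast
  qed
qed

lemma solves_iff:
  assumes f: "forced f m"
  shows "solves l f (bessel l a0) u \<longleftrightarrow>
    (\<exists>a. mild_sol (bessel_forcing l f) a \<and> a 0 = a0 \<and> (\<forall>t\<ge>0. u t = bessel l (a t)))"
  unfolding solves_def mild_solution_iff[OF f] using bessel_inject[OF l(1)] by auto

lemma solves_uniquely_mild_sol:
  assumes f: "forced f m" and a: "mild_sol (bessel_forcing l f) a" and u: "\<And>t. 0 \<le> t \<Longrightarrow> u t = bessel l (a t)"
  shows "solves_uniquely l f (bessel l (a 0)) u"
  unfolding solves_uniquely_def solves_iff[OF f]
proof (intro conjI allI impI)
  show "\<exists>b. mild_sol (bessel_forcing l f) b \<and> b 0 = a 0 \<and> (\<forall>t\<ge>0. u t = bessel l (b t))" using a u by blast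
  fix v and t :: real
  assume "\<exists>b. mild_sol (bessel_forcing l f) b \<and> b 0 = a 0 \<and> (\<forall>t\<ge>0. v t = bessel l (b t))" and t: "0 \<le> t"
  then obtain b where b: "mild_sol (bessel_forcing l f) b" "b 0 = a 0" "\<forall>t\<ge>0. v t = bessel l (b t)" by blast
  then show "v t = u t" using mild_sol_unique[OF forced_bessel_forcing[OF f] b(1) a b(2) t] u[OF t] t by simp
qed

lemma norm_diff_sobolev: "sobolev_norm l (bessel l a - bessel l b) = norm (a - b)"
  using sobolev_bessel(2)[OF l(1), of "a - b"]
  by (simp add: linear_diff[OF bounded_linear.linear[OF bounded_linear_bessel[OF l(1)]]])

lemma data_size_forced:
  assumes f: "forcing_term f" and le: "data_size l (bessel l a) f \<le> ennreal \<delta>" and \<delta>: "0 \<le> \<delta>"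
  obtains m where "0 \<le> m" "norm a + m \<le> \<delta>" "data_size l (bessel l a) f = ennreal (norm a + m)" "forced f m"
proof -
  have eq: "data_size l (bessel l a) f = ennreal (norm a) + forcing_sup f"
    by (simp add: data_size_def sobolev_bessel(2)[OF l(1)])
  have "forcing_sup f \<le> ennreal \<delta>" using le unfolding eq by (rule order_trans[rotated]) simp
  then obtain m where m: "0 \<le> m" "forcing_sup f = ennreal m" "forced f m"
    using forcing_sup_forced[OF f _ \<delta>] by blast
  then have d: "data_size l (bessel l a) f = ennreal (norm a + m)" by (simp add: eq)
  then have "norm a + m \<le> \<delta>" using le \<delta> by simp
  then show ?thesis using that m d by blast
qed

lemma small_data_bounded:
  assumes f: "forcing_term f" and le: "data_size l (bessel l a0) f \<le> ennreal (rad / 2)"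
    and u: "solves l f (bessel l a0) u"
  obtains a m where "mild_sol (bessel_forcing l f) a" "a 0 = a0" "\<And>t. 0 \<le> t \<Longrightarrow> u t = bessel l (a t)"
    "\<And>t. 0 \<le> t \<Longrightarrow> norm (a t) \<le> rad" "0 \<le> m" "data_size l (bessel l a0) f = ennreal (norm a0 + m)"
    "forced (bessel_forcing l f) m"
proof -
  obtain m where m: "0 \<le> m" "norm a0 + m \<le> rad / 2" "data_size l (bessel l a0) f = ennreal (norm a0 + m)" "forced f m"
    using data_size_forced[OF f le] rad_pos by auto
  obtain a where a: "mild_sol (bessel_forcing l f) a" "a 0 = a0" "\<And>t. 0 \<le> t \<Longrightarrow> u t = bessel l (a t)"
    using u unfolding solves_iff[OF m(4)] by blast
  note G = forced_bessel_forcing[OF m(4)]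
  have "m \<le> rad / 2" "norm a0 \<le> rad" using m(1,2) norm_ge_zero[of a0] rad_pos by linarith+
  then have "norm (a t) \<le> rad" if "0 \<le> t" for t
    using small_bounded[OF forced_mono[OF G] a(1)] a(2) that by simp
  then show ?thesis using that a m G by blast
qed

text \<open>Data of size at most \<open>rad / 2\<close> have initial coordinate in the ball of
  radius \<open>rad\<close> and forcing below \<open>rad / 2\<close>, so the small-data estimates
  hold for all times.\<close>

lemma well_posed_below_rad:
  assumes \<tau>: "0 \<le> \<tau>" "0 < T" shows "well_posed_below l \<tau> T (rad / 2)"
  unfolding well_posed_below_def
proof (intro conjI ballI allI impI)
  fix \<phi> f assume \<phi>: "\<phi> \<in> sobolev l" and f: "forcing_term f \<and> data_size l \<phi> f \<le> ennreal (rad / 2)"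
  obtain a0 where a0: "\<phi> = bessel l a0" using sobolev_bessel_ex[OF l(1) \<phi>] by blast
  obtain m where m: "0 \<le> m" "norm a0 + m \<le> rad / 2" "forced f m"
    using data_size_forced[of f a0 "rad / 2"] f rad_pos unfolding a0 by auto
  have "m \<le> rad / 2" using m(2) norm_ge_zero[of a0] by linarith
  then obtain a where a: "mild_sol (bessel_forcing l f) a" "a 0 = a0"
    using mild_sol_exists[OF forced_mono[OF forced_bessel_forcing[OF m(3)]]] by blast
  show "\<exists>u. solves_uniquely l f \<phi> u"
    using solves_uniquely_mild_sol[OF m(3) a(1), of "\<lambda>t. bessel l (a t)"] by (auto simp: a0 a(2))
next
  fix \<phi> f u and S \<epsilon> :: real assume \<phi>: "\<phi> \<in> sobolev l"
    and A: "forcing_term f \<and> data_size l \<phi> f \<le> ennreal (rad / 2) \<and> solves l f \<phi> u \<and> 0 < S \<and> 0 < \<epsilon>"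
  obtain a0 where a0: "\<phi> = bessel l a0" using sobolev_bessel_ex[OF l(1) \<phi>] by blast
  obtain a m where a: "mild_sol (bessel_forcing l f) a" "a 0 = a0" "\<And>t. 0 \<le> t \<Longrightarrow> u t = bessel l (a t)"
    "\<And>t. 0 \<le> t \<Longrightarrow> norm (a t) \<le> rad" "forced (bessel_forcing l f) m"
    using small_data_bounded[of f a0 u] A unfolding a0 by blast
  show "\<exists>\<eta>>0. \<forall>\<psi>\<in>sobolev l. \<forall>g v. forcing_term g \<and> data_size l \<psi> g \<le> ennreal (rad / 2) \<and> solves l g \<psi> v \<and>
           data_size l (\<psi> - \<phi>) (\<lambda>t. g t - f t) < ennreal \<eta> \<longrightarrow>
           (\<forall>t\<in>{0..S}. sobolev_norm l (v t - u t) < \<epsilon>)"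
  \<comment> \<open>Half of \<open>\<epsilon>\<close> compensates the factor 2 in
    \<open>small_dependence\<close>, which is uniform in time and thus covers every
    \<open>S\<close>.\<close>
  proof (intro exI[of _ "\<epsilon> / 2"] conjI ballI allI impI)
    show "0 < \<epsilon> / 2" using A by simp
    fix \<psi> g v t assume \<psi>: "\<psi> \<in> sobolev l" and B: "forcing_term g \<and> data_size l \<psi> g \<le> ennreal (rad / 2) \<and>
      solves l g \<psi> v \<and> data_size l (\<psi> - \<phi>) (\<lambda>t. g t - f t) < ennreal (\<epsilon> / 2)" and t: "t \<in> {0..S}"
    obtain b0 where b0: "\<psi> = bessel l b0" using sobolev_bessel_ex[OF l(1) \<psi>] by blast
    obtain b m' where b: "mild_sol (bessel_forcing l g) b" "b 0 = b0" "\<And>t. 0 \<le> t \<Longrightarrow> v t = bessel l (b t)"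
      "\<And>t. 0 \<le> t \<Longrightarrow> norm (b t) \<le> rad" "forced (bessel_forcing l g) m'"
      using small_data_bounded[of g b0 v] B unfolding b0 by blast
    have d: "data_size l (bessel l (b0 - a0)) (\<lambda>t. g t - f t) < ennreal (\<epsilon> / 2)"
      using B by (simp add: a0 b0 linear_diff[OF bounded_linear.linear[OF bounded_linear_bessel[OF l(1)]]])
    have ft: "forcing_term (\<lambda>t. g t - f t)" using A B by (auto simp: forcing_term_def)
    have e0: "0 \<le> \<epsilon> / 2" using A by simp
    obtain e where e: "data_size l (bessel l (b0 - a0)) (\<lambda>t. g t - f t) = ennreal (norm (b0 - a0) + e)"
      "forced (\<lambda>t. g t - f t) e" "0 \<le> e"
      using data_size_forced[OF ft less_imp_le[OF d] e0] by blast
    have "norm (b0 - a0) + e < \<epsilon> / 2"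
      using d e(3) unfolding e(1) by (subst (asm) ennreal_less_iff) auto
    moreover have "norm (b t - a t) \<le> 2 * (norm (b 0 - a 0) + e)"
    proof (rule small_dependence[OF b(5,1) a(5,1) b(4) a(4)])
      fix s :: real assume s: "0 \<le> s"
      have "bessel_forcing l g s - bessel_forcing l f s = bessel (2 - l) (g s - f s)"
        using l by (simp add: bessel_forcing_def linear_diff[OF bounded_linear.linear[OF bounded_linear_bessel]])
      then show "norm (bessel_forcing l g s - bessel_forcing l f s) \<le> e"
        using l s e(2) norm_bessel_le[of "2 - l" "g s - f s"] by (simp add: forced_def) (meson order_trans)
    qed (use t in auto)
    ultimately show "sobolev_norm l (v t - u t) < \<epsilon>"
      using t by (simp add: a(2,3) b(2,3) norm_diff_sobolev)
  qed
next
  show "\<exists>C::real. \<forall>\<phi>\<in>sobolev l. \<forall>f u.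
        forcing_term f \<and> data_size l \<phi> f \<le> ennreal (rad / 2) \<and> solves l f \<phi> u \<longrightarrow>
        (SUP s\<in>{\<tau>..\<tau> + T}. ennreal (sobolev_norm l (u s)))
          + ennreal (sqrt (LINT s:{\<tau>..\<tau> + T}|lebesgue. (sobolev_norm l (u s))\<^sup>2))
        \<le> ennreal C * data_size l \<phi> f"
  \<comment> \<open>By \<open>small_linear_bound\<close> the norm is at most twice the data size
    \<open>d\<close>; the supremum contributes \<open>2 * d\<close>, the root of the integrated
    square \<open>2 * d * sqrt T\<close>.\<close>
  proof (intro exI[of _ "2 + 2 * sqrt T"] ballI allI impI)
    fix \<phi> f u assume \<phi>: "\<phi> \<in> sobolev l"
      and A: "forcing_term f \<and> data_size l \<phi> f \<le> ennreal (rad / 2) \<and> solves l f \<phi> u"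
    obtain a0 where a0: "\<phi> = bessel l a0" using sobolev_bessel_ex[OF l(1) \<phi>] by blast
    obtain a m where a: "mild_sol (bessel_forcing l f) a" "a 0 = a0" "\<And>t. 0 \<le> t \<Longrightarrow> u t = bessel l (a t)"
      "\<And>t. 0 \<le> t \<Longrightarrow> norm (a t) \<le> rad" "0 \<le> m" "data_size l \<phi> f = ennreal (norm a0 + m)"
      "forced (bessel_forcing l f) m"
      using small_data_bounded[of f a0 u] A unfolding a0 by blast
    define d where "d = norm a0 + m"
    have d: "0 \<le> d" using a(5) by (simp add: d_def)
    have b: "sobolev_norm l (u s) \<le> 2 * d" "0 \<le> sobolev_norm l (u s)" if "s \<in> {\<tau>..\<tau> + T}" for s
      using small_linear_bound[OF a(7,1,4), of s] that \<tau> by (auto simp: a(2,3) d_def sobolev_bessel(2)[OF l(1)])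
    have "(LINT s:{\<tau>..\<tau> + T}|lebesgue. (sobolev_norm l (u s))\<^sup>2) \<le> (2 * d)\<^sup>2 * T"
      using \<tau> b by (intro set_integral_le_length power_mono) auto
    then have "sqrt (LINT s:{\<tau>..\<tau> + T}|lebesgue. (sobolev_norm l (u s))\<^sup>2) \<le> sqrt ((2 * d)\<^sup>2 * T)"
      by (rule real_sqrt_le_mono)
    also have "\<dots> = 2 * d * sqrt T" using d by (simp add: real_sqrt_mult)
    finally have 1: "ennreal (sqrt (LINT s:{\<tau>..\<tau> + T}|lebesgue. (sobolev_norm l (u s))\<^sup>2)) \<le> ennreal (2 * d * sqrt T)"
      by (rule ennreal_leI)
    have 2: "(SUP s\<in>{\<tau>..\<tau> + T}. ennreal (sobolev_norm l (u s))) \<le> ennreal (2 * d)"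
      by (intro SUP_least ennreal_leI b)
    have "ennreal (2 * d) + ennreal (2 * d * sqrt T) = ennreal (2 + 2 * sqrt T) * ennreal d"
      using d \<tau> by (simp add: algebra_simps flip: ennreal_mult ennreal_plus)
    then show "(SUP s\<in>{\<tau>..\<tau> + T}. ennreal (sobolev_norm l (u s)))
          + ennreal (sqrt (LINT s:{\<tau>..\<tau> + T}|lebesgue. (sobolev_norm l (u s))\<^sup>2))
        \<le> ennreal (2 + 2 * sqrt T) * data_size l \<phi> f"
      using add_mono[OF 2 1] by (simp add: a(6) d_def)
  qed
qed

lemma periodic_solution_exists:
  assumes f: "forced f (rad / 2)" and per: "time_periodic \<theta> f" and \<theta>: "0 < \<theta>"
  shows "\<exists>\<phi>'\<in>sobolev l. \<exists>u'. solves_uniquely l f \<phi>' u' \<and> periodic_solution l \<theta> f u' \<and>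
    (\<forall>v. periodic_solution l \<theta> f v \<longrightarrow> (\<forall>t\<ge>0. v t = u' t))"
proof -
  let ?G = "bessel_forcing l f"
  note G = forced_bessel_forcing[OF f]
  have "?G (t + \<theta>) = ?G t" if "0 \<le> t" for t using per that by (simp add: bessel_forcing_def time_periodic_def)
  from small_periodic[OF G \<theta> this] obtain a where a: "mild_sol ?G a" "\<And>t. 0 \<le> t \<Longrightarrow> a (t + \<theta>) = a t"
    by blast
  define u' where "u' t = bessel l (a t)" for t
  have uniq: "v t = u' t" if v: "periodic_solution l \<theta> f v" and t: "0 \<le> t" for v t
  proof -
    obtain b where b: "mild_sol ?G b" "\<And>t. 0 \<le> t \<Longrightarrow> v t = bessel l (b t)"
      using v unfolding periodic_solution_def mild_solution_iff[OF f] by blast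
    have bper: "b (t + \<theta>) = b t" if "0 \<le> t" for t
    proof -
      have "bessel l (b (t + \<theta>)) = bessel l (b t)"
        using v b(2)[of t] b(2)[of "t + \<theta>"] \<theta> that by (simp add: periodic_solution_def time_periodic_def)
      then show ?thesis unfolding bessel_inject[OF l(1)] .
    qed
    obtain C where C: "\<And>t. 0 \<le> t \<Longrightarrow> norm (b t - a t) \<le> C * exp (- t / 2)"
      using mild_sol_attraction[OF G b(1) a(1)] by blast
    have shift: "b (t + real n * \<theta>) = b t \<and> a (t + real n * \<theta>) = a t" for n
    proof (induction n)
      case (Suc n)
      have e: "t + real (Suc n) * \<theta> = (t + real n * \<theta>) + \<theta>" by (simp add: algebra_simps)
      show ?case
        unfolding e using Suc bper[of "t + real n * \<theta>"] a(2)[of "t + real n * \<theta>"] t \<theta> by simp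
    qed simp
    \<comment> \<open>Attraction is evaluated after \<open>n\<close> periods, when both solutions
      have returned to their values at \<open>t\<close>; letting \<open>n\<close> grow forces the
      difference to be 0.\<close>
    have "norm (b t - a t) \<le> C * exp (- t / 2) * exp (- \<theta> / 2) ^ n" for n
    proof -
      have "exp (- (t + real n * \<theta>) / 2) = exp (- t / 2) * exp (- \<theta> / 2) ^ n"
        by (simp add: exp_add[symmetric] exp_of_nat_mult[symmetric] add_divide_distrib)
      then show ?thesis using C[of "t + real n * \<theta>"] shift[of n] t \<theta> by simp
    qed
    moreover have "(\<lambda>n. C * exp (- t / 2) * exp (- \<theta> / 2) ^ n) \<longlonglongrightarrow> C * exp (- t / 2) * 0"
      using \<theta> by (intro tendsto_mult tendsto_const LIMSEQ_power_zero) simp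
    ultimately have "norm (b t - a t) \<le> 0" by (intro LIMSEQ_le_const[of _ 0]) auto
    then show ?thesis using b(2)[OF t] by (simp add: u'_def)
  qed
  have "solves_uniquely l f (bessel l (a 0)) u'"
    by (rule solves_uniquely_mild_sol[OF f a(1)]) (simp add: u'_def)
  moreover have "periodic_solution l \<theta> f u'"
    unfolding periodic_solution_def mild_solution_iff[OF f] time_periodic_def
    using a by (auto simp: u'_def intro!: exI[of _ a])
  ultimately show ?thesis using uniq sobolev_bessel(1)[OF l(1)] by blast
qed

text \<open>The rate is written as twice 1/4 to match the form in which decay rates are stated; it
  is the rate 1/2 of \<open>mild_sol_attraction\<close>.\<close>

lemma exp_attracted_forced:
  assumes f: "forced f (rad / 2)" and u: "mild_solution l f u'" and \<phi>: "\<phi> \<in> sobolev l"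
  shows "exp_attracted l f u' (2 * (1 / 4)) \<phi>"
proof -
  let ?G = "bessel_forcing l f"
  note G = forced_bessel_forcing[OF f]
  obtain b where b: "mild_sol ?G b" "\<And>t. 0 \<le> t \<Longrightarrow> u' t = bessel l (b t)"
    using u unfolding mild_solution_iff[OF f] by blast
  obtain a0 where a0: "\<phi> = bessel l a0" using sobolev_bessel_ex[OF l(1) \<phi>] by blast
  obtain a where a: "mild_sol ?G a" "a 0 = a0" using mild_sol_exists[OF G] by blast
  obtain C where C: "\<And>t. 0 \<le> t \<Longrightarrow> norm (a t - b t) \<le> C * exp (- t / 2)"
    using mild_sol_attraction[OF G a(1) b(1)] by blast
  have "solves_uniquely l f \<phi> (\<lambda>t. bessel l (a t))"
    using solves_uniquely_mild_sol[OF f a(1), of "\<lambda>t. bessel l (a t)"] by (simp add: a0 a(2))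
  then show ?thesis
    unfolding exp_attracted_def using C b(2)
    by (intro exI[of _ "\<lambda>t. bessel l (a t)"] conjI exI[of _ C]) (auto simp: norm_diff_sobolev)
qed

end

text \<open>Since \<open>K\<close> is 1 for \<open>bil l l l\<close>, \<open>rad\<close> is 1/8 and
  the threshold \<open>rad / 2\<close> equals 1/16.\<close>

theorem theorem2p4:
  fixes l \<theta> \<tau> T :: real
  assumes "0 \<le> l" and "l < 1" and "0 < \<theta>" and "0 \<le> \<tau>" and "0 < T"
  shows "\<exists>\<delta>>0. well_posed_below l \<tau> T \<delta> \<and>
    (\<forall>f. forcing_term f \<and> time_periodic \<theta> f \<longrightarrow>
       (\<forall>\<phi>\<in>sobolev l. data_size l \<phi> f \<le> ennreal \<delta> \<longrightarrow>
          (\<exists>\<phi>'\<in>sobolev l. \<exists>u'. solves_uniquely l f \<phi>' u' \<and> periodic_solution l \<theta> f u' \<and>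
             (\<forall>v. periodic_solution l \<theta> f v \<longrightarrow> (\<forall>t\<ge>0. v t = u' t)))) \<and>
       (\<forall>\<phi>\<in>sobolev l. data_size l \<phi> f \<le> ennreal \<delta> \<longrightarrow>
          (\<forall>u'. periodic_solution l \<theta> f u' \<longrightarrow>
             (\<exists>N\<^sub>0::nat. \<exists>\<gamma>\<^sub>0>0. locally_exp_stable l f u' (2 * \<gamma>\<^sub>0)))) \<and>
       (\<forall>\<phi>\<in>sobolev l. forcing_sup f < ennreal \<delta> \<longrightarrow>
          (\<forall>u'. periodic_solution l \<theta> f u' \<longrightarrow>
             (\<exists>N\<^sub>1::nat. \<exists>\<gamma>\<^sub>1>0. exp_attracted l f u' (2 * \<gamma>\<^sub>1) \<phi>))))"
proof -
  interpret smoothing_quadratic "bil l l l" 1 "bil 1 0 1" "bessel l" "bessel (1 - l)"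
    by (rule smoothing_quadratic_bil[OF assms(1,2)])
  have forced: "forced f (rad / 2)" if f: "forcing_term f" "forcing_sup f \<le> ennreal (rad / 2)" for f
  proof -
    have "0 \<le> rad / 2" using rad_pos by simp
    then obtain m where "m \<le> rad / 2" "forced f m" using forcing_sup_forced[OF f] by blast
    then show ?thesis using forced_mono by blast
  qed
  have sup: "forcing_sup f \<le> ennreal (rad / 2)" if "data_size l \<phi> f \<le> ennreal (rad / 2)" for \<phi> f
    using that unfolding data_size_def by (rule order_trans[rotated]) simp
  have attr: "\<exists>\<gamma>>0. exp_attracted l f u' (2 * \<gamma>) \<phi>"
    if "forced f (rad / 2)" "periodic_solution l \<theta> f u'" "\<phi> \<in> sobolev l" for f u' \<phi>
    using exp_attracted_forced[OF assms(1,2) that(1) _ that(3), of u'] that(2)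
    by (intro exI[of _ "1 / 4"]) (simp add: periodic_solution_def)
  \<comment> \<open>The decay rate \<open>1/2\<close> is absolute, so the truncation parameters play no role.\<close>
  show ?thesis
  proof (intro exI[of _ "rad / 2"] conjI allI impI ballI)
    show "0 < rad / 2" using rad_pos by simp
    show "well_posed_below l \<tau> T (rad / 2)" by (rule well_posed_below_rad[OF assms(1,2,4,5)])
  next
    fix f \<phi> assume "forcing_term f \<and> time_periodic \<theta> f" "data_size l \<phi> f \<le> ennreal (rad / 2)"
    then show "\<exists>\<phi>'\<in>sobolev l. \<exists>u'. solves_uniquely l f \<phi>' u' \<and> periodic_solution l \<theta> f u' \<and>
        (\<forall>v. periodic_solution l \<theta> f v \<longrightarrow> (\<forall>t\<ge>0. v t = u' t))"
      using periodic_solution_exists[OF assms(1,2) forced[OF _ sup] _ assms(3)] by blast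
  next
    fix f \<phi> u' assume "forcing_term f \<and> time_periodic \<theta> f" "data_size l \<phi> f \<le> ennreal (rad / 2)"
      and u': "periodic_solution l \<theta> f u'"
    then have f: "forced f (rad / 2)" using forced[OF _ sup] by blast
    \<comment> \<open>Attraction holds from every initial value, so any radius can serve as the
      neighbourhood; 1 is taken.\<close>
    have "locally_exp_stable l f u' (2 * (1 / 4))"
      unfolding locally_exp_stable_def
      using exp_attracted_forced[OF assms(1,2) f] u' by (intro exI[of _ 1]) (auto simp: periodic_solution_def)
    then show "\<exists>N\<^sub>0::nat. \<exists>\<gamma>\<^sub>0>0. locally_exp_stable l f u' (2 * \<gamma>\<^sub>0)"
      by (intro exI[of _ "0::nat"] exI[of _ "1 / 4"]) simp
  next
    fix f \<phi> u' assume "forcing_term f \<and> time_periodic \<theta> f" "forcing_sup f < ennreal (rad / 2)"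
      "periodic_solution l \<theta> f u'" "\<phi> \<in> sobolev l"
    then show "\<exists>N\<^sub>1::nat. \<exists>\<gamma>\<^sub>1>0. exp_attracted l f u' (2 * \<gamma>\<^sub>1) \<phi>"
      using attr[OF forced[OF _ less_imp_le]] by (intro exI[of _ "0::nat"]) blast
  qed
qed

end
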